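(* Consider the two-source state $\rho_s$, $s=(s_1,s_2,s_3)\in\mathbb R^3$, on $L^2(D_a)$, where $D_a$ is the disk of radius $a$, and let $\{|Z_n^m\rangle\}$ be the orthonormal Zernike basis. The projective measurement consisting of $$\Pi_2=\sum_{n=0}^\infty|Z_{2n+1}^1\rangle\langle Z_{2n+1}^1|,\quad \Pi_3=\sum_{n=0}^\infty|Z_{2n+1}^{-1}\rangle\langle Z_{2n+1}^{-1}|,\quad \Pi_1=1-\Pi_2-\Pi_3$$ is optimal for the estimation of the transverse separation (parameters $s_1,s_2$) on the line $s_\perp=0$: at every point $s_0=(0,0,s_3)$, for each of these three projectors the matrix bound of the classical Fisher information for $(s_1,s_2)$ is saturated at $s_0$.
   Context: State. Fix $a>0$ and $k>0$. For $s=(s_1,s_2,s_3)$, $s_\perp=(s_1,s_2)$ and $r=(x_1,x_2)\in D_a=\{|r|\le a\}$, let $\Phi_s(r)=\frac{1}{\sqrt\pi\,a}\exp[\mathrm i k(s_\perp\cdot r-s_3|r|^2/2)]$. The one-photon state of two incoherent point sources at $\pm s$ is $\rho_s=\tfrac12|\Phi_s\rangle\langle\Phi_s|+\tfrac12|\Phi_{-s}\rangle\langle\Phi_{-s}|$ (rank $2$ for $s\ne0$, rank $1$ at $s=0$). Write $\partial_i=\partial/\partial s_i$. Zernike basis. For integers $n\ge0$ and $m$ with $|m|\le n$, $n-|m|$ even, in polar coordinates $(|r|,\phi)$, $Z_n^m$ is the $L^2(D_a)$-normalized multiple of $R_n^{|m|}(|r|/a)\cos(m\phi)$ for $m\ge0$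 and of $R_n^{|m|}(|r|/a)\sin(|m|\phi)$ for $m<0$, where $R_n^{m}(\varrho)=\sum_{l=0}^{(n-m)/2}\frac{(-1)^l(n-l)!}{l!\,(\frac{n+m}2-l)!\,(\frac{n-m}2-l)!}\varrho^{n-2l}$. These form an orthonormal basis of $L^2(D_a)$. Fisher information of a projector $\Pi$ for the transverse parameters. For $s\neq0$, $L_{is}$ is a bounded self-adjoint solution of $\tfrac12(L_{is}\rho_s+\rho_sL_{is})=\partial_i\rho_s$ and $\mathcal I_{ij}(s)=\operatorname{Re}\operatorname{Tr}(\rho_sL_{is}\Pi L_{js})$, $i,j\in\{1,2\}$. With $h(s)=\operatorname{Tr}(\rho_s\Pi)$, $\mathcal F_{ij}(s)=\partial_ih(s)\partial_jh(s)/h(s)$, $i,j\in\{1,2\}$, where $h(s)>0$. One has $\mathcal F\le\mathcal I$ as $2\times2$ matrices. Saturation at $s_0$. Directions are $v=(v_1,v_2,0)\ne0$. If $h(s_0)>0$ ($\Pi$ regular), it means $\lim_{t\to0}\mathcal F(s_0+tv)=\lim_{t\to0}\mathcal I(s_0+tv)$ for every direction $v$. If $h(s_0)=0$ ($\Pi$ null), it means the same equality for every direction $v$ with $\sum_{p,q\in\{1,2\}}\partial_p\partial_qh(s_0)v_pv_q>0$; if this $2\times2$ Hessian is zero, the limit of $\mathcal F$ is taken to be $0$ for every direction $v$. *)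

theory Defs
  imports "HOL-Analysis.Analysis"
begin

section \<open>The Hilbert space \<open>L\<^sup>2(D\<^sub>a)\<close> and its operators\<close>

text \<open>
  Elements of \<open>L\<^sup>2(D\<^sub>a)\<close> are represented by functions on the plane, of which only the class
  modulo equality almost everywhere on \<open>D\<^sub>a\<close> matters. Operators act on representatives; every
  notion below is insensitive to the choice of representatives. Inner products are conjugate-linear
  in the first argument.
\<close>

type_synonym wavefun = "real^2 \<Rightarrow> complex"
type_synonym wave_op = "wavefun \<Rightarrow> wavefun"

definition disk_measure :: "real \<Rightarrow> (real^2) measure" where
  "disk_measure a = lebesgue_on (cball 0 a)"

definition L2 :: "real \<Rightarrow> wavefun set" where
  "L2 a = {f \<in> borel_measurable (disk_measure a). integrable (disk_measure a) (\<lambda>r. (cmod (f r))\<^sup>2)}"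

definition inner_L2 :: "real \<Rightarrow> wavefun \<Rightarrow> wavefun \<Rightarrow> complex" where
  "inner_L2 a f g = (LINT r|disk_measure a. cnj (f r) * g r)"

definition norm_L2 :: "real \<Rightarrow> wavefun \<Rightarrow> real" where
  "norm_L2 a f = sqrt (LINT r|disk_measure a. (cmod (f r))\<^sup>2)"

definition onb :: "real \<Rightarrow> wavefun set \<Rightarrow> bool" where
  "onb a E \<longleftrightarrow> E \<subseteq> L2 a
     \<and> (\<forall>e\<in>E. \<forall>e'\<in>E. inner_L2 a e e' = (if e = e' then 1 else 0))
     \<and> (\<forall>f\<in>L2 a. ((\<lambda>F. norm_L2 a (\<lambda>r. f r - (\<Sum>e\<in>F. inner_L2 a e f * e r))) \<longlongrightarrow> 0)
                    (finite_subsets_at_top E))"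

definition bounded_op :: "real \<Rightarrow> wave_op \<Rightarrow> bool" where
  "bounded_op a T \<longleftrightarrow> (\<forall>f\<in>L2 a. T f \<in> L2 a)
     \<and> (\<forall>f\<in>L2 a. \<forall>g\<in>L2 a. AE r in disk_measure a. T (\<lambda>x. f x + g x) r = T f r + T g r)
     \<and> (\<forall>f\<in>L2 a. \<forall>c. AE r in disk_measure a. T (\<lambda>x. c * f x) r = c * T f r)
     \<and> (\<exists>C. \<forall>f\<in>L2 a. norm_L2 a (T f) \<le> C * norm_L2 a f)"

definition self_adjoint :: "real \<Rightarrow> wave_op \<Rightarrow> bool" where
  "self_adjoint a T \<longleftrightarrow> (\<forall>f\<in>L2 a. \<forall>g\<in>L2 a. inner_L2 a f (T g) = inner_L2 a (T f) g)"

definition projector :: "real \<Rightarrow> wave_op \<Rightarrow> bool" where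
  "projector a P \<longleftrightarrow> bounded_op a P \<and> self_adjoint a P
     \<and> (\<forall>f\<in>L2 a. AE r in disk_measure a. P (P f) r = P f r)"

definition op_norm :: "real \<Rightarrow> wave_op \<Rightarrow> real" where
  "op_norm a T = (SUP f\<in>{f \<in> L2 a. norm_L2 a f \<le> 1}. norm_L2 a (T f))"

text \<open>The trace is the value, common to all orthonormal bases, of the sum of the diagonal entries.\<close>

definition op_trace :: "real \<Rightarrow> wave_op \<Rightarrow> complex" where
  "op_trace a A = (THE t. \<forall>E. onb a E \<longrightarrow> ((\<lambda>e. inner_L2 a e (A e)) has_sum t) E)"

definition ketbra :: "real \<Rightarrow> wavefun \<Rightarrow> wavefun \<Rightarrow> wave_op" where
  "ketbra a u v = (\<lambda>f r. u r * inner_L2 a v f)"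


section \<open>The two-source state\<close>

definition Phi :: "real \<Rightarrow> real \<Rightarrow> real^3 \<Rightarrow> wavefun" where
  "Phi a k s = (\<lambda>r. complex_of_real (1 / (sqrt pi * a)) *
     exp (\<i> * complex_of_real (k * (s$1 * r$1 + s$2 * r$2 - s$3 * (norm r)\<^sup>2 / 2))))"

definition rho :: "real \<Rightarrow> real \<Rightarrow> real^3 \<Rightarrow> wave_op" where
  "rho a k s = (\<lambda>f r. 1/2 * ketbra a (Phi a k s) (Phi a k s) f r
                     + 1/2 * ketbra a (Phi a k (- s)) (Phi a k (- s)) f r)"


section \<open>The Zernike basis\<close>

definition zernike_radial :: "nat \<Rightarrow> nat \<Rightarrow> real \<Rightarrow> real" where
  "zernike_radial n m x = (\<Sum>l=0..(n - m) div 2.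
     (-1) ^ l * fact (n - l) / (fact l * fact ((n + m) div 2 - l) * fact ((n - m) div 2 - l))
       * x ^ (n - 2 * l))"

definition polar_angle :: "real^2 \<Rightarrow> real" where
  "polar_angle r = Arg (Complex (r$1) (r$2))"

definition zernike_unnormalized :: "real \<Rightarrow> nat \<Rightarrow> int \<Rightarrow> wavefun" where
  "zernike_unnormalized a n m = (\<lambda>r. complex_of_real (zernike_radial n (nat \<bar>m\<bar>) (norm r / a) *
     (if m \<ge> 0 then cos (of_int m * polar_angle r) else sin (of_int \<bar>m\<bar> * polar_angle r))))"

text \<open>Meaningful when \<open>\<bar>m\<bar> \<le> n\<close> and \<open>n - \<bar>m\<bar>\<close> is even.\<close>

definition Zernike :: "real \<Rightarrow> nat \<Rightarrow> int \<Rightarrow> wavefun" where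
  "Zernike a n m = (\<lambda>r. zernike_unnormalized a n m r
     / complex_of_real (norm_L2 a (zernike_unnormalized a n m)))"

text \<open>
  \<open>P\<close> is the sum over \<open>n \<ge> 0\<close> of the rank-one projectors onto \<open>Zernike a (2n+1) m\<close>, in the strong
  operator topology. This determines \<open>P f\<close> up to equality almost everywhere.
\<close>

definition odd_zernike_sum :: "real \<Rightarrow> int \<Rightarrow> wave_op \<Rightarrow> bool" where
  "odd_zernike_sum a m P \<longleftrightarrow> (\<forall>f\<in>L2 a. P f \<in> L2 a \<and>
     (\<lambda>N. norm_L2 a (\<lambda>r. P f r -
        (\<Sum>n<N. ketbra a (Zernike a (2 * n + 1) m) (Zernike a (2 * n + 1) m) f r)))
     \<longlonglongrightarrow> 0)"


section \<open>Fisher information for the transverse parameters\<close>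

text \<open>
  The transverse parameters are indexed by the type \<open>2\<close>; \<open>transverse\<close> embeds the plane of transverse
  directions into the parameter space.
\<close>

definition transverse :: "real^2 \<Rightarrow> real^3" where
  "transverse v = vector [v$1, v$2, 0]"

definition partial :: "2 \<Rightarrow> (real^3 \<Rightarrow> real) \<Rightarrow> real^3 \<Rightarrow> real" where
  "partial i h s = deriv (\<lambda>t. h (s + t *\<^sub>R transverse (axis i 1))) 0"

text \<open>\<open>D\<close> is the partial derivative of \<open>rho\<close> at \<open>s\<close>, in operator norm.\<close>

definition has_partial_rho :: "real \<Rightarrow> real \<Rightarrow> 2 \<Rightarrow> real^3 \<Rightarrow> wave_op \<Rightarrow> bool" where
  "has_partial_rho a k i s D \<longleftrightarrow>
     ((\<lambda>t. op_norm a (\<lambda>f r.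
         (rho a k (s + t *\<^sub>R transverse (axis i 1)) f r - rho a k s f r) / complex_of_real t
         - D f r)) \<longlongrightarrow> 0) (at 0)"

definition is_sld :: "real \<Rightarrow> real \<Rightarrow> 2 \<Rightarrow> real^3 \<Rightarrow> wave_op \<Rightarrow> bool" where
  "is_sld a k i s T \<longleftrightarrow> bounded_op a T \<and> self_adjoint a T \<and>
     has_partial_rho a k i s (\<lambda>f r. 1/2 * (T (rho a k s f) r + rho a k s (T f) r))"

definition quantum_bound ::
    "real \<Rightarrow> real \<Rightarrow> (2 \<Rightarrow> real^3 \<Rightarrow> wave_op) \<Rightarrow> wave_op \<Rightarrow> real^3 \<Rightarrow> real^2^2" where
  "quantum_bound a k L P s =
     (\<chi> i j. Re (op_trace a (rho a k s \<circ> L i s \<circ> P \<circ> L j s)))"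

text \<open>The trace is real for self-adjoint \<open>P\<close>.\<close>

definition prob :: "real \<Rightarrow> real \<Rightarrow> wave_op \<Rightarrow> real^3 \<Rightarrow> real" where
  "prob a k P s = Re (op_trace a (rho a k s \<circ> P))"

definition classical_fisher :: "real \<Rightarrow> real \<Rightarrow> wave_op \<Rightarrow> real^3 \<Rightarrow> real^2^2" where
  "classical_fisher a k P s =
     (\<chi> i j. partial i (prob a k P) s * partial j (prob a k P) s / prob a k P s)"

definition hessian :: "(real^3 \<Rightarrow> real) \<Rightarrow> real^3 \<Rightarrow> real^2^2" where
  "hessian h s = (\<chi> p q. partial p (partial q h) s)"

definition equal_limits ::
    "real \<Rightarrow> real \<Rightarrow> (2 \<Rightarrow> real^3 \<Rightarrow> wave_op) \<Rightarrow> wave_op \<Rightarrow> real^3 \<Rightarrow> real^2 \<Rightarrow> bool" where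
  "equal_limits a k L P s0 v \<longleftrightarrow> (\<exists>M.
     ((\<lambda>t. classical_fisher a k P (s0 + t *\<^sub>R transverse v)) \<longlongrightarrow> M) (at 0) \<and>
     ((\<lambda>t. quantum_bound a k L P (s0 + t *\<^sub>R transverse v)) \<longlongrightarrow> M) (at 0))"

text \<open>
  The three clauses: \<open>P\<close> regular; \<open>P\<close> null; \<open>P\<close> null with vanishing Hessian, where the limit of the
  classical information is 0 by convention.
\<close>

definition saturated_at ::
    "real \<Rightarrow> real \<Rightarrow> (2 \<Rightarrow> real^3 \<Rightarrow> wave_op) \<Rightarrow> wave_op \<Rightarrow> real^3 \<Rightarrow> bool" where
  "saturated_at a k L P s0 \<longleftrightarrow>
     (prob a k P s0 > 0 \<longrightarrow> (\<forall>v. v \<noteq> 0 \<longrightarrow> equal_limits a k L P s0 v)) \<and>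
     (prob a k P s0 = 0 \<longrightarrow>
        (\<forall>v. (\<Sum>p\<in>UNIV. \<Sum>q\<in>UNIV. hessian (prob a k P) s0 $ p $ q * v $ p * v $ q) > 0
             \<longrightarrow> equal_limits a k L P s0 v) \<and>
        (hessian (prob a k P) s0 = 0 \<longrightarrow>
           (\<forall>v. v \<noteq> 0 \<longrightarrow>
              ((\<lambda>t. quantum_bound a k L P (s0 + t *\<^sub>R transverse v)) \<longlongrightarrow> 0) (at 0))))"

end

(*
  For s_perp = (s1,s2) <> 0 the wave functions Phi_s and Phi_{-s} are linearly independent, each
  has centroid 0, and d_i Phi_s = i k x_i Phi_s. This forces every symmetric logarithmic derivative
  to act on the two states by L_i Phi_s = 2 d_i Phi_s (for both signs of s), so that I_ij is
  2 Re <d_i Phi_s, Pi d_j Phi_s> summed over the two signs, which is continuous up to the line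
  s_perp = 0.

  At s0 = (0,0,s3) the function Phi_{s0} is radial. The ranges of Pi_2 and Pi_3 consist of x_1 and
  x_2 times radial functions, so both annihilate Phi_{s0} and are null; Pi_2 fixes x_1 Phi_{s0} and
  kills x_2 Phi_{s0}, and conversely for Pi_3. Hence the Hessian of the probability of Pi_2 or Pi_3
  is diag(c,0) or diag(0,c), and F and I both tend to twice it. Pi_1 kills both x_i Phi_{s0}, so its
  F and I tend to 0.
*)
theory Submission
  imports Defs
begin

section \<open>The space of square-integrable functions on the disk\<close>

text \<open>\<open>op_trace\<close> is a definite description over all orthonormal bases, so it says
  nothing until one basis is known to exist. This is why polynomials are shown to be dense and
  Gram-Schmidt is run on the monomials. The ranges of the two Zernike sums are reached by elementary
  means: each \<open>x_i |r|^(2j)\<close> is a finite combination of odd Zernike functions, and on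
  the axis the exponential series makes \<open>x_i Phi\<close> a uniform limit of such terms.
  Orthogonality reduces to the moments of \<open>x_i^2 |r|^(2m)\<close>, found by dilating the disk
  instead of by polar coordinates, and to the vanishing of n-th finite differences of polynomials of
  degree below n. Functions stand for classes modulo null functions, and operators are linear only
  almost everywhere. Equality of classes is therefore written as \<open>norm_L2\<close> of the
  difference being 0, and identities are carried through inner products. Only limits along t -> 0
  with nonzero direction enter, so the drop of rank at s = 0 is covered together with the other
  points of the line.\<close>

lemma finite_measure_disk [simp]: "finite_measure (disk_measure a)"
  unfolding disk_measure_def by (rule finite_measure_lebesgue_on) simp

lemma space_disk [simp]: "space (disk_measure a) = cball 0 a"
  by (simp add: disk_measure_def)

lemma continuous_measurable_disk:
  fixes f :: "real^2 \<Rightarrow> 'b::euclidean_space"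
  shows "continuous_on (cball 0 a) f \<Longrightarrow> f \<in> borel_measurable (disk_measure a)"
  unfolding disk_measure_def by (rule continuous_imp_measurable_on_sets_lebesgue) auto

lemma integrable_disk_bounded:
  fixes f :: "real^2 \<Rightarrow> 'b::{banach,second_countable_topology}"
  assumes "f \<in> borel_measurable (disk_measure a)" "\<And>r. r \<in> cball 0 a \<Longrightarrow> norm (f r) \<le> B"
  shows "integrable (disk_measure a) f"
proof -
  interpret finite_measure "disk_measure a" by simp
  show ?thesis
    by (rule integrable_const_bound[where B=B]) (use assms in \<open>auto intro: AE_I2\<close>)
qed

lemma integrable_disk_continuous:
  fixes f :: "real^2 \<Rightarrow> 'b::euclidean_space"
  assumes "continuous_on (cball 0 a) f"
  shows "integrable (disk_measure a) f"
proof -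
  have "bounded (f ` cball 0 a)"
    using compact_continuous_image[OF assms] compact_imp_bounded by auto
  then obtain B where "\<forall>r\<in>cball 0 a. norm (f r) \<le> B"
    unfolding bounded_iff by auto
  then show ?thesis
    using integrable_disk_bounded[OF continuous_measurable_disk[OF assms]] by blast
qed

lemma L2_measurable [measurable_dest]: "f \<in> L2 a \<Longrightarrow> f \<in> borel_measurable (disk_measure a)"
  by (simp add: L2_def)

lemma L2_integrable: "f \<in> L2 a \<Longrightarrow> integrable (disk_measure a) (\<lambda>r. (cmod (f r))\<^sup>2)"
  by (simp add: L2_def)

lemma L2_bounded:
  assumes "f \<in> borel_measurable (disk_measure a)" "\<And>r. r \<in> cball 0 a \<Longrightarrow> cmod (f r) \<le> B"
  shows "f \<in> L2 a"
  unfolding L2_def using assms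
  by (auto intro!: integrable_disk_bounded[where B="B\<^sup>2"] power_mono)

lemma L2_continuous: "continuous_on (cball 0 a) f \<Longrightarrow> f \<in> L2 a"
  unfolding L2_def
  by (auto intro!: continuous_measurable_disk integrable_disk_continuous continuous_intros)

lemma L2_add:
  assumes "f \<in> L2 a" "g \<in> L2 a"
  shows "(\<lambda>r. f r + g r) \<in> L2 a"
proof -
  note [measurable] = assms[THEN L2_measurable]
  have *: "(cmod (f r + g r))\<^sup>2 \<le> 2 * (cmod (f r))\<^sup>2 + 2 * (cmod (g r))\<^sup>2" for r
  proof -
    have "(cmod (f r + g r))\<^sup>2 \<le> (cmod (f r) + cmod (g r))\<^sup>2"
      by (intro power_mono norm_triangle_ineq) auto
    also have "\<dots> \<le> 2 * (cmod (f r))\<^sup>2 + 2 * (cmod (g r))\<^sup>2"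
      using sum_squares_bound[of "cmod (f r)" "cmod (g r)"] by (simp add: power2_sum)
    finally show ?thesis .
  qed
  have "integrable (disk_measure a) (\<lambda>r. (cmod (f r + g r))\<^sup>2)"
    by (rule Bochner_Integration.integrable_bound
        [of _ "\<lambda>r. 2 * (cmod (f r))\<^sup>2 + 2 * (cmod (g r))\<^sup>2"])
      (use * in \<open>auto intro!: AE_I2 L2_integrable assms\<close>)
  then show ?thesis by (simp add: L2_def)
qed

lemma L2_scale:
  assumes "f \<in> L2 a"
  shows "(\<lambda>r. c * f r) \<in> L2 a"
  using assms unfolding L2_def by (auto simp: norm_mult power_mult_distrib)

lemma L2_scale': "f \<in> L2 a \<Longrightarrow> (\<lambda>r. f r * c) \<in> L2 a"
  using L2_scale[of f a c] by (simp add: mult.commute)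

lemma L2_divide: "f \<in> L2 a \<Longrightarrow> (\<lambda>r. f r / c) \<in> L2 a"
  using L2_scale[of f a "1/c"] by simp

lemma L2_uminus: "f \<in> L2 a \<Longrightarrow> (\<lambda>r. - f r) \<in> L2 a"
  using L2_scale[of f a "-1"] by simp

lemma L2_diff: "f \<in> L2 a \<Longrightarrow> g \<in> L2 a \<Longrightarrow> (\<lambda>r. f r - g r) \<in> L2 a"
  using L2_add[of f a "\<lambda>r. - g r"] L2_uminus[of g a] by simp

lemma L2_zero [simp]: "(\<lambda>r. 0) \<in> L2 a"
  by (simp add: L2_def)

lemma L2_sum:
  "(\<And>i. i \<in> I \<Longrightarrow> f i \<in> L2 a) \<Longrightarrow> (\<lambda>r. \<Sum>i\<in>I. f i r) \<in> L2 a"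
  by (induction I rule: infinite_finite_induct) (auto intro: L2_add)

lemmas L2_intros = L2_add L2_diff L2_uminus L2_scale L2_scale' L2_divide L2_sum L2_zero

section \<open>Inner product, norm and the Cauchy-Schwarz inequality\<close>

lemma integrable_inner_L2:
  assumes "f \<in> L2 a" "g \<in> L2 a"
  shows "integrable (disk_measure a) (\<lambda>r. cnj (f r) * g r)"
proof -
  note [measurable] = assms[THEN L2_measurable]
  have [measurable]: "(\<lambda>r. cnj (f r)) \<in> borel_measurable (disk_measure a)"
    using measurable_compose[OF L2_measurable[OF assms(1)]
        borel_measurable_continuous_onI[OF linear_continuous_on[OF bounded_linear_cnj]]] .
  have *: "cmod (f r) * cmod (g r) \<le> (cmod (f r))\<^sup>2 + (cmod (g r))\<^sup>2" for r
    using sum_squares_bound[of "cmod (f r)" "cmod (g r)"]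
      mult_nonneg_nonneg[OF norm_ge_zero[of "f r"] norm_ge_zero[of "g r"]] by linarith
  show ?thesis
    by (rule Bochner_Integration.integrable_bound
        [of _ "\<lambda>r. (cmod (f r))\<^sup>2 + (cmod (g r))\<^sup>2"])
      (use * in \<open>simp_all add: norm_mult L2_integrable assms\<close>)
qed

lemma inner_L2_add_right:
  assumes "f \<in> L2 a" "g \<in> L2 a" "h \<in> L2 a"
  shows "inner_L2 a f (\<lambda>r. g r + h r) = inner_L2 a f g + inner_L2 a f h"
  unfolding inner_L2_def using assms
  by (simp add: ring_distribs integrable_inner_L2)

lemma inner_L2_scale_right: "inner_L2 a f (\<lambda>r. c * g r) = c * inner_L2 a f g"
  unfolding inner_L2_def by (simp add: mult.left_commute)

lemma inner_L2_commute: "inner_L2 a g f = cnj (inner_L2 a f g)"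
  unfolding inner_L2_def Bochner_Integration.integral_cnj[symmetric] by (simp add: mult.commute)

lemma inner_L2_zero_right [simp]: "inner_L2 a f (\<lambda>r. 0) = 0"
  by (simp add: inner_L2_def)

lemma inner_L2_zero_left [simp]: "inner_L2 a (\<lambda>r. 0) f = 0"
  by (simp add: inner_L2_def)

lemma inner_L2_scale_left: "inner_L2 a (\<lambda>r. c * f r) g = cnj c * inner_L2 a f g"
  unfolding inner_L2_def by (simp add: mult.assoc)

lemma inner_L2_add_left:
  assumes "f \<in> L2 a" "g \<in> L2 a" "h \<in> L2 a"
  shows "inner_L2 a (\<lambda>r. g r + h r) f = inner_L2 a g f + inner_L2 a h f"
  unfolding inner_L2_def using assms
  by (simp add: ring_distribs integrable_inner_L2)

lemma inner_L2_diff_right: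
  assumes "f \<in> L2 a" "g \<in> L2 a" "h \<in> L2 a"
  shows "inner_L2 a f (\<lambda>r. g r - h r) = inner_L2 a f g - inner_L2 a f h"
  unfolding inner_L2_def using assms
  by (simp add: ring_distribs integrable_inner_L2)

lemma inner_L2_diff_left:
  assumes "f \<in> L2 a" "g \<in> L2 a" "h \<in> L2 a"
  shows "inner_L2 a (\<lambda>r. g r - h r) f = inner_L2 a g f - inner_L2 a h f"
  unfolding inner_L2_def using assms
  by (simp add: ring_distribs integrable_inner_L2)

lemma inner_L2_sum_right:
  assumes "f \<in> L2 a" "\<And>i. i \<in> I \<Longrightarrow> g i \<in> L2 a"
  shows "inner_L2 a f (\<lambda>r. \<Sum>i\<in>I. g i r) = (\<Sum>i\<in>I. inner_L2 a f (g i))"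
  using assms(2)
  by (induction I rule: infinite_finite_induct) (auto simp: inner_L2_add_right L2_sum assms(1))

lemma inner_L2_sum_left:
  assumes "f \<in> L2 a" "\<And>i. i \<in> I \<Longrightarrow> g i \<in> L2 a"
  shows "inner_L2 a (\<lambda>r. \<Sum>i\<in>I. g i r) f = (\<Sum>i\<in>I. inner_L2 a (g i) f)"
  using assms(2)
  by (induction I rule: infinite_finite_induct) (auto simp: inner_L2_add_left L2_sum assms(1))

lemma norm_L2_nonneg [simp]: "0 \<le> norm_L2 a f"
  by (simp add: norm_L2_def)

lemma norm_L2_power2: "(norm_L2 a f)\<^sup>2 = (LINT r|disk_measure a. (cmod (f r))\<^sup>2)"
  by (simp add: norm_L2_def)

lemma inner_L2_self: "inner_L2 a f f = complex_of_real ((norm_L2 a f)\<^sup>2)"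
  unfolding norm_L2_power2 inner_L2_def
  by (subst integral_complex_of_real[symmetric]) (simp add: mult.commute flip: complex_norm_square of_real_power)

lemma norm_L2_scale: "norm_L2 a (\<lambda>r. c * f r) = cmod c * norm_L2 a f"
  unfolding norm_L2_def by (simp add: norm_mult power_mult_distrib real_sqrt_mult)

lemma norm_L2_divide: "norm_L2 a (\<lambda>r. f r / c) = norm_L2 a f / cmod c"
  using norm_L2_scale[of a "1/c" f] by (simp add: norm_divide)

lemma norm_L2_uminus [simp]: "norm_L2 a (\<lambda>r. - f r) = norm_L2 a f"
  by (simp add: norm_L2_def)

lemma norm_L2_zero [simp]: "norm_L2 a (\<lambda>r. 0) = 0"
  by (simp add: norm_L2_def)

lemma norm_L2_minus_commute: "norm_L2 a (\<lambda>r. f r - g r) = norm_L2 a (\<lambda>r. g r - f r)"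
  unfolding norm_L2_def by (simp add: norm_minus_commute)

lemma norm_L2_eq_0_iff:
  assumes "f \<in> L2 a"
  shows "norm_L2 a f = 0 \<longleftrightarrow> (AE r in disk_measure a. f r = 0)"
  unfolding norm_L2_def using integral_nonneg_eq_0_iff_AE[OF L2_integrable[OF assms]] by simp

lemma norm_L2_diff_eq_0_iff:
  assumes "f \<in> L2 a" "g \<in> L2 a"
  shows "norm_L2 a (\<lambda>r. f r - g r) = 0 \<longleftrightarrow> (AE r in disk_measure a. f r = g r)"
  using norm_L2_eq_0_iff[OF L2_diff[OF assms]] by simp

text \<open>The integral of \<open>(x |f| - |g|)^2\<close> is a nonnegative quadratic in x, so its
  discriminant is not positive. Working with the moduli bounds the integral of
  \<open>|f| |g|\<close>, which dominates the inner product.\<close>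

lemma Cauchy_Schwarz_L2:
  assumes "f \<in> L2 a" "g \<in> L2 a"
  shows "cmod (inner_L2 a f g) \<le> norm_L2 a f * norm_L2 a g"
proof -
  note [measurable] = assms[THEN L2_measurable]
  let ?M = "disk_measure a"
  have int: "integrable ?M (\<lambda>r. cmod (f r) * cmod (g r))"
    using integrable_norm[OF integrable_inner_L2[OF assms]] by (simp add: norm_mult)
  define C where "C = (LINT r|?M. cmod (f r) * cmod (g r))"
  have quad: "0 \<le> x\<^sup>2 * (norm_L2 a f)\<^sup>2 - 2 * x * C + (norm_L2 a g)\<^sup>2" for x
  proof -
    have "0 \<le> (LINT r|?M. (x * cmod (f r) - cmod (g r))\<^sup>2)"
      by simp
    also have "\<dots> = (LINT r|?M. x\<^sup>2 * (cmod (f r))\<^sup>2 - 2 * x * (cmod (f r) * cmod (g r)) + (cmod (g r))\<^sup>2)"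
      by (rule Bochner_Integration.integral_cong) (auto simp: power2_diff power_mult_distrib)
    also have "\<dots> = x\<^sup>2 * (norm_L2 a f)\<^sup>2 - 2 * x * C + (norm_L2 a g)\<^sup>2"
      unfolding C_def norm_L2_power2 using int L2_integrable[OF assms(1)] L2_integrable[OF assms(2)]
      by simp
    finally show ?thesis .
  qed
  have "C \<le> norm_L2 a f * norm_L2 a g"
  proof (cases "norm_L2 a f = 0")
    case True
    have "C \<le> 0"
    proof (rule ccontr)
      assume "\<not> C \<le> 0"
      \<comment> \<open>With \<open>norm_L2 a f = 0\<close> the quadratic is affine in x; this
        choice of x gives it the value -1.\<close>
      then show False
        using quad[of "((norm_L2 a g)\<^sup>2 + 1) / (2 * C)"] True by simp
    qed
    then show ?thesis using True by simp
  next
    case False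
    then have pos: "(norm_L2 a f)\<^sup>2 > 0" by simp
    have "C\<^sup>2 \<le> (norm_L2 a f)\<^sup>2 * (norm_L2 a g)\<^sup>2"
      \<comment> \<open>The minimiser of the quadratic.\<close>
      using quad[of "C / (norm_L2 a f)\<^sup>2"] pos False
      by (simp add: power_divide field_simps power2_eq_square)
    then show ?thesis
      by (metis norm_L2_nonneg mult_nonneg_nonneg power2_le_imp_le power_mult_distrib)
  qed
  moreover have "cmod (inner_L2 a f g) \<le> C"
    unfolding inner_L2_def C_def using integral_norm_bound[of ?M "\<lambda>r. cnj (f r) * g r"]
    by (simp add: norm_mult)
  ultimately show ?thesis by linarith
qed

lemma norm_L2_add_power2:
  assumes "f \<in> L2 a" "g \<in> L2 a"
  shows "(norm_L2 a (\<lambda>r. f r + g r))\<^sup>2 = (norm_L2 a f)\<^sup>2 + 2 * Re (inner_L2 a f g) + (norm_L2 a g)\<^sup>2"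
proof -
  have "complex_of_real ((norm_L2 a (\<lambda>r. f r + g r))\<^sup>2)
      = inner_L2 a f f + (inner_L2 a f g + cnj (inner_L2 a f g)) + inner_L2 a g g"
    unfolding inner_L2_self[symmetric] using assms
    by (simp add: inner_L2_add_left inner_L2_add_right L2_add inner_L2_commute[of a g f])
  also have "\<dots> = complex_of_real ((norm_L2 a f)\<^sup>2 + 2 * Re (inner_L2 a f g) + (norm_L2 a g)\<^sup>2)"
    unfolding inner_L2_self complex_add_cnj by simp
  finally show ?thesis
    using of_real_eq_iff by blast
qed

lemma norm_L2_triangle:
  assumes "f \<in> L2 a" "g \<in> L2 a"
  shows "norm_L2 a (\<lambda>r. f r + g r) \<le> norm_L2 a f + norm_L2 a g"
proof (rule power2_le_imp_le)
  show "(norm_L2 a (\<lambda>r. f r + g r))\<^sup>2 \<le> (norm_L2 a f + norm_L2 a g)\<^sup>2"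
    unfolding norm_L2_add_power2[OF assms] power2_sum
    using order_trans[OF complex_Re_le_cmod Cauchy_Schwarz_L2[OF assms]] by simp
qed simp

lemma norm_L2_triangle_diff:
  assumes "f \<in> L2 a" "g \<in> L2 a" "h \<in> L2 a"
  shows "norm_L2 a (\<lambda>r. f r - h r) \<le> norm_L2 a (\<lambda>r. f r - g r) + norm_L2 a (\<lambda>r. g r - h r)"
  using norm_L2_triangle[of "\<lambda>r. f r - g r" a "\<lambda>r. g r - h r"] assms by (simp add: L2_diff)

lemma norm_L2_triangle_sub:
  assumes "f \<in> L2 a" "g \<in> L2 a"
  shows "norm_L2 a f \<le> norm_L2 a (\<lambda>r. f r - g r) + norm_L2 a g"
  using norm_L2_triangle_diff[OF assms L2_zero] by simp

lemma norm_L2_triangle_minus: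
  assumes "f \<in> L2 a" "g \<in> L2 a"
  shows "norm_L2 a (\<lambda>r. f r - g r) \<le> norm_L2 a f + norm_L2 a g"
  using norm_L2_triangle_diff[OF assms(1) L2_zero assms(2)] by simp

lemma inner_L2_null_right:
  assumes "f \<in> L2 a" "g \<in> L2 a" "norm_L2 a g = 0"
  shows "inner_L2 a f g = 0"
  using Cauchy_Schwarz_L2[OF assms(1,2)] assms(3) by simp

text \<open>A difference of norm 0 is equality in the quotient space. Images under an operator are
  known only in this sense, so they are exchanged inside inner products instead of being
  rewritten.\<close>

lemma inner_L2_cong_right:
  assumes "f \<in> L2 a" "g \<in> L2 a" "h \<in> L2 a" "norm_L2 a (\<lambda>r. g r - h r) = 0"
  shows "inner_L2 a f g = inner_L2 a f h"
  using inner_L2_null_right[OF assms(1) L2_diff[OF assms(2,3)] assms(4)]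
    inner_L2_diff_right[OF assms(1-3)] by simp

lemma inner_L2_cong_left:
  assumes "f \<in> L2 a" "g \<in> L2 a" "h \<in> L2 a" "norm_L2 a (\<lambda>r. g r - h r) = 0"
  shows "inner_L2 a g f = inner_L2 a h f"
  using inner_L2_cong_right[OF assms] by (metis inner_L2_commute)

lemma norm_L2_null_if_orthogonal:
  assumes "f \<in> L2 a" "\<And>g. g \<in> L2 a \<Longrightarrow> inner_L2 a g f = 0"
  shows "norm_L2 a f = 0"
  using assms(2)[OF assms(1)] by (simp add: inner_L2_self)

text \<open>Expanding around the limit leaves the product of the two errors and two mixed terms,
  each controlled by Cauchy-Schwarz.\<close>

lemma tendsto_inner_L2:
  assumes "\<And>t. u t \<in> L2 a" "\<And>t. w t \<in> L2 a" "u0 \<in> L2 a" "w0 \<in> L2 a"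
    and u: "((\<lambda>t. norm_L2 a (\<lambda>r. u t r - u0 r)) \<longlongrightarrow> 0) F"
    and w: "((\<lambda>t. norm_L2 a (\<lambda>r. w t r - w0 r)) \<longlongrightarrow> 0) F"
  shows "((\<lambda>t. inner_L2 a (u t) (w t)) \<longlongrightarrow> inner_L2 a u0 w0) F"
proof -
  let ?du = "\<lambda>t r. u t r - u0 r" and ?dw = "\<lambda>t r. w t r - w0 r"
  have "inner_L2 a (u t) (w t) - inner_L2 a u0 w0
      = inner_L2 a (?du t) (?dw t) + inner_L2 a (?du t) w0 + inner_L2 a u0 (?dw t)" for t
    using assms by (simp add: inner_L2_diff_left inner_L2_diff_right L2_diff)
  then have bound: "cmod (inner_L2 a (u t) (w t) - inner_L2 a u0 w0)
      \<le> norm_L2 a (?du t) * norm_L2 a (?dw t) + norm_L2 a (?du t) * norm_L2 a w0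
        + norm_L2 a u0 * norm_L2 a (?dw t)" for t
    using Cauchy_Schwarz_L2[of "?du t" a "?dw t"] Cauchy_Schwarz_L2[of "?du t" a w0]
      Cauchy_Schwarz_L2[of u0 a "?dw t"] assms
      norm_triangle_ineq[of "inner_L2 a (?du t) (?dw t) + inner_L2 a (?du t) w0"
        "inner_L2 a u0 (?dw t)"]
      norm_triangle_ineq[of "inner_L2 a (?du t) (?dw t)" "inner_L2 a (?du t) w0"]
    by (simp add: L2_diff)
  have "((\<lambda>t. norm_L2 a (?du t) * norm_L2 a (?dw t) + norm_L2 a (?du t) * norm_L2 a w0
        + norm_L2 a u0 * norm_L2 a (?dw t)) \<longlongrightarrow> 0 * 0 + 0 * norm_L2 a w0 + norm_L2 a u0 * 0) F"
    by (intro tendsto_intros u w)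
  then have "((\<lambda>t. inner_L2 a (u t) (w t) - inner_L2 a u0 w0) \<longlongrightarrow> 0) F"
    by (intro Lim_null_comparison[OF always_eventually[OF allI[OF bound]]]) simp
  then show ?thesis by (simp add: LIM_zero_iff)
qed

lemma norm_L2_bounded:
  assumes f: "f \<in> L2 a" and B: "\<And>r. r \<in> cball 0 a \<Longrightarrow> cmod (f r) \<le> B" and "B \<ge> 0"
  shows "norm_L2 a f \<le> B * sqrt (measure lebesgue (cball (0::real^2) a))"
proof -
  interpret finite_measure "disk_measure a" by simp
  have "(LINT r|disk_measure a. (cmod (f r))\<^sup>2) \<le> (LINT r|disk_measure a. B\<^sup>2)"
    by (intro integral_mono L2_integrable f) (use B in \<open>auto intro!: power_mono\<close>)
  also have "\<dots> = B\<^sup>2 * measure lebesgue (cball (0::real^2) a)"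
    by (simp add: disk_measure_def measure_restrict_space)
  finally have "norm_L2 a f \<le> sqrt (B\<^sup>2 * measure lebesgue (cball (0::real^2) a))"
    unfolding norm_L2_def by (rule real_sqrt_le_mono)
  then show ?thesis
    using \<open>B \<ge> 0\<close> by (simp add: real_sqrt_mult)
qed

text \<open>The disk has finite measure, so uniform smallness implies smallness in norm. The limits
  of the wave functions in t rest on this.\<close>

lemma norm_L2_tendsto_0_uniform:
  assumes "\<And>t. f t \<in> L2 a" and "\<And>t r. r \<in> cball 0 a \<Longrightarrow> cmod (f t r) \<le> b t" "\<And>t. b t \<ge> 0"
    and "(b \<longlongrightarrow> 0) F"
  shows "((\<lambda>t. norm_L2 a (f t)) \<longlongrightarrow> 0) F"
proof (rule Lim_null_comparison)
  show "\<forall>\<^sub>F t in F. norm (norm_L2 a (f t)) \<le> b t * sqrt (measure lebesgue (cball (0::real^2) a))"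
    using norm_L2_bounded[OF assms(1,2,3)] by (simp add: always_eventually)
  show "((\<lambda>t. b t * sqrt (measure lebesgue (cball (0::real^2) a))) \<longlongrightarrow> 0) F"
    using tendsto_mult_right[OF assms(4), of "sqrt (measure lebesgue (cball (0::real^2) a))"] by simp
qed

section \<open>Orthonormal families and bases\<close>

text \<open>Null members are allowed because both families in use are quotients by a norm that may
  be 0: Gram-Schmidt residuals of dependent functions, and Zernike polynomials, whose norms are
  never computed. Coefficients along a null member vanish by Cauchy-Schwarz.\<close>

definition orthonormal_or_null :: "real \<Rightarrow> ('i \<Rightarrow> wavefun) \<Rightarrow> bool" where
  "orthonormal_or_null a e \<longleftrightarrow> (\<forall>i. e i \<in> L2 a) \<and> (\<forall>i. norm_L2 a (e i) = 1 \<or> norm_L2 a (e i) = 0)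
     \<and> (\<forall>i j. i \<noteq> j \<longrightarrow> inner_L2 a (e i) (e j) = 0)"

definition fourier_part :: "real \<Rightarrow> ('i \<Rightarrow> wavefun) \<Rightarrow> 'i set \<Rightarrow> wavefun \<Rightarrow> wavefun" where
  "fourier_part a e F f = (\<lambda>r. \<Sum>i\<in>F. inner_L2 a (e i) f * e i r)"

lemma L2_fourier_part:
  assumes "\<And>i. i \<in> F \<Longrightarrow> e i \<in> L2 a"
  shows "fourier_part a e F f \<in> L2 a"
  unfolding fourier_part_def using assms by (intro L2_intros)

lemma fourier_part_add:
  assumes "\<And>i. i \<in> F \<Longrightarrow> e i \<in> L2 a" "f \<in> L2 a" "g \<in> L2 a"
  shows "fourier_part a e F (\<lambda>r. f r + g r) = (\<lambda>r. fourier_part a e F f r + fourier_part a e F g r)"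
  using assms unfolding fourier_part_def
  by (auto simp: inner_L2_add_right ring_distribs fun_eq_iff simp flip: sum.distrib intro!: sum.cong)

lemma fourier_part_diff:
  assumes "\<And>i. i \<in> F \<Longrightarrow> e i \<in> L2 a" "f \<in> L2 a" "g \<in> L2 a"
  shows "fourier_part a e F (\<lambda>r. f r - g r) = (\<lambda>r. fourier_part a e F f r - fourier_part a e F g r)"
  using assms unfolding fourier_part_def
  by (auto simp: inner_L2_diff_right ring_distribs fun_eq_iff simp flip: sum_subtractf intro!: sum.cong)

lemma fourier_part_scale:
  "fourier_part a e F (\<lambda>r. c * f r) = (\<lambda>r. c * fourier_part a e F f r)"
  unfolding fourier_part_def by (simp add: inner_L2_scale_right sum_distrib_left mult.assoc)

lemma inner_L2_fourier_part_right:
  assumes "\<And>i. i \<in> F \<Longrightarrow> e i \<in> L2 a" "g \<in> L2 a"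
  shows "inner_L2 a g (fourier_part a e F f) = (\<Sum>i\<in>F. inner_L2 a g (e i) * inner_L2 a (e i) f)"
  using assms unfolding fourier_part_def
  by (subst inner_L2_sum_right) (auto simp: inner_L2_scale_right L2_scale intro: mult.commute sum.cong)

lemma inner_L2_fourier_part_left:
  assumes "\<And>i. i \<in> F \<Longrightarrow> e i \<in> L2 a" "g \<in> L2 a"
  shows "inner_L2 a (fourier_part a e F f) g = (\<Sum>i\<in>F. inner_L2 a f (e i) * inner_L2 a (e i) g)"
  using assms unfolding fourier_part_def
  by (subst inner_L2_sum_left)
     (auto simp: inner_L2_scale_left inner_L2_commute[of a f] L2_scale)

context
  fixes a :: real and e :: "'i \<Rightarrow> wavefun"
  assumes on: "orthonormal_or_null a e"
begin

lemma orthonormal_or_null_L2: "e i \<in> L2 a"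
  using on by (simp add: orthonormal_or_null_def)

lemma inner_L2_basis_fourier_part:
  assumes "finite F" "f \<in> L2 a"
  shows "inner_L2 a (e j) (fourier_part a e F f) = (if j \<in> F then inner_L2 a (e j) f else 0)"
proof -
  have "inner_L2 a (e j) (fourier_part a e F f)
      = (\<Sum>i\<in>F. inner_L2 a (e j) (e i) * inner_L2 a (e i) f)"
    by (rule inner_L2_fourier_part_right) (auto intro: orthonormal_or_null_L2)
  also have "\<dots> = (\<Sum>i\<in>F. if i = j then inner_L2 a (e j) (e j) * inner_L2 a (e j) f else 0)"
    using on by (intro sum.cong) (auto simp: orthonormal_or_null_def)
  also have "\<dots> = (if j \<in> F then inner_L2 a (e j) (e j) * inner_L2 a (e j) f else 0)"
    using assms(1) by simp
  also have "inner_L2 a (e j) (e j) * inner_L2 a (e j) f = inner_L2 a (e j) f"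
  proof (cases "norm_L2 a (e j) = 0")
    case True
    then show ?thesis
      using Cauchy_Schwarz_L2[OF orthonormal_or_null_L2 assms(2), of j] by simp
  next
    case False
    then have "norm_L2 a (e j) = 1" using on by (auto simp: orthonormal_or_null_def)
    then show ?thesis by (simp add: inner_L2_self)
  qed
  finally show ?thesis .
qed

lemma norm_L2_fourier_part_power2:
  assumes "finite F" "f \<in> L2 a"
  shows "(norm_L2 a (fourier_part a e F f))\<^sup>2 = (\<Sum>i\<in>F. (cmod (inner_L2 a (e i) f))\<^sup>2)"
proof -
  have L: "fourier_part a e F f \<in> L2 a" by (intro L2_fourier_part orthonormal_or_null_L2)
  have "complex_of_real ((norm_L2 a (fourier_part a e F f))\<^sup>2)
     = (\<Sum>i\<in>F. inner_L2 a f (e i) * inner_L2 a (e i) (fourier_part a e F f))"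
    unfolding inner_L2_self[symmetric]
    by (subst inner_L2_fourier_part_left) (auto intro: orthonormal_or_null_L2 L)
  also have "\<dots> = (\<Sum>i\<in>F. complex_of_real ((cmod (inner_L2 a (e i) f))\<^sup>2))"
    using assms by (intro sum.cong refl)
      (simp add: inner_L2_basis_fourier_part inner_L2_commute[of a f] complex_norm_square mult.commute
        del: of_real_power)
  finally show ?thesis
    by (metis of_real_sum of_real_eq_iff)
qed

text \<open>The residual is orthogonal to the Fourier part, so Pythagoras applies. Bessel's
  inequality and the monotonicity of residuals are read off from it.\<close>

lemma norm_L2_fourier_residual_power2:
  assumes "finite F" "f \<in> L2 a"
  shows "(norm_L2 a (\<lambda>r. f r - fourier_part a e F f r))\<^sup>2
      = (norm_L2 a f)\<^sup>2 - (\<Sum>i\<in>F. (cmod (inner_L2 a (e i) f))\<^sup>2)"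
proof -
  let ?P = "fourier_part a e F f"
  have L: "?P \<in> L2 a" by (intro L2_fourier_part orthonormal_or_null_L2)
  have "inner_L2 a (\<lambda>r. f r - ?P r) ?P = cnj (inner_L2 a ?P (\<lambda>r. f r - ?P r))"
    by (rule inner_L2_commute)
  also have "inner_L2 a ?P (\<lambda>r. f r - ?P r) = 0"
    using assms L
    by (subst inner_L2_fourier_part_left)
       (auto intro!: L2_diff sum.neutral orthonormal_or_null_L2
             simp: inner_L2_diff_right inner_L2_basis_fourier_part orthonormal_or_null_L2)
  finally have "inner_L2 a (\<lambda>r. f r - ?P r) ?P = 0" by simp
  then have "(norm_L2 a (\<lambda>r. (f r - ?P r) + ?P r))\<^sup>2
     = (norm_L2 a (\<lambda>r. f r - ?P r))\<^sup>2 + (norm_L2 a ?P)\<^sup>2"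
    using assms L by (subst norm_L2_add_power2) (auto intro: L2_diff)
  then show ?thesis
    using norm_L2_fourier_part_power2[OF assms] by simp
qed

lemma norm_L2_fourier_residual_mono:
  assumes "finite G" "F \<subseteq> G" "f \<in> L2 a"
  shows "norm_L2 a (\<lambda>r. f r - fourier_part a e G f r) \<le> norm_L2 a (\<lambda>r. f r - fourier_part a e F f r)"
proof (rule power2_le_imp_le)
  have "(\<Sum>i\<in>F. (cmod (inner_L2 a (e i) f))\<^sup>2) \<le> (\<Sum>i\<in>G. (cmod (inner_L2 a (e i) f))\<^sup>2)"
    using assms by (intro sum_mono2) auto
  then show "(norm_L2 a (\<lambda>r. f r - fourier_part a e G f r))\<^sup>2
      \<le> (norm_L2 a (\<lambda>r. f r - fourier_part a e F f r))\<^sup>2"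
    using assms finite_subset[OF assms(2,1)] by (simp add: norm_L2_fourier_residual_power2)
qed simp

lemma norm_L2_fourier_residual_le:
  assumes "finite F" "f \<in> L2 a"
  shows "norm_L2 a (\<lambda>r. f r - fourier_part a e F f r) \<le> norm_L2 a f"
  using norm_L2_fourier_residual_mono[OF assms(1) empty_subsetI assms(2)]
  by (simp add: fourier_part_def)

lemma Bessel_fourier_part:
  assumes "finite F" "f \<in> L2 a"
  shows "norm_L2 a (fourier_part a e F f) \<le> norm_L2 a f"
proof (rule power2_le_imp_le)
  show "(norm_L2 a (fourier_part a e F f))\<^sup>2 \<le> (norm_L2 a f)\<^sup>2"
    using norm_L2_fourier_residual_power2[OF assms] norm_L2_fourier_part_power2[OF assms]
    by (smt (verit) zero_le_power2)
qed simp

end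

section \<open>Gram-Schmidt orthonormalisation and existence of orthonormal bases\<close>

text \<open>A function dependent on its predecessors gets a residual of norm 0, and division by 0 turns it
  into the zero function.\<close>

function gram_schmidt :: "real \<Rightarrow> (nat \<Rightarrow> wavefun) \<Rightarrow> nat \<Rightarrow> wavefun" where
  "gram_schmidt a p n =
     (let q = (\<lambda>r. p n r - (\<Sum>i<n. inner_L2 a (gram_schmidt a p i) (p n) * gram_schmidt a p i r))
      in (\<lambda>r. q r / complex_of_real (norm_L2 a q)))"
  by auto
termination by (relation "Wellfounded.measure (\<lambda>(a, p, n). n)") auto

declare gram_schmidt.simps [simp del]

lemma gram_schmidt_eq:
  "gram_schmidt a p n =
     (\<lambda>r. (p n r - fourier_part a (gram_schmidt a p) {..<n} (p n) r)
       / complex_of_real (norm_L2 a (\<lambda>r. p n r - fourier_part a (gram_schmidt a p) {..<n} (p n) r)))"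
  by (subst gram_schmidt.simps) (simp add: Let_def fourier_part_def)

lemma L2_gram_schmidt:
  assumes "\<And>n. p n \<in> L2 a"
  shows "gram_schmidt a p n \<in> L2 a"
proof (induction n rule: less_induct)
  case (less n)
  then show ?case
    unfolding gram_schmidt_eq[of a p n]
    by (intro L2_divide L2_diff L2_fourier_part assms) auto
qed

lemma norm_L2_gram_schmidt:
  "norm_L2 a (gram_schmidt a p n) = 1 \<or> gram_schmidt a p n = (\<lambda>r. 0)"
proof -
  let ?q = "\<lambda>r. p n r - fourier_part a (gram_schmidt a p) {..<n} (p n) r"
  show ?thesis
    unfolding gram_schmidt_eq[of a p n]
    by (cases "norm_L2 a ?q = 0") (simp_all add: norm_L2_divide)
qed

text \<open>Strong induction on the later index: subtracting the Fourier part over the earlier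
  members removes every earlier component, zero members included.\<close>

lemma gram_schmidt_orthogonal:
  assumes p: "\<And>n. p n \<in> L2 a"
  shows "i \<noteq> j \<Longrightarrow> inner_L2 a (gram_schmidt a p i) (gram_schmidt a p j) = 0"
proof -
  let ?e = "gram_schmidt a p"
  note eL = L2_gram_schmidt[of p a, OF p]
  have main: "\<forall>i<n. inner_L2 a (?e i) (?e n) = 0" for n
  proof (induction n rule: less_induct)
    case (less n)
    let ?q = "\<lambda>r. p n r - fourier_part a ?e {..<n} (p n) r"
    show ?case
    proof (intro allI impI)
      fix i assume i: "i < n"
      have orth: "inner_L2 a (?e i) (?e j) = 0" if "j < n" "j \<noteq> i" for j
        using less.IH[of i] less.IH[of j] i that inner_L2_commute[of a "?e i" "?e j"]
        by (cases "i < j") auto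
      have "inner_L2 a (?e i) ?q = inner_L2 a (?e i) (p n)
          - (\<Sum>j<n. inner_L2 a (?e j) (p n) * inner_L2 a (?e i) (?e j))"
        by (simp add: inner_L2_diff_right p eL L2_fourier_part inner_L2_fourier_part_right mult.commute)
      also have "(\<Sum>j<n. inner_L2 a (?e j) (p n) * inner_L2 a (?e i) (?e j))
          = (\<Sum>j<n. if j = i then inner_L2 a (?e i) (p n) * inner_L2 a (?e i) (?e i) else 0)"
        using orth by (intro sum.cong) auto
      also have "\<dots> = inner_L2 a (?e i) (p n) * inner_L2 a (?e i) (?e i)"
        using i by simp
      also have "\<dots> = inner_L2 a (?e i) (p n)"
        using norm_L2_gram_schmidt[of a p i] by (auto simp: inner_L2_self)
      finally have "inner_L2 a (?e i) ?q = 0" by simp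
      then show "inner_L2 a (?e i) (?e n) = 0"
        using inner_L2_scale_right[of a "?e i" "1 / complex_of_real (norm_L2 a ?q)" ?q]
        unfolding gram_schmidt_eq[of a p n] by simp
    qed
  qed
  show ?thesis if "i \<noteq> j"
    using main[of i] main[of j] inner_L2_commute[of a "?e i" "?e j"] that
    by (cases "i < j") auto
qed

lemma orthonormal_or_null_gram_schmidt:
  assumes "\<And>n. p n \<in> L2 a"
  shows "orthonormal_or_null a (gram_schmidt a p)"
  unfolding orthonormal_or_null_def
proof (intro conjI allI impI)
  fix n show "norm_L2 a (gram_schmidt a p n) = 1 \<or> norm_L2 a (gram_schmidt a p n) = 0"
    using norm_L2_gram_schmidt[of a p n] by auto
qed (rule L2_gram_schmidt[OF assms] gram_schmidt_orthogonal[OF assms], assumption?)+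

text \<open>If the residual of \<open>p n\<close> is null, the earlier members already reproduce
  \<open>p n\<close>; otherwise the component along the new member is exactly that residual.\<close>

lemma gram_schmidt_spans:
  assumes p: "\<And>n. p n \<in> L2 a"
  shows "norm_L2 a (\<lambda>r. p n r - fourier_part a (gram_schmidt a p) {..n} (p n) r) = 0"
proof -
  let ?e = "gram_schmidt a p"
  note eL = L2_gram_schmidt[of p a, OF p]
  note on = orthonormal_or_null_gram_schmidt[of p a, OF p]
  let ?S = "fourier_part a ?e {..<n} (p n)"
  let ?q = "\<lambda>r. p n r - ?S r"
  have e: "?e n = (\<lambda>r. ?q r / complex_of_real (norm_L2 a ?q))"
    by (rule gram_schmidt_eq)
  have SL: "?S \<in> L2 a" by (rule L2_fourier_part) (rule eL)
  show ?thesis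
  proof (cases "norm_L2 a ?q = 0")
    case True
    then show ?thesis
      using norm_L2_fourier_residual_mono[OF on, of "{..n}" "{..<n}" "p n"] p
      by (simp add: antisym lessThan_Suc_atMost[symmetric] subset_insertI lessThan_Suc)
  next
    case False
    have "inner_L2 a (?e n) (p n) = inner_L2 a (?e n) ?q"
      by (simp add: inner_L2_diff_right eL p SL inner_L2_basis_fourier_part[OF on])
    also have "\<dots> = complex_of_real (norm_L2 a ?q)"
      using inner_L2_scale_left[of a "1 / complex_of_real (norm_L2 a ?q)" ?q ?q] False
      by (simp add: e inner_L2_self power2_eq_square)
    finally have "inner_L2 a (?e n) (p n) * ?e n r = ?q r" for r
      using False by (simp add: e)
    then have "(\<lambda>r. p n r - fourier_part a ?e {..n} (p n) r) = (\<lambda>r. 0)"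
      by (simp add: fourier_part_def lessThan_Suc_atMost[symmetric])
    then show ?thesis by simp
  qed
qed

text \<open>\<open>total\<close> says that every linear subspace of \<open>L2\<close> containing all
  \<open>p n\<close> is dense. It is applied to the functions reproduced, up to null functions, by
  finitely many members of the family. Residuals shrink as the index set grows, so density gives
  convergence along the net of finite subsets.\<close>

lemma ex_onb_of_total:
  fixes p :: "nat \<Rightarrow> wavefun"
  assumes p: "\<And>n. p n \<in> L2 a"
    and total: "\<And>V f \<epsilon>. \<lbrakk>\<And>n. p n \<in> V; \<And>g h. \<lbrakk>g \<in> V; h \<in> V\<rbrakk> \<Longrightarrow> (\<lambda>r. g r + h r) \<in> V;
        \<And>c g. g \<in> V \<Longrightarrow> (\<lambda>r. c * g r) \<in> V; V \<subseteq> L2 a; f \<in> L2 a; \<epsilon> > 0\<rbrakk>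
        \<Longrightarrow> \<exists>g\<in>V. norm_L2 a (\<lambda>r. f r - g r) < \<epsilon>"
  shows "\<exists>E. onb a E"
proof -
  let ?e = "gram_schmidt a p"
  \<comment> \<open>Zero members are dropped. On \<open>J\<close> the family is injective, so finite
    subsets of the set \<open>E\<close> of functions correspond to finite index sets.\<close>
  define J where "J = {n. norm_L2 a (?e n) = 1}"
  define E where "E = ?e ` J"
  note eL = L2_gram_schmidt[of p a, OF p]
  note on = orthonormal_or_null_gram_schmidt[of p a, OF p]
  have inj: "inj_on ?e J"
  proof (rule inj_onI, rule ccontr)
    fix i j assume "i \<in> J" "j \<in> J" "?e i = ?e j" "i \<noteq> j"
    then show False
      using gram_schmidt_orthogonal[of p a, OF p, of i j] by (simp add: J_def inner_L2_self)
  qed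
  have fourier: "fourier_part a (\<lambda>e. e) (?e ` A) f = fourier_part a ?e A f" if "A \<subseteq> J" for A f
    unfolding fourier_part_def
    by (subst sum.reindex[OF inj_on_subset[OF inj that]]) simp
  define V where "V = {f \<in> L2 a. \<exists>A\<subseteq>J. finite A \<and> norm_L2 a (\<lambda>r. f r - fourier_part a ?e A f r) = 0}"
  have fL: "fourier_part a ?e A f \<in> L2 a" for A f
    by (rule L2_fourier_part) (rule eL)
  have pV: "p n \<in> V" for n
  proof -
    have "fourier_part a ?e ({..n} \<inter> J) (p n) = fourier_part a ?e {..n} (p n)"
    proof -
      have "?e i = (\<lambda>r. 0)" if "i \<notin> J" for i
        using norm_L2_gram_schmidt[of a p i] that by (auto simp: J_def)
      then show ?thesis
        unfolding fourier_part_def by (intro ext sum.mono_neutral_left) auto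
    qed
    then show ?thesis
      unfolding V_def using gram_schmidt_spans[of p a, OF p, of n] p
      by (intro CollectI conjI exI[of _ "{..n} \<inter> J"]) auto
  qed
  have addV: "(\<lambda>r. g r + h r) \<in> V" if "g \<in> V" "h \<in> V" for g h
  proof -
    from that obtain A B where A: "A \<subseteq> J" "finite A" "norm_L2 a (\<lambda>r. g r - fourier_part a ?e A g r) = 0"
      and B: "B \<subseteq> J" "finite B" "norm_L2 a (\<lambda>r. h r - fourier_part a ?e B h r) = 0"
      and L: "g \<in> L2 a" "h \<in> L2 a"
      unfolding V_def by auto
    let ?C = "A \<union> B"
    have "norm_L2 a (\<lambda>r. g r - fourier_part a ?e ?C g r) \<le> 0"
      using norm_L2_fourier_residual_mono[OF on, of ?C A g] A B L by simp
    moreover have "norm_L2 a (\<lambda>r. h r - fourier_part a ?e ?C h r) \<le> 0"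
      using norm_L2_fourier_residual_mono[OF on, of ?C B h] A B L by simp
    moreover have "(\<lambda>r. g r + h r - fourier_part a ?e ?C (\<lambda>r. g r + h r) r)
        = (\<lambda>r. (g r - fourier_part a ?e ?C g r) + (h r - fourier_part a ?e ?C h r))"
      by (subst fourier_part_add) (auto simp: eL L)
    ultimately have "norm_L2 a (\<lambda>r. g r + h r - fourier_part a ?e ?C (\<lambda>r. g r + h r) r) \<le> 0"
      using norm_L2_triangle[of "\<lambda>r. g r - fourier_part a ?e ?C g r" a
          "\<lambda>r. h r - fourier_part a ?e ?C h r"] L by (simp add: L2_diff fL)
    then show ?thesis
      unfolding V_def using A B L2_add[OF L]
      by (intro CollectI conjI exI[of _ ?C]) (auto simp: antisym)
  qed
  have scaleV: "(\<lambda>r. c * g r) \<in> V" if "g \<in> V" for c g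
  proof -
    from that obtain A where A: "A \<subseteq> J" "finite A" "norm_L2 a (\<lambda>r. g r - fourier_part a ?e A g r) = 0"
      and L: "g \<in> L2 a"
      unfolding V_def by auto
    have "norm_L2 a (\<lambda>r. c * g r - fourier_part a ?e A (\<lambda>r. c * g r) r) = 0"
      using norm_L2_scale[of a c "\<lambda>r. g r - fourier_part a ?e A g r"] A(3)
      by (simp add: fourier_part_scale right_diff_distrib)
    then show ?thesis
      unfolding V_def using A(1,2) L2_scale[OF L] by (intro CollectI conjI exI[of _ A])
  qed
  have "onb a E"
    unfolding onb_def
  proof (intro conjI ballI)
    show "E \<subseteq> L2 a" using eL by (auto simp: E_def)
    show "inner_L2 a u v = (if u = v then 1 else 0)" if "u \<in> E" "v \<in> E" for u v
    proof -
      from that obtain i j where ij: "u = ?e i" "v = ?e j" "i \<in> J" "j \<in> J"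
        by (auto simp: E_def)
      show ?thesis
      proof (cases "i = j")
        case True
        then show ?thesis using ij by (simp add: J_def inner_L2_self)
      next
        case False
        then have "u \<noteq> v" using ij inj by (auto simp: inj_on_def)
        then show ?thesis using ij gram_schmidt_orthogonal[of p a, OF p False] by simp
      qed
    qed
    fix f assume f: "f \<in> L2 a"
    show "((\<lambda>F. norm_L2 a (\<lambda>r. f r - (\<Sum>e\<in>F. inner_L2 a e f * e r))) \<longlongrightarrow> 0)
        (finite_subsets_at_top E)"
    proof (rule tendstoI)
      fix \<epsilon> :: real assume "\<epsilon> > 0"
      then obtain g where g: "g \<in> V" "norm_L2 a (\<lambda>r. f r - g r) < \<epsilon>"
        using total[of V f \<epsilon>] pV addV scaleV f by (auto simp: V_def)
      then obtain A where A: "A \<subseteq> J" "finite A" "norm_L2 a (\<lambda>r. g r - fourier_part a ?e A g r) = 0"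
        and gL: "g \<in> L2 a"
        unfolding V_def by auto
      show "\<forall>\<^sub>F F in finite_subsets_at_top E.
          dist (norm_L2 a (\<lambda>r. f r - (\<Sum>e\<in>F. inner_L2 a e f * e r))) 0 < \<epsilon>"
        unfolding eventually_finite_subsets_at_top
      proof (intro exI[of _ "?e ` A"] conjI allI impI)
        show "finite (?e ` A)" "?e ` A \<subseteq> E" using A by (auto simp: E_def)
        fix F assume F: "finite F \<and> ?e ` A \<subseteq> F \<and> F \<subseteq> E"
        then obtain B where B: "B \<subseteq> J" "F = ?e ` B"
          unfolding E_def by (meson subset_imageE)
        have finB: "finite B"
          using F B finite_image_iff[OF inj_on_subset[OF inj B(1)]] by simp
        have AB: "A \<subseteq> B"
          using F B A(1) inj_on_image_subset_iff[OF inj A(1) B(1)] by simp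
        \<comment> \<open>g has a null residual as soon as B contains A, so the residual of f is at
          most that of f - g, which is at most the norm of f - g.\<close>
        have "norm_L2 a (\<lambda>r. f r - fourier_part a ?e B f r)
           \<le> norm_L2 a (\<lambda>r. (f r - g r) - fourier_part a ?e B (\<lambda>r. f r - g r) r)
             + norm_L2 a (\<lambda>r. g r - fourier_part a ?e B g r)"
        proof -
          have "(\<lambda>r. f r - fourier_part a ?e B f r)
            = (\<lambda>r. ((f r - g r) - fourier_part a ?e B (\<lambda>r. f r - g r) r)
                + (g r - fourier_part a ?e B g r))"
            by (subst fourier_part_diff) (auto simp: eL f gL)
          then show ?thesis
            by (simp only:) (intro norm_L2_triangle L2_intros f gL fL)
        qed
        also have "norm_L2 a (\<lambda>r. g r - fourier_part a ?e B g r) \<le> 0"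
          using norm_L2_fourier_residual_mono[OF on finB AB gL] A by simp
        also have "norm_L2 a (\<lambda>r. (f r - g r) - fourier_part a ?e B (\<lambda>r. f r - g r) r)
            \<le> norm_L2 a (\<lambda>r. f r - g r)"
          by (intro norm_L2_fourier_residual_le[OF on finB] L2_diff f gL)
        also note g(2)
        finally have "norm_L2 a (\<lambda>r. f r - fourier_part a (\<lambda>e. e) F f r) < \<epsilon>"
          using fourier[OF B(1)] B(2) by simp
        then show "dist (norm_L2 a (\<lambda>r. f r - (\<Sum>e\<in>F. inner_L2 a e f * e r))) 0 < \<epsilon>"
          by (simp add: fourier_part_def)
      qed
    qed
  qed
  then show ?thesis ..
qed

text \<open>Continuity of the inner product, applied to the expansion of u in the basis.\<close>

lemma onb_Parseval:
  assumes E: "onb a E" and "u \<in> L2 a" "v \<in> L2 a"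
  shows "((\<lambda>e. inner_L2 a e u * inner_L2 a v e) has_sum inner_L2 a v u) E"
proof -
  have EL: "E \<subseteq> L2 a" using E by (simp add: onb_def)
  \<comment> \<open>Intersecting with E keeps the sum in \<open>L2\<close> for every F, as
    \<open>tendsto_inner_L2\<close> demands, and changes nothing for the finite subsets of E seen by
    the filter.\<close>
  let ?S = "\<lambda>F. fourier_part a (\<lambda>e. e) (F \<inter> E) u"
  have SL: "?S F \<in> L2 a" for F using EL by (intro L2_fourier_part) auto
  have "((\<lambda>F. norm_L2 a (\<lambda>r. u r - (\<Sum>e\<in>F. inner_L2 a e u * e r))) \<longlongrightarrow> 0) (finite_subsets_at_top E)"
    using E assms(2) by (simp add: onb_def)
  then have "((\<lambda>F. norm_L2 a (\<lambda>r. ?S F r - u r)) \<longlongrightarrow> 0) (finite_subsets_at_top E)"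
  proof (rule Lim_transform_eventually)
    show "\<forall>\<^sub>F F in finite_subsets_at_top E.
       norm_L2 a (\<lambda>r. u r - (\<Sum>e\<in>F. inner_L2 a e u * e r)) = norm_L2 a (\<lambda>r. ?S F r - u r)"
      by (rule eventually_finite_subsets_at_top_weakI)
         (simp add: Int_absorb2 fourier_part_def norm_L2_minus_commute)
  qed
  then have "((\<lambda>F. inner_L2 a v (?S F)) \<longlongrightarrow> inner_L2 a v u) (finite_subsets_at_top E)"
    by (intro tendsto_inner_L2 SL assms) auto
  moreover have "\<forall>\<^sub>F F in finite_subsets_at_top E.
     inner_L2 a v (?S F) = (\<Sum>e\<in>F. inner_L2 a e u * inner_L2 a v e)"
  proof (rule eventually_finite_subsets_at_top_weakI)
    fix F assume F: "finite F" "F \<subseteq> E"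
    show "inner_L2 a v (?S F) = (\<Sum>e\<in>F. inner_L2 a e u * inner_L2 a v e)"
      using F EL assms
      by (subst inner_L2_fourier_part_right) (auto simp: Int_absorb2 mult.commute intro!: sum.cong)
  qed
  ultimately show ?thesis
    unfolding has_sum_def by (rule Lim_transform_eventually)
qed

section \<open>Density of polynomials and the trace\<close>

definition monomial_fun :: "nat \<Rightarrow> nat \<Rightarrow> wavefun" where
  "monomial_fun i j = (\<lambda>r. complex_of_real ((r$1) ^ i * (r$2) ^ j))"

lemma L2_monomial_fun: "monomial_fun i j \<in> L2 a"
  unfolding monomial_fun_def by (intro L2_continuous continuous_intros)

lemma real_polynomial_in_monomial_span:
  assumes "real_polynomial_function g"
    and mono: "\<And>i j. monomial_fun i j \<in> V"
    and add: "\<And>g h. g \<in> V \<Longrightarrow> h \<in> V \<Longrightarrow> (\<lambda>r. g r + h r) \<in> V"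
    and scale: "\<And>c g. g \<in> V \<Longrightarrow> (\<lambda>r. c * g r) \<in> V"
  shows "(\<lambda>r. complex_of_real (g r)) \<in> V"
proof -
  text \<open>Carrying a factor \<open>w\<close> whose monomial multiples lie in \<open>V\<close> makes the product case of
    the induction compose.\<close>
  have "(\<lambda>r. complex_of_real (g r * w r) * monomial_fun i j r) \<in> V"
    if "\<And>i j. (\<lambda>r. complex_of_real (w r) * monomial_fun i j r) \<in> V" for w i j
    using assms(1) that
  proof (induction g arbitrary: w i j rule: real_polynomial_function.induct)
    case (linear f)
    interpret f: bounded_linear f by fact
    define c1 c2 where "c1 = f (axis 1 1)" and "c2 = f (axis 2 1)"
    have f: "f r = r$1 * c1 + r$2 * c2" for r
    proof -
      have "r = (r$1) *\<^sub>R axis 1 1 + (r$2) *\<^sub>R axis 2 1"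
        by (simp add: vec_eq_iff forall_2 axis_def)
      then have "f r = f ((r$1) *\<^sub>R axis 1 1 + (r$2) *\<^sub>R axis 2 1)" by simp
      then show ?thesis by (simp add: f.add f.scaleR c1_def c2_def)
    qed
    have "(\<lambda>r. complex_of_real c1 * (complex_of_real (w r) * monomial_fun (Suc i) j r)
             + complex_of_real c2 * (complex_of_real (w r) * monomial_fun i (Suc j) r)) \<in> V"
      by (intro add scale linear.prems)
    then show ?case
      by (rule back_subst[of "\<lambda>f. f \<in> V"])
         (simp add: fun_eq_iff f monomial_fun_def algebra_simps)
  next
    case (const c)
    then show ?case using scale[OF const.prems, of "complex_of_real c"] by (simp add: mult.assoc)
  next
    case (add f g)
    show ?case
      using assms(3)[OF add.IH(1)[OF add.prems] add.IH(2)[OF add.prems]]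
      by (simp add: algebra_simps)
  next
    case (mult f g)
    show ?case
      using mult.IH(1)[OF mult.IH(2)[OF mult.prems]] by (simp add: mult.assoc)
  qed
  from this[of "\<lambda>_. 1" 0 0] mono show ?thesis
    by (simp add: monomial_fun_def)
qed

text \<open>Truncation to the set where \<open>|f|\<close> is at most n; the squared error is
  dominated by \<open>|f|^2\<close>.\<close>

lemma L2_approx_bounded:
  assumes f: "f \<in> L2 a" and "\<epsilon> > 0"
  shows "\<exists>g B. g \<in> borel_measurable (disk_measure a) \<and> (\<forall>r. cmod (g r) \<le> B)
    \<and> norm_L2 a (\<lambda>r. f r - g r) < \<epsilon>"
proof -
  note [measurable] = L2_measurable[OF f]
  define g where "g = (\<lambda>n r. if cmod (f r) \<le> real n then f r else 0)"
  have g_meas [measurable]: "g n \<in> borel_measurable (disk_measure a)" for n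
    unfolding g_def by measurable
  have "(\<lambda>n. LINT r|disk_measure a. (cmod (f r - g n r))\<^sup>2) \<longlonglongrightarrow> (LINT r|disk_measure a. 0)"
  proof (rule integral_dominated_convergence[where w="\<lambda>r. (cmod (f r))\<^sup>2"])
    show "AE r in disk_measure a. (\<lambda>n. (cmod (f r - g n r))\<^sup>2) \<longlonglongrightarrow> 0"
    proof (rule AE_I2)
      fix r
      obtain N where N: "cmod (f r) \<le> real N" using real_arch_simple by blast
      have "\<forall>\<^sub>F n in sequentially. (cmod (f r - g n r))\<^sup>2 = 0"
        using eventually_ge_at_top[of N]
      proof eventually_elim
        case (elim n)
        then have "cmod (f r) \<le> real n" using N by linarith
        then show ?case by (simp add: g_def)
      qed
      then show "(\<lambda>n. (cmod (f r - g n r))\<^sup>2) \<longlonglongrightarrow> 0" by (rule tendsto_eventually)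
    qed
    show "AE r in disk_measure a. norm ((cmod (f r - g n r))\<^sup>2) \<le> (cmod (f r))\<^sup>2" for n
      by (rule AE_I2) (simp add: g_def)
  qed (use L2_integrable[OF f] in measurable)
  then have "(\<lambda>n. sqrt (LINT r|disk_measure a. (cmod (f r - g n r))\<^sup>2)) \<longlonglongrightarrow> sqrt 0"
    by (intro tendsto_real_sqrt) simp
  then have "(\<lambda>n. norm_L2 a (\<lambda>r. f r - g n r)) \<longlonglongrightarrow> 0"
    by (simp add: norm_L2_def)
  then have "\<forall>\<^sub>F n in sequentially. norm_L2 a (\<lambda>r. f r - g n r) < \<epsilon>"
    using \<open>\<epsilon> > 0\<close> by (rule order_tendstoD(2))
  then obtain n where n: "norm_L2 a (\<lambda>r. f r - g n r) < \<epsilon>"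
    by (auto simp: eventually_sequentially)
  have "\<forall>r. cmod (g n r) \<le> real n" by (simp add: g_def)
  then show ?thesis using n g_meas[of n] by (intro exI[of _ "g n"] exI[of _ "real n"] conjI)
qed

text \<open>A measurable function is a limit of continuous ones off a negligible set, but these need
  not be uniformly bounded. Sending their values to the nearest point of the ball of radius B
  preserves continuity and the limit and supplies a dominating constant.\<close>

lemma bounded_approx_continuous:
  fixes f :: wavefun
  assumes f: "f \<in> borel_measurable (disk_measure a)" and B: "\<And>r. cmod (f r) \<le> B" and "\<epsilon> > 0"
  shows "\<exists>g. continuous_on UNIV g \<and> norm_L2 a (\<lambda>r. f r - g r) < \<epsilon>"
proof -
  have "f measurable_on (cball 0 a)"
    using f by (subst measurable_on_iff_borel_measurable) (auto simp: disk_measure_def)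
  then obtain N g where N: "negligible N" and g: "\<And>n. continuous_on UNIV (g n)"
    and lim: "\<And>x. x \<notin> N \<Longrightarrow> (\<lambda>n. g n x) \<longlonglongrightarrow> (if x \<in> cball 0 a then f x else 0)"
    unfolding measurable_on_def by (elim exE conjE) (rule that; (assumption | erule spec | (drule spec, erule (1) mp)))
  have "0 \<le> B" using B[of 0] norm_ge_zero[of "f 0"] by linarith
  let ?p = "closest_point (cball (0::complex) B)"
  have cont_p: "continuous_on UNIV ?p"
    using \<open>0 \<le> B\<close> by (intro continuous_on_closest_point) auto
  define h where "h = (\<lambda>n r. ?p (g n r))"
  have h_cont: "continuous_on UNIV (h n)" for n
    unfolding h_def using continuous_on_compose[OF g continuous_on_subset[OF cont_p]]
    by (auto simp: o_def)
  have h_bound: "cmod (h n r) \<le> B" for n r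
    using closest_point_in_set[of "cball (0::complex) B" "g n r"] \<open>0 \<le> B\<close> by (simp add: h_def)
  have h_meas [measurable]: "h n \<in> borel_measurable (disk_measure a)" for n
    by (rule continuous_measurable_disk[OF continuous_on_subset[OF h_cont]]) simp
  note [measurable] = f
  interpret finite_measure "disk_measure a" by simp
  have "(\<lambda>n. LINT r|disk_measure a. (cmod (f r - h n r))\<^sup>2) \<longlonglongrightarrow> (LINT r|disk_measure a. 0)"
  proof (rule integral_dominated_convergence[where w="\<lambda>r. (2 * B)\<^sup>2"])
    have "AE r in lebesgue. r \<notin> N"
      using N by (intro AE_not_in) (simp add: negligible_iff_null_sets)
    then have "AE r in disk_measure a. r \<notin> N"
      unfolding disk_measure_def by (subst AE_restrict_space_iff) auto
    then show "AE r in disk_measure a. (\<lambda>n. (cmod (f r - h n r))\<^sup>2) \<longlonglongrightarrow> 0"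
    proof (rule AE_mp, intro AE_I2 impI)
      fix r :: "real^2" assume r: "r \<in> space (disk_measure a)" "r \<notin> N"
      then have "(\<lambda>n. g n r) \<longlonglongrightarrow> f r" using lim[of r] by simp
      then have "(\<lambda>n. h n r) \<longlonglongrightarrow> ?p (f r)"
        unfolding h_def using cont_p by (intro continuous_on_tendsto_compose[OF cont_p]) auto
      then have "(\<lambda>n. h n r) \<longlonglongrightarrow> f r"
        using closest_point_self[of "f r" "cball 0 B"] B by simp
      then have "(\<lambda>n. (cmod (f r - h n r))\<^sup>2) \<longlonglongrightarrow> (cmod (f r - f r))\<^sup>2"
        by (intro tendsto_intros)
      then show "(\<lambda>n. (cmod (f r - h n r))\<^sup>2) \<longlonglongrightarrow> 0" by simp
    qed
    show "AE r in disk_measure a. norm ((cmod (f r - h n r))\<^sup>2) \<le> (2 * B)\<^sup>2" for n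
    proof (rule AE_I2)
      fix r
      have "cmod (f r - h n r) \<le> 2 * B"
        using norm_triangle_ineq4[of "f r" "h n r"] B[of r] h_bound[of n r] by linarith
      then show "norm ((cmod (f r - h n r))\<^sup>2) \<le> (2 * B)\<^sup>2"
        using power_mono[of "cmod (f r - h n r)" "2 * B" 2] by simp
    qed
  qed (auto intro: integrable_const)
  then have "(\<lambda>n. sqrt (LINT r|disk_measure a. (cmod (f r - h n r))\<^sup>2)) \<longlonglongrightarrow> sqrt 0"
    by (intro tendsto_real_sqrt) simp
  then have "(\<lambda>n. norm_L2 a (\<lambda>r. f r - h n r)) \<longlonglongrightarrow> 0"
    by (simp add: norm_L2_def)
  then have "\<forall>\<^sub>F n in sequentially. norm_L2 a (\<lambda>r. f r - h n r) < \<epsilon>"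
    using \<open>\<epsilon> > 0\<close> by (rule order_tendstoD(2))
  then obtain n where "norm_L2 a (\<lambda>r. f r - h n r) < \<epsilon>"
    by (auto simp: eventually_sequentially)
  then show ?thesis
    using h_cont[of n] by (intro exI[of _ "h n"] conjI)
qed

lemma polynomials_dense_L2:
  assumes f: "f \<in> L2 a" and \<epsilon>: "\<epsilon> > 0"
  shows "\<exists>u v. real_polynomial_function u \<and> real_polynomial_function v
    \<and> norm_L2 a (\<lambda>r. f r - (complex_of_real (u r) + \<i> * complex_of_real (v r))) < \<epsilon>"
proof -
  obtain g B where g: "g \<in> borel_measurable (disk_measure a)" "\<And>r. cmod (g r) \<le> B"
    and fg: "norm_L2 a (\<lambda>r. f r - g r) < \<epsilon> / 3"
    using L2_approx_bounded[OF f, of "\<epsilon> / 3"] \<epsilon> by auto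
  obtain h where h: "continuous_on UNIV h" and gh: "norm_L2 a (\<lambda>r. g r - h r) < \<epsilon> / 3"
    using bounded_approx_continuous[OF g, of "\<epsilon> / 3"] \<epsilon> by auto
  \<comment> \<open>The summand 1 keeps the divisor positive even when the disk is null, since a is
    arbitrary here.\<close>
  define C where "C = sqrt (measure lebesgue (cball (0::real^2) a)) + 1"
  have C: "C > 0" unfolding C_def by (simp add: add_nonneg_pos)
  obtain p where p: "polynomial_function p" and hp: "\<And>r. r \<in> cball 0 a \<Longrightarrow> cmod (h r - p r) < \<epsilon> / 3 / C"
    using Stone_Weierstrass_polynomial_function[of "cball (0::real^2) a" h "\<epsilon> / 3 / C"]
      continuous_on_subset[OF h, of "cball 0 a"] \<epsilon> C by auto
  have L: "g \<in> L2 a" "h \<in> L2 a" "p \<in> L2 a"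
    using L2_bounded[OF g(1,2)] L2_continuous[OF continuous_on_subset[OF h]]
      L2_continuous[OF continuous_on_polymonial_function[OF p]] by auto
  have "norm_L2 a (\<lambda>r. h r - p r) \<le> \<epsilon> / 3 / C * sqrt (measure lebesgue (cball (0::real^2) a))"
    using hp \<epsilon> C by (intro norm_L2_bounded L2_diff L) (auto intro: less_imp_le)
  also have "\<dots> \<le> \<epsilon> / 3 / C * C"
    using \<epsilon> C by (intro mult_left_mono) (auto simp: C_def)
  finally have "norm_L2 a (\<lambda>r. h r - p r) \<le> \<epsilon> / 3" using C by simp
  then have "norm_L2 a (\<lambda>r. f r - p r) < \<epsilon>"
    using norm_L2_triangle_diff[OF f L(1,3)] norm_L2_triangle_diff[OF L] fg gh by linarith
  moreover have "real_polynomial_function (\<lambda>r. Re (p r))" "real_polynomial_function (\<lambda>r. Im (p r))"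
    using p bounded_linear_Re bounded_linear_Im by (auto simp: polynomial_function_def o_def)
  ultimately show ?thesis
    by (intro exI[of _ "\<lambda>r. Re (p r)"] exI[of _ "\<lambda>r. Im (p r)"]) (simp add: complex_eq[symmetric])
qed

text \<open>The enumerated monomials are total because polynomials are dense. This gives content to
  \<open>op_trace\<close>: if there were no basis, every number would meet its description.\<close>

lemma ex_onb: "\<exists>E. onb a E"
proof -
  let ?p = "\<lambda>n. monomial_fun (fst (prod_decode n)) (snd (prod_decode n))"
  have p: "monomial_fun i j = ?p (prod_encode (i, j))" for i j by simp
  show ?thesis
  proof (rule ex_onb_of_total[of ?p])
    fix V f and \<epsilon> :: real
    assume V: "\<And>n. ?p n \<in> V" "\<And>g h. \<lbrakk>g \<in> V; h \<in> V\<rbrakk> \<Longrightarrow> (\<lambda>r. g r + h r) \<in> V"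
      "\<And>c g. g \<in> V \<Longrightarrow> (\<lambda>r. c * g r) \<in> V" and f: "f \<in> L2 a" "\<epsilon> > 0"
    obtain u v where u: "real_polynomial_function u" and v: "real_polynomial_function v"
      and less: "norm_L2 a (\<lambda>r. f r - (complex_of_real (u r) + \<i> * complex_of_real (v r))) < \<epsilon>"
      using polynomials_dense_L2[OF f] by blast
    have mono: "monomial_fun i j \<in> V" for i j using V(1) p by metis
    have "(\<lambda>r. complex_of_real (u r) + \<i> * complex_of_real (v r)) \<in> V"
      by (intro V(2,3) real_polynomial_in_monomial_span[OF u] real_polynomial_in_monomial_span[OF v]
          mono)
    with less show "\<exists>g\<in>V. norm_L2 a (\<lambda>r. f r - g r) < \<epsilon>" by (rule bexI)
  qed (rule L2_monomial_fun)
qed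

section \<open>The trace of an operator of rank two\<close>

lemma op_trace_eqI:
  assumes "\<And>E. onb a E \<Longrightarrow> ((\<lambda>e. inner_L2 a e (A e)) has_sum t) E"
  shows "op_trace a A = t"
  unfolding op_trace_def
proof (rule the_equality)
  fix t' assume "\<forall>E. onb a E \<longrightarrow> ((\<lambda>e. inner_L2 a e (A e)) has_sum t') E"
  then show "t' = t" using assms ex_onb[of a] has_sum_unique by metis
qed (use assms in blast)

text \<open>By Parseval each ket-bra contributes its own inner product, whatever the basis. All
  traces in this development have \<open>rho\<close> as outermost factor, so their operators have
  this form literally and not only up to null functions.\<close>

lemma op_trace_rank_two:
  assumes L: "u1 \<in> L2 a" "u2 \<in> L2 a" "v1 \<in> L2 a" "v2 \<in> L2 a"
    and A: "\<And>f. f \<in> L2 a \<Longrightarrow> A f = (\<lambda>r. u1 r * inner_L2 a v1 f + u2 r * inner_L2 a v2 f)"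
  shows "op_trace a A = inner_L2 a v1 u1 + inner_L2 a v2 u2"
proof (rule op_trace_eqI)
  fix E assume E: "onb a E"
  then have EL: "e \<in> L2 a" if "e \<in> E" for e using that by (auto simp: onb_def)
  have "inner_L2 a e (A e) = inner_L2 a e u1 * inner_L2 a v1 e + inner_L2 a e u2 * inner_L2 a v2 e"
    if "e \<in> E" for e
    using EL[OF that] L inner_L2_scale_right[of a e "inner_L2 a v1 e" u1]
      inner_L2_scale_right[of a e "inner_L2 a v2 e" u2]
    by (simp add: A inner_L2_add_right L2_scale' mult.commute)
  then show "((\<lambda>e. inner_L2 a e (A e)) has_sum (inner_L2 a v1 u1 + inner_L2 a v2 u2)) E"
    using has_sum_add[OF onb_Parseval[OF E L(1,3)] onb_Parseval[OF E L(2,4)]]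
    by (simp cong: has_sum_cong)
qed

section \<open>Integrals over the disk\<close>

text \<open>One diagonal change of variables gives both reflections and dilations, from which the
  parity arguments and the radial moments follow.\<close>

lemma lebesgue_integral_coordinate_scaling:
  fixes f :: "real^2 \<Rightarrow> 'b::{banach,second_countable_topology}" and c :: "2 \<Rightarrow> real"
  assumes c: "\<And>m. c m \<noteq> 0" and f: "f \<in> borel_measurable lebesgue"
  shows "(LINT r|lebesgue. f r) = \<bar>c 1 * c 2\<bar> *\<^sub>R (LINT r|lebesgue. f (\<chi> m. c m * r$m))"
    and "(\<lambda>r. f (\<chi> m. c m * r$m)) \<in> borel_measurable lebesgue"
proof -
  let ?T = "\<lambda>r :: real^2. \<chi> m. c m * r$m"
  let ?c = "\<lambda>j :: real^2. \<Sum>m\<in>UNIV. c m * j$m"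
  have cB: "?c (axis m 1) = c m" for m
  proof -
    have "?c (axis m 1) = (\<Sum>n\<in>UNIV. if n = m then c m else 0)"
      by (intro sum.cong) (auto simp: axis_def)
    then show ?thesis by simp
  qed
  have B: "(Basis :: (real^2) set) = {axis 1 1, axis 2 1}"
    by (auto simp: Basis_vec_def UNIV_2)
  have neq: "axis 1 1 \<noteq> (axis 2 1 :: real^2)"
    by (simp add: axis_eq_axis)
  have T: "0 + (\<Sum>j\<in>Basis. (?c j * (r \<bullet> j)) *\<^sub>R j) = ?T r" for r
    by (simp add: B neq cB inner_axis, simp add: vec_eq_iff forall_2 axis_def)
  have c0: "?c j \<noteq> 0" if "j \<in> Basis" for j
    using that c cB by (auto simp: B)
  have prod: "(\<Prod>j\<in>Basis. \<bar>?c j\<bar>) = \<bar>c 1 * c 2\<bar>"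
    using neq by (simp add: B cB abs_mult)
  have leb: "lebesgue = density (distr lebesgue lebesgue ?T) (\<lambda>_. ennreal \<bar>c 1 * c 2\<bar>)"
    using lebesgue_affine_euclidean[of ?c 0] c0 unfolding T prod by simp
  have meas [measurable]: "?T \<in> lebesgue \<rightarrow>\<^sub>M lebesgue"
    using lebesgue_affine_measurable[of ?c 0] c0 unfolding T by simp
  note [measurable] = f
  show "(\<lambda>r. f (?T r)) \<in> borel_measurable lebesgue" by measurable
  have "(LINT r|lebesgue. f r)
      = (LINT r|density (distr lebesgue lebesgue ?T) (\<lambda>_. ennreal \<bar>c 1 * c 2\<bar>). f r)"
    using leb by simp
  also have "\<dots> = (LINT r|distr lebesgue lebesgue ?T. \<bar>c 1 * c 2\<bar> *\<^sub>R f r)"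
    by (subst integral_density) auto
  also have "\<dots> = (LINT r|lebesgue. \<bar>c 1 * c 2\<bar> *\<^sub>R f (?T r))"
    by (subst integral_distr) auto
  finally show "(LINT r|lebesgue. f r) = \<bar>c 1 * c 2\<bar> *\<^sub>R (LINT r|lebesgue. f (?T r))"
    by simp
qed

lemma integral_disk_measure:
  fixes f :: "real^2 \<Rightarrow> 'b::{banach,second_countable_topology}"
  shows "(LINT r|disk_measure a. f r) = (LINT r|lebesgue. indicator (cball 0 a) r *\<^sub>R f r)"
  unfolding disk_measure_def by (subst integral_restrict_space) auto

lemma measurable_indicator_disk:
  fixes f :: "real^2 \<Rightarrow> 'b::euclidean_space"
  assumes "f \<in> borel_measurable (disk_measure a)"
  shows "(\<lambda>r. indicator (cball 0 a) r *\<^sub>R f r) \<in> borel_measurable lebesgue"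
  using assms unfolding disk_measure_def
  by (subst (asm) borel_measurable_restrict_space_iff) auto

section \<open>Parity and radial moments on the disk\<close>

definition reflect :: "2 \<Rightarrow> real^2 \<Rightarrow> real^2" where
  "reflect i r = (\<chi> m. (if m = i then -1 else 1) * r$m)"

lemma norm_reflect [simp]: "norm (reflect i r) = norm r"
  by (simp add: norm_vec_def L2_set_def reflect_def sum_2 power2_eq_square)

lemma reflect_nth: "reflect i r $ m = (if m = i then - r$m else r$m)"
  by (simp add: reflect_def)

text \<open>The reflection preserves the disk and Lebesgue measure, so the integral equals its own
  negative.\<close>

lemma integral_disk_odd:
  fixes f :: "real^2 \<Rightarrow> 'b::euclidean_space"
  assumes f: "f \<in> borel_measurable (disk_measure a)" and odd: "\<And>r. f (reflect i r) = - f r"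
  shows "(LINT r|disk_measure a. f r) = 0"
proof -
  let ?g = "\<lambda>r. indicator (cball 0 a) r *\<^sub>R f r"
  have "(LINT r|lebesgue. ?g r) = (LINT r|lebesgue. ?g (reflect i r))"
    using lebesgue_integral_coordinate_scaling(1)[of "\<lambda>m. if m = i then -1 else 1", OF _
        measurable_indicator_disk[OF f]]
    by (simp add: reflect_def[symmetric] del: indicator_simps split: if_splits)
  also have "(\<lambda>r. ?g (reflect i r)) = (\<lambda>r. - ?g r)"
    by (simp add: fun_eq_iff odd indicator_def)
  finally have "(LINT r|lebesgue. ?g r) = - (LINT r|lebesgue. ?g r)"
    by simp
  then have "(2::real) *\<^sub>R (LINT r|lebesgue. ?g r) = 0"
    unfolding scaleR_2 eq_neg_iff_add_eq_0[symmetric] .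
  then show ?thesis by (simp add: integral_disk_measure)
qed

lemma integral_disk_scaling:
  fixes f :: "real^2 \<Rightarrow> real"
  assumes f: "continuous_on UNIV f" and "0 < c"
  shows "(LINT r|disk_measure (c * a). f r) = c\<^sup>2 * (LINT r|disk_measure a. f (c *\<^sub>R r))"
proof -
  have "(LINT r|disk_measure (c * a). f r) = (LINT r|lebesgue. indicator (cball 0 (c * a)) r *\<^sub>R f r)"
    by (rule integral_disk_measure)
  also have "\<dots> = \<bar>c * c\<bar> *\<^sub>R (LINT r|lebesgue. indicator (cball 0 (c * a)) (\<chi> m. c * r$m) *\<^sub>R f (\<chi> m. c * r$m))"
    using assms
    by (intro lebesgue_integral_coordinate_scaling(1) measurable_indicator_disk
        continuous_measurable_disk) (auto intro: continuous_on_subset)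
  also have "(\<lambda>r. indicator (cball 0 (c * a)) (\<chi> m. c * r$m) *\<^sub>R f (\<chi> m. c * r$m))
      = (\<lambda>r. indicator (cball 0 a) r *\<^sub>R f (c *\<^sub>R r))"
  proof
    fix r :: "real^2"
    have "(\<chi> m. c * r$m) = c *\<^sub>R r" by (simp add: vec_eq_iff)
    then show "indicator (cball 0 (c * a)) (\<chi> m. c * r$m) *\<^sub>R f (\<chi> m. c * r$m)
        = indicator (cball 0 a) r *\<^sub>R f (c *\<^sub>R r)"
      using \<open>0 < c\<close> by (simp add: indicator_def)
  qed
  also have "\<bar>c * c\<bar> *\<^sub>R (LINT r|lebesgue. indicator (cball 0 a) r *\<^sub>R f (c *\<^sub>R r))
      = c\<^sup>2 * (LINT r|disk_measure a. f (c *\<^sub>R r))"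
    by (simp add: integral_disk_measure power2_eq_square)
  finally show ?thesis .
qed

text \<open>The inner product of \<open>x_i |r|^(2j)\<close> and \<open>x_i |r|^(2l)\<close> is the
  moment with m = j + l.\<close>

definition disk_moment :: "real \<Rightarrow> 2 \<Rightarrow> nat \<Rightarrow> real" where
  "disk_moment a i m = (LINT r|disk_measure a. (r$i)\<^sup>2 * (norm r) ^ (2 * m))"

text \<open>The integrand is homogeneous of degree 2m + 2, and the Jacobian in the plane adds
  2.\<close>

lemma disk_moment_scaling:
  assumes "0 < c"
  shows "disk_moment (c * a) i m = c ^ (2 * m + 4) * disk_moment a i m"
proof -
  have "disk_moment (c * a) i m
      = c\<^sup>2 * (LINT r|disk_measure a. ((c *\<^sub>R r)$i)\<^sup>2 * (norm (c *\<^sub>R r)) ^ (2 * m))"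
    unfolding disk_moment_def
    by (intro integral_disk_scaling assms continuous_intros)
  also have "(\<lambda>r. ((c *\<^sub>R r)$i)\<^sup>2 * (norm (c *\<^sub>R r)) ^ (2 * m))
      = (\<lambda>r. c ^ (2 * m + 2) * ((r$i)\<^sup>2 * (norm r) ^ (2 * m)))"
    using assms by (simp add: fun_eq_iff power_mult_distrib power_add power2_eq_square mult_ac)
  finally have "disk_moment (c * a) i m = c\<^sup>2 * (c ^ (2 * m + 2) * disk_moment a i m)"
    unfolding disk_moment_def by (simp only: integral_mult_right_zero)
  then show ?thesis
    by (simp add: power_add eval_nat_numeral mult_ac)
qed

lemma integral_annulus:
  fixes f :: "real^2 \<Rightarrow> real"
  assumes f: "continuous_on UNIV f" and "0 < c" "c \<le> 1" "0 < a"
  shows "(LINT r|disk_measure a. f r) - (LINT r|disk_measure (c * a). f r)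
    = (LINT r|disk_measure a. indicator (cball 0 a - cball 0 (c * a)) r * f r)"
    and "integrable (disk_measure a) (\<lambda>r. indicator (cball 0 a - cball 0 (c * a)) r * f r)"
proof -
  have ca: "c * a \<le> a" using assms by simp
  have sub: "cball (0::real^2) (c * a) \<subseteq> cball 0 a"
    using ca by auto
  have int: "integrable (disk_measure b) f" for b
    by (rule integrable_disk_continuous[OF continuous_on_subset[OF f]]) simp
  have leb: "integrable lebesgue (\<lambda>r. indicator (cball 0 b) r *\<^sub>R f r)" for b
    using int[of b] unfolding disk_measure_def by (subst (asm) integrable_restrict_space) auto
  have "(LINT r|disk_measure a. f r) - (LINT r|disk_measure (c * a). f r)
      = (LINT r|lebesgue. indicator (cball 0 a) r *\<^sub>R f r - indicator (cball 0 (c * a)) r *\<^sub>R f r)"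
    unfolding integral_disk_measure using leb by simp
  also have "\<dots> = (LINT r|lebesgue. indicator (cball 0 a) r *\<^sub>R
      (indicator (cball 0 a - cball 0 (c * a)) r * f r))"
    using ca by (intro Bochner_Integration.integral_cong refl) (auto simp: indicator_def)
  also have "\<dots> = (LINT r|disk_measure a. indicator (cball 0 a - cball 0 (c * a)) r * f r)"
    by (simp add: integral_disk_measure)
  finally show "(LINT r|disk_measure a. f r) - (LINT r|disk_measure (c * a). f r)
    = (LINT r|disk_measure a. indicator (cball 0 a - cball 0 (c * a)) r * f r)" .
  have "cball 0 a - cball 0 (c * a) \<in> sets (disk_measure a)"
    unfolding disk_measure_def by (auto simp: sets_restrict_space_iff)
  then show "integrable (disk_measure a) (\<lambda>r. indicator (cball 0 a - cball 0 (c * a)) r * f r)"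
    using int[of a] integrable_mult_indicator[of _ "disk_measure a" f] by simp
qed

text \<open>Scaling makes the integral over the annulus of radii \<open>ca\<close> and \<open>a\<close> equal to
  \<open>(1 - c\<^sup>2\<^sup>m\<^sup>+\<^sup>4)\<close> times the moment; on a thin annulus the factor \<open>\<bar>r\<bar>\<^sup>2\<^sup>m\<close> is almost constant.\<close>

lemma disk_moment_eq:
  assumes "0 < a"
  shows "disk_moment a i m * (real m + 2) = 2 * a ^ (2 * m) * disk_moment a i 0"
proof -
  let ?K = "disk_moment a i"
  have bounds: "(c * a) ^ (2 * m) * ((1 - c ^ 4) * ?K 0) \<le> (1 - c ^ (2 * m + 4)) * ?K m \<and>
      (1 - c ^ (2 * m + 4)) * ?K m \<le> a ^ (2 * m) * ((1 - c ^ 4) * ?K 0)" if c: "0 < c" "c < 1" for c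
  proof -
    let ?A = "\<lambda>r :: real^2. indicator (cball 0 a - cball 0 (c * a)) r :: real"
    let ?f = "\<lambda>m r :: real^2. (r$i)\<^sup>2 * (norm r) ^ (2 * m)"
    have cont: "continuous_on UNIV (?f m)" for m by (intro continuous_intros)
    have eq: "(1 - c ^ (2 * m + 4)) * ?K m = (LINT r|disk_measure a. ?A r * ?f m r)" for m
      using integral_annulus(1)[OF cont[of m] c(1) less_imp_le[OF c(2)] assms]
        disk_moment_scaling[OF c(1), of a i m]
      by (simp add: disk_moment_def algebra_simps)
    have int: "integrable (disk_measure a) (\<lambda>r. ?A r * ?f m r)" for m
      by (rule integral_annulus(2)[OF cont c(1) less_imp_le[OF c(2)] assms])
    have eq0: "(1 - c ^ 4) * ?K 0 = (LINT r|disk_measure a. ?A r * ?f 0 r)"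
      using eq[of 0] by simp
    have lower: "(LINT r|disk_measure a. (c * a) ^ (2 * m) * (?A r * ?f 0 r))
        \<le> (LINT r|disk_measure a. ?A r * ?f m r)"
    proof (intro integral_mono int integrable_mult_right)
      fix r :: "real^2"
      show "(c * a) ^ (2 * m) * (?A r * ?f 0 r) \<le> ?A r * ?f m r"
      proof (cases "r \<in> cball 0 a - cball 0 (c * a)")
        case True
        then have "(c * a) ^ (2 * m) \<le> (norm r) ^ (2 * m)"
          using c assms by (intro power_mono) auto
        then have "(c * a) ^ (2 * m) * (r$i)\<^sup>2 \<le> (norm r) ^ (2 * m) * (r$i)\<^sup>2"
          by (rule mult_right_mono) simp
        then show ?thesis using True by (simp add: mult.commute)
      qed simp
    qed
    have upper: "(LINT r|disk_measure a. ?A r * ?f m r)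
        \<le> (LINT r|disk_measure a. a ^ (2 * m) * (?A r * ?f 0 r))"
    proof (intro integral_mono int integrable_mult_right)
      fix r :: "real^2"
      show "?A r * ?f m r \<le> a ^ (2 * m) * (?A r * ?f 0 r)"
      proof (cases "r \<in> cball 0 a - cball 0 (c * a)")
        case True
        then have "(norm r) ^ (2 * m) \<le> a ^ (2 * m)"
          by (intro power_mono) auto
        then have "(norm r) ^ (2 * m) * (r$i)\<^sup>2 \<le> a ^ (2 * m) * (r$i)\<^sup>2"
          by (rule mult_right_mono) simp
        then show ?thesis using True by (simp add: mult.commute)
      qed simp
    qed
    show ?thesis
      using lower upper unfolding eq eq0 by simp
  qed
  \<comment> \<open>Dividing by 1 - c and letting c increase to 1 replaces \<open>1 - c^n\<close> by
    n. The two bounds then pinch to \<open>(2m + 4) K m = 4 a^(2m) K 0\<close>.\<close>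
  have geom: "((\<lambda>c::real. (1 - c ^ n) / (1 - c)) \<longlongrightarrow> real n) (at_left 1)" for n
  proof -
    have "((\<lambda>c::real. \<Sum>j<n. c ^ j) \<longlongrightarrow> (\<Sum>j<n. 1 ^ j)) (at_left 1)"
      by (intro tendsto_intros)
    moreover have "\<forall>\<^sub>F c::real in at_left 1. (\<Sum>j<n. c ^ j) = (1 - c ^ n) / (1 - c)"
      unfolding eventually_at_left_field
      by (intro exI[of _ 0]) (auto simp: sum_gp_strict)
    ultimately show ?thesis
      by (simp add: Lim_transform_eventually)
  qed
  have c1: "((\<lambda>c::real. c) \<longlongrightarrow> 1) (at_left 1)" by (rule tendsto_ident_at)
  have ev: "\<forall>\<^sub>F c::real in at_left 1. 0 < c \<and> c < 1"
    unfolding eventually_at_left_field by (intro exI[of _ 0]) auto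
  have limM: "((\<lambda>c. (1 - c ^ (2 * m + 4)) / (1 - c) * ?K m) \<longlongrightarrow> real (2 * m + 4) * ?K m) (at_left 1)"
    by (intro tendsto_intros geom)
  have limU: "((\<lambda>c. a ^ (2 * m) * ((1 - c ^ 4) / (1 - c) * ?K 0)) \<longlongrightarrow> a ^ (2 * m) * (real 4 * ?K 0)) (at_left 1)"
    by (intro tendsto_intros geom)
  have limL: "((\<lambda>c. (c * a) ^ (2 * m) * ((1 - c ^ 4) / (1 - c) * ?K 0))
      \<longlongrightarrow> (1 * a) ^ (2 * m) * (real 4 * ?K 0)) (at_left 1)"
    by (intro tendsto_intros geom c1)
  have evU: "\<forall>\<^sub>F c in at_left 1. (1 - c ^ (2 * m + 4)) / (1 - c) * ?K m
      \<le> a ^ (2 * m) * ((1 - c ^ 4) / (1 - c) * ?K 0)"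
    using ev
  proof eventually_elim
    case (elim c)
    then show ?case
      using divide_right_mono[OF conjunct2[OF bounds[of c]], of "1 - c"] by (simp add: mult.assoc)
  qed
  have evL: "\<forall>\<^sub>F c in at_left 1. (c * a) ^ (2 * m) * ((1 - c ^ 4) / (1 - c) * ?K 0)
      \<le> (1 - c ^ (2 * m + 4)) / (1 - c) * ?K m"
    using ev
  proof eventually_elim
    case (elim c)
    then show ?case
      using divide_right_mono[OF conjunct1[OF bounds[of c]], of "1 - c"] by (simp add: mult.assoc)
  qed
  have "real (2 * m + 4) * ?K m \<le> a ^ (2 * m) * (real 4 * ?K 0)"
    by (rule tendsto_le[OF _ limU limM evU]) simp
  moreover have "(1 * a) ^ (2 * m) * (real 4 * ?K 0) \<le> real (2 * m + 4) * ?K m"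
    by (rule tendsto_le[OF _ limM limL evL]) simp
  ultimately show ?thesis by (simp add: algebra_simps)
qed

section \<open>Bounded operators and strong sums of rank-one projectors\<close>

text \<open>What makes the supremum in \<open>op_norm\<close> a genuine bound. It passes to sums,
  multiples and compositions by estimates alone, without arguments about linearity almost
  everywhere.\<close>

definition norm_bounded :: "real \<Rightarrow> wave_op \<Rightarrow> bool" where
  "norm_bounded a A \<longleftrightarrow> (\<forall>f\<in>L2 a. A f \<in> L2 a) \<and> (\<exists>C. \<forall>f\<in>L2 a. norm_L2 a (A f) \<le> C * norm_L2 a f)"

lemma norm_boundedE:
  assumes "norm_bounded a A"
  obtains C where "C \<ge> 0" "\<And>f. f \<in> L2 a \<Longrightarrow> norm_L2 a (A f) \<le> C * norm_L2 a f"
proof -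
  obtain C where C: "\<forall>f\<in>L2 a. norm_L2 a (A f) \<le> C * norm_L2 a f"
    using assms unfolding norm_bounded_def by blast
  show ?thesis
  proof (rule that[of "max C 0"])
    fix f assume f: "f \<in> L2 a"
    then have "norm_L2 a (A f) \<le> C * norm_L2 a f" using C by simp
    also have "\<dots> \<le> max C 0 * norm_L2 a f" by (intro mult_right_mono) auto
    finally show "norm_L2 a (A f) \<le> max C 0 * norm_L2 a f" .
  qed simp
qed

lemma norm_bounded_L2: "norm_bounded a A \<Longrightarrow> f \<in> L2 a \<Longrightarrow> A f \<in> L2 a"
  by (simp add: norm_bounded_def)

lemma norm_bounded_op: "bounded_op a A \<Longrightarrow> norm_bounded a A"
  by (simp add: norm_bounded_def bounded_op_def)

lemma bounded_op_add:
  assumes "bounded_op a P" "f \<in> L2 a" "g \<in> L2 a"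
  shows "norm_L2 a (\<lambda>r. P (\<lambda>x. f x + g x) r - (P f r + P g r)) = 0"
  using assms unfolding bounded_op_def
  by (subst norm_L2_diff_eq_0_iff) (auto intro!: L2_add)

lemma bounded_op_scale:
  assumes "bounded_op a P" "f \<in> L2 a"
  shows "norm_L2 a (\<lambda>r. P (\<lambda>x. c * f x) r - c * P f r) = 0"
  using assms unfolding bounded_op_def
  by (subst norm_L2_diff_eq_0_iff) (auto intro!: L2_scale)

lemma bounded_op_L2: "bounded_op a P \<Longrightarrow> f \<in> L2 a \<Longrightarrow> P f \<in> L2 a"
  by (simp add: bounded_op_def)

lemma inner_L2_bounded_op_add:
  assumes "bounded_op a P" "f \<in> L2 a" "g \<in> L2 a" "h \<in> L2 a"
  shows "inner_L2 a h (P (\<lambda>r. f r + g r)) = inner_L2 a h (P f) + inner_L2 a h (P g)"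
  using inner_L2_cong_right[OF assms(4) bounded_op_L2[OF assms(1) L2_add[OF assms(2,3)]]
      L2_add[OF bounded_op_L2[OF assms(1,2)] bounded_op_L2[OF assms(1,3)]]
      bounded_op_add[OF assms(1-3)]]
  by (simp add: inner_L2_add_right assms bounded_op_L2[OF assms(1)])

lemma inner_L2_bounded_op_scale:
  assumes "bounded_op a P" "f \<in> L2 a" "h \<in> L2 a"
  shows "inner_L2 a h (P (\<lambda>r. c * f r)) = c * inner_L2 a h (P f)"
  using inner_L2_cong_right[OF assms(3) bounded_op_L2[OF assms(1) L2_scale[OF assms(2)]]
      L2_scale[OF bounded_op_L2[OF assms(1,2)]] bounded_op_scale[OF assms(1,2)]]
  by (simp add: inner_L2_scale_right)

lemma inner_L2_bounded_op_diff:
  assumes "bounded_op a P" "f \<in> L2 a" "g \<in> L2 a" "h \<in> L2 a"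
  shows "inner_L2 a h (P (\<lambda>r. f r - g r)) = inner_L2 a h (P f) - inner_L2 a h (P g)"
  using inner_L2_bounded_op_add[OF assms(1,2) L2_scale[OF assms(3)] assms(4), of "-1"]
    inner_L2_bounded_op_scale[OF assms(1,3,4), of "-1"]
  by simp

lemma bounded_op_diff:
  assumes "bounded_op a P" "f \<in> L2 a" "g \<in> L2 a"
  shows "norm_L2 a (\<lambda>r. P (\<lambda>x. f x - g x) r - (P f r - P g r)) = 0"
proof (rule norm_L2_null_if_orthogonal)
  fix h assume h: "h \<in> L2 a"
  show "inner_L2 a h (\<lambda>r. P (\<lambda>x. f x - g x) r - (P f r - P g r)) = 0"
    using assms h
    by (simp add: inner_L2_diff_right inner_L2_bounded_op_diff bounded_op_L2[OF assms(1)] L2_diff)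
qed (intro L2_diff bounded_op_L2[OF assms(1)] assms(2,3))

text \<open>Images are additive only up to null functions, so \<open>P (u t) - P u0\<close> is
  compared with the image of \<open>u t - u0\<close> before boundedness is applied.\<close>

lemma tendsto_bounded_op:
  assumes P: "bounded_op a P" and u: "\<And>t. u t \<in> L2 a" "u0 \<in> L2 a"
    and lim: "((\<lambda>t. norm_L2 a (\<lambda>r. u t r - u0 r)) \<longlongrightarrow> 0) F"
  shows "((\<lambda>t. norm_L2 a (\<lambda>r. P (u t) r - P u0 r)) \<longlongrightarrow> 0) F"
proof -
  obtain C where C: "C \<ge> 0" "\<And>f. f \<in> L2 a \<Longrightarrow> norm_L2 a (P f) \<le> C * norm_L2 a f"
    using norm_boundedE[OF norm_bounded_op[OF P]] by blast
  have *: "norm (norm_L2 a (\<lambda>r. P (u t) r - P u0 r)) \<le> C * norm_L2 a (\<lambda>r. u t r - u0 r)" for t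
  proof -
    let ?d = "\<lambda>r. u t r - u0 r" and ?g = "\<lambda>r. P (u t) r - P u0 r"
    have L: "?d \<in> L2 a" "?g \<in> L2 a" "P ?d \<in> L2 a"
      by (intro L2_diff bounded_op_L2[OF P] u)+
    have "norm_L2 a (\<lambda>r. ?g r - P ?d r) = 0"
      using bounded_op_diff[OF P u(1)[of t] u(2)] norm_L2_minus_commute[of a ?g "P ?d"] by simp
    then have "norm_L2 a ?g \<le> norm_L2 a (P ?d)"
      using norm_L2_triangle_sub[OF L(2,3)] by simp
    also have "\<dots> \<le> C * norm_L2 a ?d" by (rule C(2)[OF L(1)])
    finally show ?thesis by simp
  qed
  have "((\<lambda>t. C * norm_L2 a (\<lambda>r. u t r - u0 r)) \<longlongrightarrow> C * 0) F"
    by (intro tendsto_intros lim)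
  then show ?thesis
    by (intro Lim_null_comparison[OF always_eventually[OF allI[OF *]]]) simp
qed

section \<open>Strong sums of rank-one projectors\<close>

definition strong_sum :: "real \<Rightarrow> (nat \<Rightarrow> wavefun) \<Rightarrow> wave_op \<Rightarrow> bool" where
  "strong_sum a e P \<longleftrightarrow> (\<forall>f\<in>L2 a. P f \<in> L2 a \<and>
     (\<lambda>N. norm_L2 a (\<lambda>r. P f r - fourier_part a e {..<N} f r)) \<longlonglongrightarrow> 0)"

context
  fixes a :: real and e :: "nat \<Rightarrow> wavefun" and P :: wave_op
  assumes on: "orthonormal_or_null a e" and P: "strong_sum a e P"
begin

lemma strong_sum_L2: "f \<in> L2 a \<Longrightarrow> P f \<in> L2 a"
  using P by (simp add: strong_sum_def)

lemma strong_sum_fourier_L2: "fourier_part a e F f \<in> L2 a"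
  by (rule L2_fourier_part) (rule orthonormal_or_null_L2[OF on])

lemma strong_sum_tendsto:
  "f \<in> L2 a \<Longrightarrow> (\<lambda>N. norm_L2 a (\<lambda>r. P f r - fourier_part a e {..<N} f r)) \<longlonglongrightarrow> 0"
  using P by (simp add: strong_sum_def)

lemma strong_sum_tendsto':
  "f \<in> L2 a \<Longrightarrow> (\<lambda>N. norm_L2 a (\<lambda>r. fourier_part a e {..<N} f r - P f r)) \<longlonglongrightarrow> 0"
  using strong_sum_tendsto by (subst norm_L2_minus_commute)

text \<open>Norm limits are unique up to null functions. Linearity, idempotence and the fixed
  functions of P are obtained by exhibiting a second limit of the same Fourier sums.\<close>

lemma strong_sum_unique:
  assumes f: "f \<in> L2 a" and h: "h \<in> L2 a"
    and lim: "(\<lambda>N. norm_L2 a (\<lambda>r. h r - fourier_part a e {..<N} f r)) \<longlonglongrightarrow> 0"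
  shows "norm_L2 a (\<lambda>r. P f r - h r) = 0"
proof -
  have "(\<lambda>N. norm_L2 a (\<lambda>r. P f r - fourier_part a e {..<N} f r)
      + norm_L2 a (\<lambda>r. fourier_part a e {..<N} f r - h r)) \<longlonglongrightarrow> 0 + 0"
    using lim by (intro tendsto_add strong_sum_tendsto f) (subst norm_L2_minus_commute)
  then have "norm_L2 a (\<lambda>r. P f r - h r) \<le> 0"
    using norm_L2_triangle_diff[OF strong_sum_L2[OF f] strong_sum_fourier_L2 h]
    by (intro LIMSEQ_le_const) auto
  then show ?thesis by (simp add: antisym)
qed

lemma strong_sum_inner_right:
  assumes "f \<in> L2 a" "g \<in> L2 a"
  shows "(\<lambda>N. inner_L2 a g (fourier_part a e {..<N} f)) \<longlonglongrightarrow> inner_L2 a g (P f)"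
  by (rule tendsto_inner_L2)
     (auto intro: strong_sum_fourier_L2 strong_sum_L2 assms strong_sum_tendsto')

lemma strong_sum_inner_left:
  assumes "f \<in> L2 a" "g \<in> L2 a"
  shows "(\<lambda>N. inner_L2 a (fourier_part a e {..<N} f) g) \<longlonglongrightarrow> inner_L2 a (P f) g"
  by (rule tendsto_inner_L2)
     (auto intro: strong_sum_fourier_L2 strong_sum_L2 assms strong_sum_tendsto')

lemma strong_sum_basis_inner:
  assumes "f \<in> L2 a"
  shows "inner_L2 a (e n) (P f) = inner_L2 a (e n) f"
proof -
  have "\<forall>\<^sub>F N in sequentially. inner_L2 a (e n) (fourier_part a e {..<N} f) = inner_L2 a (e n) f"
    using eventually_gt_at_top[of n]
    by eventually_elim (simp add: inner_L2_basis_fourier_part[OF on] assms)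
  then have "(\<lambda>N. inner_L2 a (e n) (fourier_part a e {..<N} f)) \<longlonglongrightarrow> inner_L2 a (e n) f"
    by (rule tendsto_eventually)
  then show ?thesis
    using LIMSEQ_unique strong_sum_inner_right[OF assms orthonormal_or_null_L2[OF on]] by blast
qed

lemma strong_sum_norm_le:
  assumes "f \<in> L2 a"
  shows "norm_L2 a (P f) \<le> norm_L2 a f"
proof -
  have "(\<lambda>N. norm_L2 a (\<lambda>r. P f r - fourier_part a e {..<N} f r) + norm_L2 a f) \<longlonglongrightarrow> 0 + norm_L2 a f"
    by (intro tendsto_intros strong_sum_tendsto assms)
  moreover have "norm_L2 a (P f)
      \<le> norm_L2 a (\<lambda>r. P f r - fourier_part a e {..<N} f r) + norm_L2 a f" for N
    using norm_L2_triangle_sub[OF strong_sum_L2[OF assms] strong_sum_fourier_L2[of "{..<N}" f]]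
      Bessel_fourier_part[OF on, of "{..<N}" f] assms by simp
  ultimately show ?thesis
    by (intro LIMSEQ_le_const[of _ "norm_L2 a f"]) auto
qed

text \<open>Fourier sums are linear and contractive, and both properties pass to the strong
  limit.\<close>

lemma strong_sum_bounded_op: "bounded_op a P"
  unfolding bounded_op_def
proof (intro conjI ballI allI)
  fix f g assume f: "f \<in> L2 a" and g: "g \<in> L2 a"
  let ?S = "\<lambda>N. fourier_part a e {..<N}"
  have "(\<lambda>N. norm_L2 a (\<lambda>r. P f r + P g r - ?S N (\<lambda>r. f r + g r) r)) \<longlonglongrightarrow> 0"
  proof (rule Lim_null_comparison[OF always_eventually[OF allI]])
    fix N
    have "(\<lambda>r. P f r + P g r - ?S N (\<lambda>r. f r + g r) r)
        = (\<lambda>r. (P f r - ?S N f r) + (P g r - ?S N g r))"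
      by (subst fourier_part_add) (auto intro: orthonormal_or_null_L2[OF on] f g)
    then show "norm (norm_L2 a (\<lambda>r. P f r + P g r - ?S N (\<lambda>r. f r + g r) r))
       \<le> norm_L2 a (\<lambda>r. P f r - ?S N f r) + norm_L2 a (\<lambda>r. P g r - ?S N g r)"
      using norm_L2_triangle[OF L2_diff[OF strong_sum_L2[OF f] strong_sum_fourier_L2[of "{..<N}" f]]
          L2_diff[OF strong_sum_L2[OF g] strong_sum_fourier_L2[of "{..<N}" g]]] by simp
    show "(\<lambda>N. norm_L2 a (\<lambda>r. P f r - ?S N f r) + norm_L2 a (\<lambda>r. P g r - ?S N g r)) \<longlonglongrightarrow> 0"
      using tendsto_add[OF strong_sum_tendsto[OF f] strong_sum_tendsto[OF g]] by simp
  qed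
  then have "norm_L2 a (\<lambda>r. P (\<lambda>x. f x + g x) r - (P f r + P g r)) = 0"
    by (intro strong_sum_unique L2_add f g strong_sum_L2)
  then show "AE r in disk_measure a. P (\<lambda>x. f x + g x) r = P f r + P g r"
    by (subst (asm) norm_L2_diff_eq_0_iff) (intro strong_sum_L2 L2_add f g)+
next
  fix f c assume f: "f \<in> L2 a"
  let ?S = "\<lambda>N. fourier_part a e {..<N}"
  have "(\<lambda>N. cmod c * norm_L2 a (\<lambda>r. P f r - ?S N f r)) \<longlonglongrightarrow> cmod c * 0"
    by (intro tendsto_intros strong_sum_tendsto f)
  then have "(\<lambda>N. norm_L2 a (\<lambda>r. c * P f r - ?S N (\<lambda>r. c * f r) r)) \<longlonglongrightarrow> 0"
    by (simp add: fourier_part_scale norm_L2_scale flip: right_diff_distrib)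
  then have "norm_L2 a (\<lambda>r. P (\<lambda>x. c * f x) r - c * P f r) = 0"
    by (intro strong_sum_unique L2_scale f strong_sum_L2)
  then show "AE r in disk_measure a. P (\<lambda>x. c * f x) r = c * P f r"
    by (subst (asm) norm_L2_diff_eq_0_iff) (intro strong_sum_L2 L2_scale f)+
next
  show "\<exists>C. \<forall>f\<in>L2 a. norm_L2 a (P f) \<le> C * norm_L2 a f"
    using strong_sum_norm_le by (intro exI[of _ 1]) simp
qed (rule strong_sum_L2)

lemma strong_sum_self_adjoint: "self_adjoint a P"
  unfolding self_adjoint_def
proof (intro ballI)
  fix f g assume f: "f \<in> L2 a" and g: "g \<in> L2 a"
  have "inner_L2 a f (fourier_part a e {..<N} g) = inner_L2 a (fourier_part a e {..<N} f) g" for N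
    using inner_L2_fourier_part_right[where e=e and F="{..<N}", OF orthonormal_or_null_L2[OF on] f]
      inner_L2_fourier_part_left[where e=e and F="{..<N}", OF orthonormal_or_null_L2[OF on] g] by simp
  then show "inner_L2 a f (P g) = inner_L2 a (P f) g"
    using strong_sum_inner_right[OF g f] strong_sum_inner_left[OF f g] by (simp add: LIMSEQ_unique)
qed

lemma strong_sum_fourier_apply:
  assumes "f \<in> L2 a"
  shows "fourier_part a e F (P f) = fourier_part a e F f"
  unfolding fourier_part_def by (simp add: strong_sum_basis_inner[OF assms])

lemma strong_sum_idem:
  assumes f: "f \<in> L2 a"
  shows "norm_L2 a (\<lambda>r. P (P f) r - P f r) = 0"
  using strong_sum_tendsto[OF f]
  by (intro strong_sum_unique strong_sum_L2 f) (simp add: strong_sum_fourier_apply[OF f])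

lemma projector_strong_sum: "projector a P"
  unfolding projector_def
proof (intro conjI ballI)
  fix f assume f: "f \<in> L2 a"
  show "AE r in disk_measure a. P (P f) r = P f r"
    using strong_sum_idem[OF f]
    by (subst (asm) norm_L2_diff_eq_0_iff) (intro strong_sum_L2 f)+
qed (rule strong_sum_bounded_op strong_sum_self_adjoint)+

lemma strong_sum_null:
  assumes f: "f \<in> L2 a" and "\<And>n. inner_L2 a (e n) f = 0"
  shows "norm_L2 a (P f) = 0"
  using strong_sum_unique[OF f L2_zero] assms(2) by (simp add: fourier_part_def)

text \<open>For N > n the error is \<open>e n\<close> times \<open>1 - <e n, e n>\<close>, which is
  null whether \<open>e n\<close> is a unit vector or itself null.\<close>

lemma strong_sum_fixes_basis: "norm_L2 a (\<lambda>r. P (e n) r - e n r) = 0"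
proof (rule strong_sum_unique)
  have "norm_L2 a (\<lambda>r. e n r - fourier_part a e {..<N} (e n) r) = 0" if "n < N" for N
  proof -
    have "fourier_part a e {..<N} (e n) r
        = (\<Sum>i<N. if i = n then inner_L2 a (e n) (e n) * e n r else 0)" for r
      unfolding fourier_part_def using on
      by (intro sum.cong) (auto simp: orthonormal_or_null_def)
    then have "(\<lambda>r. e n r - fourier_part a e {..<N} (e n) r)
        = (\<lambda>r. (1 - inner_L2 a (e n) (e n)) * e n r)"
      using that by (simp add: fun_eq_iff left_diff_distrib)
    moreover have "norm_L2 a (e n) = 1 \<or> norm_L2 a (e n) = 0"
      using on by (simp add: orthonormal_or_null_def)
    ultimately show ?thesis
      by (auto simp: norm_L2_scale inner_L2_self)
  qed
  then have "\<forall>\<^sub>F N in sequentially. norm_L2 a (\<lambda>r. e n r - fourier_part a e {..<N} (e n) r) = 0"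
    by (intro eventually_mono[OF eventually_gt_at_top[of n]])
  then show "(\<lambda>N. norm_L2 a (\<lambda>r. e n r - fourier_part a e {..<N} (e n) r)) \<longlonglongrightarrow> 0"
    by (rule tendsto_eventually)
qed (rule orthonormal_or_null_L2[OF on])+

end

section \<open>Functions fixed by a bounded operator, and the complement of two strong sums\<close>

lemma bounded_op_fixes_add:
  assumes P: "bounded_op a P" and L: "f \<in> L2 a" "g \<in> L2 a"
    and "norm_L2 a (\<lambda>r. P f r - f r) = 0" "norm_L2 a (\<lambda>r. P g r - g r) = 0"
  shows "norm_L2 a (\<lambda>r. P (\<lambda>r. f r + g r) r - (f r + g r)) = 0"
proof -
  note PL = bounded_op_L2[OF P]
  have "norm_L2 a (\<lambda>r. (P f r + P g r) - (f r + g r))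
      \<le> norm_L2 a (\<lambda>r. P f r - f r) + norm_L2 a (\<lambda>r. P g r - g r)"
    using norm_L2_triangle[OF L2_diff[OF PL[OF L(1)] L(1)] L2_diff[OF PL[OF L(2)] L(2)]]
    by (simp add: algebra_simps)
  then have "norm_L2 a (\<lambda>r. P (\<lambda>r. f r + g r) r - (f r + g r)) \<le> 0"
    using norm_L2_triangle_diff[OF PL[OF L2_add[OF L]] L2_add[OF PL[OF L(1)] PL[OF L(2)]] L2_add[OF L]]
      bounded_op_add[OF P L] assms(4,5) by simp
  then show ?thesis by (simp add: antisym)
qed

lemma bounded_op_fixes_scale:
  assumes P: "bounded_op a P" and f: "f \<in> L2 a"
    and "norm_L2 a (\<lambda>r. P f r - f r) = 0"
  shows "norm_L2 a (\<lambda>r. P (\<lambda>r. c * f r) r - c * f r) = 0"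
proof -
  note PL = bounded_op_L2[OF P]
  have "norm_L2 a (\<lambda>r. c * P f r - c * f r) = 0"
    using norm_L2_scale[of a c "\<lambda>r. P f r - f r"] assms(3) by (simp add: right_diff_distrib)
  then have "norm_L2 a (\<lambda>r. P (\<lambda>r. c * f r) r - c * f r) \<le> 0"
    using norm_L2_triangle_diff[OF PL[OF L2_scale[OF f]] L2_scale[OF PL[OF f]] L2_scale[OF f],
        of c c c]
      bounded_op_scale[OF P f, of c] by simp
  then show ?thesis by (simp add: antisym)
qed

text \<open>The fixed functions form a closed set: pair with an arbitrary h and pass to the limit on
  both sides.\<close>

lemma bounded_op_fixes_limit:
  assumes P: "bounded_op a P" and L: "\<And>n. g n \<in> L2 a" "f \<in> L2 a"
    and lim: "(\<lambda>n. norm_L2 a (\<lambda>r. g n r - f r)) \<longlonglongrightarrow> 0"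
    and fixed: "\<And>n. norm_L2 a (\<lambda>r. P (g n) r - g n r) = 0"
  shows "norm_L2 a (\<lambda>r. P f r - f r) = 0"
proof (rule norm_L2_null_if_orthogonal)
  note PL = bounded_op_L2[OF P]
  fix h assume h: "h \<in> L2 a"
  have "(\<lambda>n. inner_L2 a h (P (g n))) \<longlonglongrightarrow> inner_L2 a h (P f)"
    by (rule tendsto_inner_L2[OF h PL[OF L(1)] h PL[OF L(2)] _ tendsto_bounded_op[OF P L lim]]) simp
  moreover have "(\<lambda>n. inner_L2 a h (g n)) \<longlonglongrightarrow> inner_L2 a h f"
    by (rule tendsto_inner_L2[OF h L(1) h L(2) _ lim]) simp
  moreover have "inner_L2 a h (P (g n)) = inner_L2 a h (g n)" for n
    by (rule inner_L2_cong_right[OF h PL[OF L(1)] L(1) fixed])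
  ultimately have "inner_L2 a h (P f) = inner_L2 a h f"
    by (simp add: LIMSEQ_unique)
  then show "inner_L2 a h (\<lambda>r. P f r - f r) = 0"
    by (simp add: inner_L2_diff_right h PL[OF L(2)] L(2))
qed (intro L2_diff bounded_op_L2[OF P] L(2))

text \<open>All Fourier coefficients of \<open>f - Pf - Qf\<close> vanish, so \<open>P\<close> and \<open>Q\<close> annihilate it.\<close>

lemma projector_complement_strong_sums:
  assumes e: "orthonormal_or_null a e" "strong_sum a e P"
    and d: "orthonormal_or_null a d" "strong_sum a d Q"
    and orth: "\<And>m n. inner_L2 a (e m) (d n) = 0"
  shows "projector a (\<lambda>f r. f r - P f r - Q f r)"
proof -
  let ?R = "\<lambda>f r. f r - P f r - Q f r"
  note eL = orthonormal_or_null_L2[OF e(1)] and dL = orthonormal_or_null_L2[OF d(1)]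
  note bP = strong_sum_bounded_op[OF e] and bQ = strong_sum_bounded_op[OF d]
  note PL = bounded_op_L2[OF bP] and QL = bounded_op_L2[OF bQ]
  have saP: "inner_L2 a f (P g) = inner_L2 a (P f) g" if "f \<in> L2 a" "g \<in> L2 a" for f g
    using strong_sum_self_adjoint[OF e] that by (simp add: self_adjoint_def)
  have saQ: "inner_L2 a f (Q g) = inner_L2 a (Q f) g" if "f \<in> L2 a" "g \<in> L2 a" for f g
    using strong_sum_self_adjoint[OF d] that by (simp add: self_adjoint_def)
  have RL: "?R f \<in> L2 a" if "f \<in> L2 a" for f
    by (intro L2_diff PL QL that)
  have orth': "inner_L2 a (d m) (e n) = 0" for m n
    using orth[of n m] inner_L2_commute[of a "d m" "e n"] by simp
  \<comment> \<open>\<open>e n\<close> is orthogonal to every \<open>d m\<close>, so Q annihilates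
    it; self-adjointness then moves Q to the other slot.\<close>
  have eQ: "inner_L2 a (e n) (Q f) = 0" if "f \<in> L2 a" for f n
  proof -
    have "norm_L2 a (Q (e n)) = 0" by (rule strong_sum_null[OF d eL orth'])
    then have "inner_L2 a (Q (e n)) f = 0"
      using Cauchy_Schwarz_L2[OF QL[OF eL] that, of n] by simp
    then show ?thesis using saQ[OF eL that] by simp
  qed
  have dP: "inner_L2 a (d n) (P f) = 0" if "f \<in> L2 a" for f n
  proof -
    have "norm_L2 a (P (d n)) = 0" by (rule strong_sum_null[OF e dL orth])
    then have "inner_L2 a (P (d n)) f = 0"
      using Cauchy_Schwarz_L2[OF PL[OF dL] that, of n] by simp
    then show ?thesis using saP[OF dL that] by simp
  qed
  have PR: "norm_L2 a (P (?R f)) = 0" if f: "f \<in> L2 a" for f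
    by (rule strong_sum_null[OF e RL[OF f]])
       (simp add: inner_L2_diff_right L2_diff eL f PL QL eQ strong_sum_basis_inner[OF e])
  have QR: "norm_L2 a (Q (?R f)) = 0" if f: "f \<in> L2 a" for f
    by (rule strong_sum_null[OF d RL[OF f]])
       (simp add: inner_L2_diff_right L2_diff dL f PL QL dP strong_sum_basis_inner[OF d])
  have "bounded_op a ?R"
    unfolding bounded_op_def
  proof (intro conjI ballI allI)
    fix f g assume f: "f \<in> L2 a" and g: "g \<in> L2 a"
    have "AE r in disk_measure a. P (\<lambda>x. f x + g x) r = P f r + P g r"
      "AE r in disk_measure a. Q (\<lambda>x. f x + g x) r = Q f r + Q g r"
      using bP bQ f g by (auto simp: bounded_op_def)
    then show "AE r in disk_measure a. ?R (\<lambda>x. f x + g x) r = ?R f r + ?R g r"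
      by eventually_elim (simp add: algebra_simps)
  next
    fix f c assume f: "f \<in> L2 a"
    have "AE r in disk_measure a. P (\<lambda>x. c * f x) r = c * P f r"
      "AE r in disk_measure a. Q (\<lambda>x. c * f x) r = c * Q f r"
      using bP bQ f by (auto simp: bounded_op_def)
    then show "AE r in disk_measure a. ?R (\<lambda>x. c * f x) r = c * ?R f r"
      by eventually_elim (simp add: algebra_simps)
  next
    have "norm_L2 a (?R f) \<le> 3 * norm_L2 a f" if f: "f \<in> L2 a" for f
      using norm_L2_triangle_minus[OF L2_diff[OF f PL[OF f]] QL[OF f]]
        norm_L2_triangle_minus[OF f PL[OF f]]
        strong_sum_norm_le[OF e f] strong_sum_norm_le[OF d f] by linarith
    then show "\<exists>C. \<forall>f\<in>L2 a. norm_L2 a (?R f) \<le> C * norm_L2 a f" by (intro exI[of _ 3]) simp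
  qed (rule RL)
  moreover have "self_adjoint a ?R"
    unfolding self_adjoint_def
    by (simp add: inner_L2_diff_right inner_L2_diff_left L2_diff PL QL saP saQ)
  moreover have "AE r in disk_measure a. ?R (?R f) r = ?R f r" if f: "f \<in> L2 a" for f
  proof -
    have "AE r in disk_measure a. P (?R f) r = 0" "AE r in disk_measure a. Q (?R f) r = 0"
      using PR[OF f] QR[OF f]
        norm_L2_eq_0_iff[OF PL[OF RL[OF f]]] norm_L2_eq_0_iff[OF QL[OF RL[OF f]]] by auto
    then show ?thesis by eventually_elim simp
  qed
  ultimately show ?thesis
    unfolding projector_def by (intro conjI ballI)
qed

section \<open>The wave functions of the two sources\<close>

lemma transverse_nth [simp]:
  "transverse v $ 1 = v$1" "transverse v $ 2 = v$2" "transverse v $ 3 = 0"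
  by (simp_all add: transverse_def)

lemma transverse_uminus: "transverse (- v) = - transverse v"
  by (simp add: vec_eq_iff forall_3)

definition position :: "real^2 \<Rightarrow> wavefun \<Rightarrow> wavefun" where
  "position v f = (\<lambda>r. complex_of_real (v \<bullet> r) * f r)"

text \<open>The derivative of \<open>Phi\<close> in the transverse direction v. Since
  \<open>-(s + t v) = -s + t (-v)\<close>, the derivative of the second source occurs throughout as
  \<open>dPhi a k (- v) (- s)\<close>.\<close>

definition dPhi :: "real \<Rightarrow> real \<Rightarrow> real^2 \<Rightarrow> real^3 \<Rightarrow> wavefun" where
  "dPhi a k v s = (\<lambda>r. \<i> * complex_of_real k * position v (Phi a k s) r)"

lemma continuous_on_Phi: "continuous_on S (Phi a k s)"
  unfolding Phi_def by (intro continuous_intros) auto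

lemma L2_Phi: "Phi a k s \<in> L2 a"
  by (intro L2_continuous continuous_on_Phi)

lemma L2_position_Phi: "position v (Phi a k s) \<in> L2 a"
  unfolding position_def by (intro L2_continuous continuous_intros continuous_on_Phi)

lemma L2_dPhi: "dPhi a k v s \<in> L2 a"
  unfolding dPhi_def by (intro L2_scale L2_position_Phi)

text \<open>A transverse displacement only multiplies by a phase, so limits in t reduce to Taylor
  bounds for \<open>exp (i x)\<close> that are uniform on the disk.\<close>

lemma Phi_shift:
  "Phi a k (s + t *\<^sub>R transverse v) r = Phi a k s r * exp (\<i> * complex_of_real (t * k * (v \<bullet> r)))"
  by (simp add: Phi_def inner_vec_def sum_2 algebra_simps flip: exp_add)

lemma dPhi_uminus: "dPhi a k (- v) s = (\<lambda>r. - dPhi a k v s r)"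
  by (simp add: dPhi_def position_def)

lemma cmod_Phi: "cmod (Phi a k s r) = 1 / (sqrt pi * \<bar>a\<bar>)"
  by (simp add: Phi_def norm_mult norm_divide)

lemma norm_L2_Phi:
  assumes "a > 0"
  shows "norm_L2 a (Phi a k s) = 1"
proof -
  have "(LINT r|disk_measure a. (cmod (Phi a k s r))\<^sup>2) = measure lebesgue (cball (0::real^2) a) / (pi * a\<^sup>2)"
    using assms
    by (simp add: cmod_Phi power_divide power_mult_distrib disk_measure_def measure_restrict_space)
  also have "measure lebesgue (cball (0::real^2) a) = pi * a\<^sup>2"
    using assms content_cball[of a "0::real^2"] by (simp add: unit_ball_vol_2)
  finally show ?thesis
    using assms by (simp add: norm_L2_def)
qed

lemma cmod_exp_i_minus_1_le: "cmod (exp (\<i> * complex_of_real x) - 1) \<le> \<bar>x\<bar>"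
  using Taylor_exp[of "\<i> * complex_of_real x" 0] by (simp add: norm_mult)

lemma cmod_exp_i_minus_linear_le:
  "cmod (exp (\<i> * complex_of_real x) - 1 - \<i> * complex_of_real x) \<le> x\<^sup>2"
  using Taylor_exp[of "\<i> * complex_of_real x" 1] by (simp add: norm_mult power2_eq_square diff_diff_eq)

lemma inner_disk_le: "r \<in> cball 0 a \<Longrightarrow> \<bar>v \<bullet> r\<bar> \<le> norm v * a"
  using Cauchy_Schwarz_ineq2[of v r] mult_left_mono[of "norm r" a "norm v"] by simp

text \<open>The weight lets one estimate serve both \<open>Phi\<close> and
  \<open>position w Phi\<close>.\<close>

lemma tendsto_weighted_Phi:
  fixes w :: "real^2 \<Rightarrow> real"
  assumes "a > 0" and w: "continuous_on (cball 0 a) w" and W: "\<And>r. r \<in> cball 0 a \<Longrightarrow> \<bar>w r\<bar> \<le> W" "W \<ge> 0"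
  shows "((\<lambda>t. norm_L2 a (\<lambda>r. complex_of_real (w r) * Phi a k (s + t *\<^sub>R transverse v) r
      - complex_of_real (w r) * Phi a k s r)) \<longlongrightarrow> 0) (at 0)"
proof (rule norm_L2_tendsto_0_uniform)
  let ?f = "\<lambda>s r. complex_of_real (w r) * Phi a k s r"
  let ?b = "\<lambda>t. W * (1 / (sqrt pi * a)) * (\<bar>t\<bar> * \<bar>k\<bar> * (norm v * a))"
  have fL: "?f s \<in> L2 a" for s
    by (rule L2_continuous) (intro continuous_on_mult continuous_on_of_real w continuous_on_Phi)
  show "(\<lambda>r. ?f (s + t *\<^sub>R transverse v) r - ?f s r) \<in> L2 a" for t
    by (rule L2_diff[OF fL fL])
  show "cmod (?f (s + t *\<^sub>R transverse v) r - ?f s r) \<le> ?b t" if r: "r \<in> cball 0 a" for t r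
  proof -
    have "?f (s + t *\<^sub>R transverse v) r - ?f s r
        = complex_of_real (w r) * Phi a k s r * (exp (\<i> * complex_of_real (t * k * (v \<bullet> r))) - 1)"
      by (simp add: Phi_shift algebra_simps)
    then have "cmod (?f (s + t *\<^sub>R transverse v) r - ?f s r)
        = \<bar>w r\<bar> * (1 / (sqrt pi * a)) * cmod (exp (\<i> * complex_of_real (t * k * (v \<bullet> r))) - 1)"
      using assms(1) by (simp add: norm_mult cmod_Phi)
    also have "\<dots> \<le> \<bar>w r\<bar> * (1 / (sqrt pi * a)) * \<bar>t * k * (v \<bullet> r)\<bar>"
      using assms(1) by (intro mult_left_mono cmod_exp_i_minus_1_le) auto
    also have "\<dots> = \<bar>w r\<bar> * (1 / (sqrt pi * a)) * (\<bar>t\<bar> * \<bar>k\<bar> * \<bar>v \<bullet> r\<bar>)"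
      by (simp add: abs_mult mult.assoc)
    also have "\<dots> \<le> ?b t"
      using assms(1) W(2) by (intro mult_mono inner_disk_le[OF r] W(1)[OF r]) auto
    finally show ?thesis .
  qed
  have "(?b \<longlongrightarrow> W * (1 / (sqrt pi * a)) * (\<bar>0\<bar> * \<bar>k\<bar> * (norm v * a))) (at 0)"
    by (intro tendsto_intros)
  then show "(?b \<longlongrightarrow> 0) (at 0)" by simp
qed (use assms(1) W(2) in auto)

lemma tendsto_Phi:
  assumes "a > 0"
  shows "((\<lambda>t. norm_L2 a (\<lambda>r. Phi a k (s + t *\<^sub>R transverse v) r - Phi a k s r)) \<longlongrightarrow> 0) (at 0)"
  using tendsto_weighted_Phi[OF assms, of "\<lambda>_. 1" 1] by simp

lemma tendsto_position_Phi:
  assumes "a > 0"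
  shows "((\<lambda>t. norm_L2 a (\<lambda>r. position w (Phi a k (s + t *\<^sub>R transverse v)) r - position w (Phi a k s) r))
    \<longlongrightarrow> 0) (at 0)"
  unfolding position_def using assms
  by (intro tendsto_weighted_Phi[where W="norm w * a"] inner_disk_le continuous_intros) simp_all

lemma tendsto_dPhi:
  assumes "a > 0"
  shows "((\<lambda>t. norm_L2 a (\<lambda>r. dPhi a k w (s + t *\<^sub>R transverse v) r - dPhi a k w s r))
    \<longlongrightarrow> 0) (at 0)"
proof -
  have "((\<lambda>t. cmod (\<i> * complex_of_real k) *
      norm_L2 a (\<lambda>r. position w (Phi a k (s + t *\<^sub>R transverse v)) r - position w (Phi a k s) r))
    \<longlongrightarrow> cmod (\<i> * complex_of_real k) * 0) (at 0)"
    by (intro tendsto_intros tendsto_position_Phi assms)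
  then show ?thesis
    unfolding dPhi_def right_diff_distrib[symmetric] norm_L2_scale by simp
qed

definition Phi_quotient :: "real \<Rightarrow> real \<Rightarrow> real^2 \<Rightarrow> real^3 \<Rightarrow> real \<Rightarrow> wavefun" where
  "Phi_quotient a k v s t = (\<lambda>r. (Phi a k (s + t *\<^sub>R transverse v) r - Phi a k s r) / complex_of_real t)"

lemma L2_Phi_quotient: "Phi_quotient a k v s t \<in> L2 a"
  unfolding Phi_quotient_def by (intro L2_divide L2_diff L2_Phi)

lemma tendsto_Phi_quotient:
  assumes "a > 0"
  shows "((\<lambda>t. norm_L2 a (\<lambda>r. Phi_quotient a k v s t r - dPhi a k v s r)) \<longlongrightarrow> 0) (at 0)"
proof (rule Lim_transform_eventually)
  \<comment> \<open>At t = 0 the quotient is 0 by the convention for division while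
    \<open>dPhi\<close> remains; overriding this value makes the uniform bound hold for every
    t.\<close>
  let ?f = "\<lambda>t r. if t = 0 then 0 else Phi_quotient a k v s t r - dPhi a k v s r"
  let ?b = "\<lambda>t. (1 / (sqrt pi * a)) * (\<bar>t\<bar> * (\<bar>k\<bar> * (norm v * a))\<^sup>2)"
  show "((\<lambda>t. norm_L2 a (?f t)) \<longlongrightarrow> 0) (at 0)"
  proof (rule norm_L2_tendsto_0_uniform)
    show "?f t \<in> L2 a" for t
      by (cases "t = 0") (simp_all add: L2_diff L2_Phi_quotient L2_dPhi)
    show "cmod (?f t r) \<le> ?b t" if r: "r \<in> cball 0 a" for t r
    proof (cases "t = 0")
      case False
      let ?x = "t * k * (v \<bullet> r)"
      have "?f t r = Phi a k s r / complex_of_real t * (exp (\<i> * complex_of_real ?x) - 1 - \<i> * complex_of_real ?x)"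
        using False by (simp add: Phi_quotient_def dPhi_def position_def Phi_shift field_simps)
      then have "cmod (?f t r) = (1 / (sqrt pi * a)) / \<bar>t\<bar> * cmod (exp (\<i> * complex_of_real ?x) - 1 - \<i> * complex_of_real ?x)"
        using assms by (simp add: norm_mult norm_divide cmod_Phi del: of_real_mult)
      also have "\<dots> \<le> (1 / (sqrt pi * a)) / \<bar>t\<bar> * ?x\<^sup>2"
        using assms by (intro mult_left_mono cmod_exp_i_minus_linear_le) auto
      also have "\<dots> = (1 / (sqrt pi * a)) * (\<bar>t\<bar> * (\<bar>k\<bar> * \<bar>v \<bullet> r\<bar>)\<^sup>2)"
      proof -
        have gen: "y \<noteq> 0 \<Longrightarrow> y\<^sup>2 * z / y = y * z" for y z :: real
          by (simp add: power2_eq_square)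
        have "?x\<^sup>2 = \<bar>t\<bar>\<^sup>2 * (\<bar>k\<bar> * \<bar>v \<bullet> r\<bar>)\<^sup>2"
          by (simp add: power_mult_distrib mult.assoc)
        then have "?x\<^sup>2 / \<bar>t\<bar> = \<bar>t\<bar> * (\<bar>k\<bar> * \<bar>v \<bullet> r\<bar>)\<^sup>2"
          using False gen[of "\<bar>t\<bar>"] by (simp del: power2_abs)
        then show ?thesis by (metis times_divide_eq_left times_divide_eq_right)
      qed
      also have "\<dots> \<le> ?b t"
        using assms by (intro mult_mono power_mono inner_disk_le[OF r]) auto
      finally show ?thesis .
    qed (use assms in simp)
    have "(?b \<longlongrightarrow> (1 / (sqrt pi * a)) * (\<bar>0\<bar> * (\<bar>k\<bar> * (norm v * a))\<^sup>2)) (at 0)"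
      by (intro tendsto_intros)
    then show "(?b \<longlongrightarrow> 0) (at 0)" by simp
  qed (use assms in auto)
  show "\<forall>\<^sub>F t in at 0. norm_L2 a (?f t) = norm_L2 a (\<lambda>r. Phi_quotient a k v s t r - dPhi a k v s r)"
    by (simp add: eventually_at_filter)
qed

text \<open>The points of the open ball where f is nonzero form an open set; being negligible, it is
  empty.\<close>

lemma norm_L2_continuous_eq_0:
  assumes f: "continuous_on (cball 0 a) f" and "norm_L2 a f = 0" and r: "r \<in> ball 0 a"
  shows "f r = 0"
proof (rule ccontr)
  assume nz: "f r \<noteq> 0"
  let ?S = "ball 0 a \<inter> f -` (- {0})"
  have "open ?S"
    by (intro continuous_open_preimage continuous_on_subset[OF f]) auto
  moreover have "?S \<noteq> {}" using nz r by auto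
  moreover have "negligible ?S"
  proof -
    have "AE r in disk_measure a. f r = 0"
      using assms(2) norm_L2_eq_0_iff[OF L2_continuous[OF f]] by simp
    then have "AE r in lebesgue. r \<in> cball 0 a \<longrightarrow> f r = 0"
      unfolding disk_measure_def by (subst (asm) AE_restrict_space_iff) auto
    then have "AE r in lebesgue. r \<notin> ?S"
      by (rule eventually_mono) auto
    then show ?thesis
      using \<open>open ?S\<close> unfolding negligible_iff_null_sets
      by (subst (asm) AE_iff_null_sets[symmetric]) auto
  qed
  ultimately show False
    using open_not_negligible by blast
qed

text \<open>If the overlap had modulus 1, the two wave functions would be proportional, hence the phase
  \<open>2k(s\<^sub>\<bottom>\<cdot>r - s\<^sub>3\<bar>r\<bar>\<^sup>2/2)\<close> locally constant; its slope at 0 along \<open>s\<^sub>\<bottom>\<close> is \<open>2k\<bar>s\<^sub>\<bottom>\<bar>\<^sup>2\<close>.\<close>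

lemma Phi_overlap:
  assumes "a > 0" "k > 0" and s: "s$1 \<noteq> 0 \<or> s$2 \<noteq> 0"
  defines "\<delta> \<equiv> inner_L2 a (Phi a k s) (Phi a k (- s))"
  shows "\<delta> * cnj \<delta> \<noteq> 1"
proof
  assume one: "\<delta> * cnj \<delta> = 1"
  let ?p = "Phi a k s" and ?m = "Phi a k (- s)"
  \<comment> \<open>The component of \<open>?m\<close> orthogonal to \<open>?p\<close>; its squared
    norm is \<open>1 - |\<delta>|^2\<close>.\<close>
  let ?d = "\<lambda>r. ?m r - \<delta> * ?p r"
  have pm: "inner_L2 a ?m ?p = cnj \<delta>" unfolding \<delta>_def by (rule inner_L2_commute)
  have self: "inner_L2 a ?p ?p = 1" "inner_L2 a ?m ?m = 1"
    using assms(1) by (simp_all add: inner_L2_self norm_L2_Phi)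
  have "inner_L2 a ?d ?d = 1 - \<delta> * cnj \<delta> - cnj \<delta> * \<delta> + cnj \<delta> * \<delta>"
    using pm self
    by (simp add: inner_L2_diff_left inner_L2_diff_right inner_L2_scale_left inner_L2_scale_right
        L2_diff L2_scale L2_Phi \<delta>_def[symmetric])
  then have "inner_L2 a ?d ?d = 0" using one by (simp add: mult.commute)
  then have "norm_L2 a ?d = 0" by (simp add: inner_L2_self)
  then have eq: "?m r = \<delta> * ?p r" if "r \<in> ball 0 a" for r
  proof -
    have "continuous_on (cball 0 a) ?d"
      by (intro continuous_on_diff continuous_on_mult continuous_on_const continuous_on_Phi)
    then show ?thesis
      using norm_L2_continuous_eq_0[of a ?d r] \<open>norm_L2 a ?d = 0\<close> that by simp
  qed
  \<comment> \<open>At r = 0 both wave functions take the same nonzero value.\<close>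
  have "\<delta> = 1"
    using eq[of 0] assms(1) by (simp add: Phi_def)
  let ?A = "\<lambda>r :: real^2. k * (s$1 * r$1 + s$2 * r$2 - s$3 * (norm r)\<^sup>2 / 2)"
  \<comment> \<open>The two sources have opposite phases, so equality of the wave functions forces
    \<open>exp (2 i A) = 1\<close>.\<close>
  have sin0: "sin (2 * ?A r) = 0" if r: "r \<in> ball 0 a" for r
  proof -
    have m: "?m r = complex_of_real (1 / (sqrt pi * a)) * exp (- (\<i> * complex_of_real (?A r)))"
      unfolding Phi_def by (intro arg_cong2[where f="(*)"] arg_cong[where f=exp] refl) (simp add: algebra_simps)
    have "exp (- (\<i> * complex_of_real (?A r))) = exp (\<i> * complex_of_real (?A r))"
      using eq[OF r] \<open>\<delta> = 1\<close> assms(1) unfolding m by (simp add: Phi_def)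
    then have "exp (\<i> * complex_of_real (?A r)) * exp (\<i> * complex_of_real (?A r))
        = exp (\<i> * complex_of_real (?A r)) * exp (- (\<i> * complex_of_real (?A r)))" by simp
    then have "exp (\<i> * complex_of_real (2 * ?A r)) = 1"
      by (simp flip: exp_add mult_2 add: mult.left_commute)
    then have "Im (cis (2 * ?A r)) = Im 1" by (simp only: cis_conv_exp)
    then show ?thesis by simp
  qed
  define w where "w = (vector [s$1, s$2] :: real^2)"
  have w: "norm w > 0" using s by (auto simp: w_def vec_eq_iff forall_2)
  have nw: "(norm w)\<^sup>2 = (s$1)\<^sup>2 + (s$2)\<^sup>2"
    unfolding power2_norm_eq_inner by (simp add: w_def inner_vec_def sum_2 power2_eq_square)
  let ?g = "\<lambda>x. 2 * (k * ((norm w)\<^sup>2 * x - s$3 * (norm w)\<^sup>2 * x\<^sup>2 / 2))"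
  have g: "sin (?g x) = 0" if "\<bar>0 - x\<bar> < a / norm w" for x
  proof -
    have "x *\<^sub>R w \<in> ball 0 a" using that w by (simp add: field_simps)
    moreover have "2 * ?A (x *\<^sub>R w) = ?g x"
      by (simp add: nw power_mult_distrib) (simp add: w_def power2_eq_square algebra_simps)
    ultimately show ?thesis using sin0 by metis
  qed
  have "((\<lambda>x. sin (?g x)) has_real_derivative 2 * (k * (norm w)\<^sup>2)) (at 0)"
    by (auto intro!: derivative_eq_intros)
  then have "2 * (k * (norm w)\<^sup>2) = 0"
    using g assms(1) w by (intro DERIV_local_const[where d="a / norm w"]) auto
  then show False using assms(2) w by simp
qed

section \<open>Symmetric logarithmic derivatives\<close>

lemma norm_bounded_add:
  assumes "norm_bounded a A" "norm_bounded a B"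
  shows "norm_bounded a (\<lambda>f r. A f r + B f r)"
proof -
  obtain C where C: "\<And>f. f \<in> L2 a \<Longrightarrow> norm_L2 a (A f) \<le> C * norm_L2 a f"
    using norm_boundedE[OF assms(1)] by blast
  obtain D where D: "\<And>f. f \<in> L2 a \<Longrightarrow> norm_L2 a (B f) \<le> D * norm_L2 a f"
    using norm_boundedE[OF assms(2)] by blast
  have "norm_L2 a (\<lambda>r. A f r + B f r) \<le> (C + D) * norm_L2 a f" if f: "f \<in> L2 a" for f
    using norm_L2_triangle[OF norm_bounded_L2[OF assms(1) f] norm_bounded_L2[OF assms(2) f]] C[OF f] D[OF f]
    by (simp add: distrib_right)
  then have "\<exists>C. \<forall>f\<in>L2 a. norm_L2 a (\<lambda>r. A f r + B f r) \<le> C * norm_L2 a f"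
    by (intro exI[of _ "C + D"]) simp
  then show ?thesis
    using norm_bounded_L2[OF assms(1)] norm_bounded_L2[OF assms(2)]
    by (simp add: norm_bounded_def L2_add)
qed

lemma norm_bounded_scale:
  assumes "norm_bounded a A"
  shows "norm_bounded a (\<lambda>f r. c * A f r)"
proof -
  obtain C where C: "\<And>f. f \<in> L2 a \<Longrightarrow> norm_L2 a (A f) \<le> C * norm_L2 a f"
    using norm_boundedE[OF assms(1)] by blast
  have "norm_L2 a (\<lambda>r. c * A f r) \<le> (cmod c * C) * norm_L2 a f" if f: "f \<in> L2 a" for f
    using mult_left_mono[OF C[OF f], of "cmod c"] by (simp add: norm_L2_scale mult.assoc)
  then have "\<exists>C. \<forall>f\<in>L2 a. norm_L2 a (\<lambda>r. c * A f r) \<le> C * norm_L2 a f"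
    by (intro exI[of _ "cmod c * C"]) simp
  then show ?thesis
    using norm_bounded_L2[OF assms] by (simp add: norm_bounded_def L2_scale)
qed

lemma norm_bounded_compose:
  assumes "norm_bounded a A" "norm_bounded a B"
  shows "norm_bounded a (\<lambda>f. A (B f))"
proof -
  obtain C where C: "C \<ge> 0" "\<And>f. f \<in> L2 a \<Longrightarrow> norm_L2 a (A f) \<le> C * norm_L2 a f"
    using norm_boundedE[OF assms(1)] by blast
  obtain D where D: "\<And>f. f \<in> L2 a \<Longrightarrow> norm_L2 a (B f) \<le> D * norm_L2 a f"
    using norm_boundedE[OF assms(2)] by blast
  have "norm_L2 a (A (B f)) \<le> (C * D) * norm_L2 a f" if f: "f \<in> L2 a" for f
    using C(2)[OF norm_bounded_L2[OF assms(2) f]] mult_left_mono[OF D[OF f] C(1)] by (simp add: mult.assoc)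
  then have "\<exists>C. \<forall>f\<in>L2 a. norm_L2 a (A (B f)) \<le> C * norm_L2 a f"
    by (intro exI[of _ "C * D"]) simp
  then show ?thesis
    using norm_bounded_L2[OF assms(1)] norm_bounded_L2[OF assms(2)] by (simp add: norm_bounded_def)
qed

lemma norm_bounded_ketbra:
  assumes "u \<in> L2 a" "v \<in> L2 a"
  shows "norm_bounded a (ketbra a u v)"
proof -
  have "norm_L2 a (ketbra a u v f) \<le> (norm_L2 a u * norm_L2 a v) * norm_L2 a f" if f: "f \<in> L2 a" for f
    using norm_L2_scale[of a "inner_L2 a v f" u]
      mult_left_mono[OF Cauchy_Schwarz_L2[OF assms(2) f], of "norm_L2 a u"]
    by (simp add: ketbra_def mult.commute mult.left_commute)
  then have "\<exists>C. \<forall>f\<in>L2 a. norm_L2 a (ketbra a u v f) \<le> C * norm_L2 a f"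
    by (intro exI[of _ "norm_L2 a u * norm_L2 a v"]) simp
  then show ?thesis
    by (simp add: norm_bounded_def ketbra_def L2_scale' assms)
qed

lemma norm_bounded_rho: "norm_bounded a (rho a k s)"
  unfolding rho_def
  by (rule norm_bounded_add; rule norm_bounded_scale; rule norm_bounded_ketbra; rule L2_Phi)

text \<open>A real supremum is an upper bound only for a set that is bounded above, which
  \<open>norm_bounded\<close> supplies.\<close>

lemma norm_L2_le_op_norm:
  assumes A: "norm_bounded a A" and f: "f \<in> L2 a" "norm_L2 a f \<le> 1"
  shows "norm_L2 a (A f) \<le> op_norm a A"
proof -
  obtain C where C: "C \<ge> 0" "\<And>f. f \<in> L2 a \<Longrightarrow> norm_L2 a (A f) \<le> C * norm_L2 a f"
    using norm_boundedE[OF A] by blast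
  show ?thesis
    unfolding op_norm_def
  proof (rule cSUP_upper)
    have "norm_L2 a (A g) \<le> C" if "g \<in> L2 a" "norm_L2 a g \<le> 1" for g
      using C(2)[OF that(1)] mult_left_mono[OF that(2) C(1)] by simp
    then show "bdd_above ((\<lambda>f. norm_L2 a (A f)) ` {f \<in> L2 a. norm_L2 a f \<le> 1})"
      by (intro bdd_aboveI[of _ C]) auto
  qed (use f in simp)
qed

lemma inner_L2_rho_right:
  assumes "g \<in> L2 a"
  shows "inner_L2 a g (rho a k s f)
    = (inner_L2 a g (Phi a k s) * inner_L2 a (Phi a k s) f
       + inner_L2 a g (Phi a k (- s)) * inner_L2 a (Phi a k (- s)) f) / 2"
proof -
  have "rho a k s f = (\<lambda>r. (inner_L2 a (Phi a k s) f / 2) * Phi a k s r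
      + (inner_L2 a (Phi a k (- s)) f / 2) * Phi a k (- s) r)"
    by (simp add: rho_def ketbra_def fun_eq_iff mult.commute)
  then show ?thesis
    by (simp only: inner_L2_add_right[OF assms L2_scale[OF L2_Phi] L2_scale[OF L2_Phi]]
        inner_L2_scale_right) (simp add: add_divide_distrib mult.commute)
qed

text \<open>The product rule for matrix elements of the ket-bra of \<open>Phi\<close>: one factor
  carries the difference quotient while the other is evaluated at t or at 0.\<close>

lemma tendsto_inner_ketbra_quotient:
  fixes k :: real and s :: "real^3" and v :: "real^2"
  assumes "a > 0" and L: "f \<in> L2 a" "g \<in> L2 a"
  defines "u \<equiv> \<lambda>t. Phi a k (s + t *\<^sub>R transverse v)"
  shows "((\<lambda>t. (inner_L2 a g (u t) * inner_L2 a (u t) f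
        - inner_L2 a g (Phi a k s) * inner_L2 a (Phi a k s) f) / complex_of_real t)
    \<longlongrightarrow> inner_L2 a g (dPhi a k v s) * inner_L2 a (Phi a k s) f
        + inner_L2 a g (Phi a k s) * inner_L2 a (dPhi a k v s) f) (at 0)"
proof (rule Lim_transform_eventually)
  let ?q = "Phi_quotient a k v s"
  have uL: "u t \<in> L2 a" for t unfolding u_def by (rule L2_Phi)
  have lim1: "((\<lambda>t. inner_L2 a g (?q t)) \<longlongrightarrow> inner_L2 a g (dPhi a k v s)) (at 0)"
    by (rule tendsto_inner_L2[OF L(2) L2_Phi_quotient L(2) L2_dPhi _ tendsto_Phi_quotient[OF assms(1)]])
       simp
  have lim2: "((\<lambda>t. inner_L2 a (u t) f) \<longlongrightarrow> inner_L2 a (Phi a k s) f) (at 0)"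
    unfolding u_def
    by (rule tendsto_inner_L2[OF L2_Phi L(1) L2_Phi L(1) tendsto_Phi[OF assms(1)]]) simp
  have lim3: "((\<lambda>t. inner_L2 a (?q t) f) \<longlongrightarrow> inner_L2 a (dPhi a k v s) f) (at 0)"
    by (rule tendsto_inner_L2[OF L2_Phi_quotient L(1) L2_dPhi L(1) tendsto_Phi_quotient[OF assms(1)]])
       simp
  show "((\<lambda>t. inner_L2 a g (?q t) * inner_L2 a (u t) f + inner_L2 a g (Phi a k s) * inner_L2 a (?q t) f)
    \<longlongrightarrow> inner_L2 a g (dPhi a k v s) * inner_L2 a (Phi a k s) f
        + inner_L2 a g (Phi a k s) * inner_L2 a (dPhi a k v s) f) (at 0)"
    by (intro tendsto_intros lim1 lim2 lim3)
  have q: "?q t = (\<lambda>r. (u t r - Phi a k s r) / complex_of_real t)" for t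
    by (simp add: Phi_quotient_def u_def)
  have r: "inner_L2 a g (?q t) = (inner_L2 a g (u t) - inner_L2 a g (Phi a k s)) / complex_of_real t" for t
    using inner_L2_scale_right[of a g "1 / complex_of_real t" "\<lambda>r. u t r - Phi a k s r"]
    by (simp add: q inner_L2_diff_right L uL L2_Phi)
  have l: "inner_L2 a (?q t) f = (inner_L2 a (u t) f - inner_L2 a (Phi a k s) f) / complex_of_real t" for t
    using inner_L2_scale_left[of a "1 / complex_of_real t" "\<lambda>r. u t r - Phi a k s r" f]
    by (simp add: q inner_L2_diff_left L uL L2_Phi)
  show "\<forall>\<^sub>F t in at 0. inner_L2 a g (?q t) * inner_L2 a (u t) f + inner_L2 a g (Phi a k s) * inner_L2 a (?q t) f
      = (inner_L2 a g (u t) * inner_L2 a (u t) f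
        - inner_L2 a g (Phi a k s) * inner_L2 a (Phi a k s) f) / complex_of_real t"
    unfolding r l by (rule always_eventually) (simp add: algebra_simps diff_divide_distrib)
qed

text \<open>Convergence in operator norm is tested at one f in the unit ball and paired with g;
  uniqueness of limits turns it into an equation. The factor 2 clears the weights 1/2 of the
  sources.\<close>

lemma has_partial_rho_weak:
  assumes "a > 0" and D: "norm_bounded a D" and partial: "has_partial_rho a k i s D"
    and f: "f \<in> L2 a" "norm_L2 a f \<le> 1" and g: "g \<in> L2 a"
  defines "v \<equiv> axis i 1"
  shows "2 * inner_L2 a g (D f) =
      inner_L2 a g (dPhi a k v s) * inner_L2 a (Phi a k s) f
    + inner_L2 a g (Phi a k s) * inner_L2 a (dPhi a k v s) f
    + inner_L2 a g (dPhi a k (- v) (- s)) * inner_L2 a (Phi a k (- s)) f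
    + inner_L2 a g (Phi a k (- s)) * inner_L2 a (dPhi a k (- v) (- s)) f"
proof -
  let ?s = "\<lambda>t. s + t *\<^sub>R transverse v"
  let ?Q = "\<lambda>t r. (rho a k (?s t) f r - rho a k s f r) / complex_of_real t"
  note rhoL = norm_bounded_L2[OF norm_bounded_rho f(1)]
  note DL = norm_bounded_L2[OF D f(1)]
  have QL: "?Q t \<in> L2 a" for t by (intro L2_divide L2_diff rhoL)
  have nb: "norm_bounded a (\<lambda>f r. (rho a k (?s t) f r - rho a k s f r) / complex_of_real t - D f r)" for t
  proof -
    have "norm_bounded a (\<lambda>f r. (1 / complex_of_real t) * (rho a k (?s t) f r + (-1) * rho a k s f r) + (-1) * D f r)"
      by (intro norm_bounded_add norm_bounded_scale norm_bounded_rho D)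
    then show ?thesis by simp
  qed
  have bound: "norm (norm_L2 a (\<lambda>r. ?Q t r - D f r))
      \<le> op_norm a (\<lambda>f r. (rho a k (?s t) f r - rho a k s f r) / complex_of_real t - D f r)" for t
    using norm_L2_le_op_norm[OF nb f, of t] by simp
  have "((\<lambda>t. norm_L2 a (\<lambda>r. ?Q t r - D f r)) \<longlongrightarrow> 0) (at 0)"
    using partial unfolding has_partial_rho_def v_def[symmetric]
    by (intro Lim_null_comparison[OF always_eventually[OF allI[OF bound]]])
  then have lim1: "((\<lambda>t. inner_L2 a g (?Q t)) \<longlongrightarrow> inner_L2 a g (D f)) (at 0)"
    by (intro tendsto_inner_L2[OF g QL g DL]) auto
  let ?k = "\<lambda>s. inner_L2 a g (Phi a k s) * inner_L2 a (Phi a k s) f"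
  have shift: "- ?s t = - s + t *\<^sub>R transverse (- v)" for t
    by (simp add: transverse_uminus)
  have Q: "inner_L2 a g (?Q t) = ((?k (?s t) - ?k s) / complex_of_real t
      + (?k (- s + t *\<^sub>R transverse (- v)) - ?k (- s)) / complex_of_real t) / 2" for t
  proof -
    have "inner_L2 a g (?Q t) = (inner_L2 a g (rho a k (?s t) f) - inner_L2 a g (rho a k s f)) / complex_of_real t"
      using inner_L2_scale_right[of a g "1 / complex_of_real t" "\<lambda>r. rho a k (?s t) f r - rho a k s f r"]
      by (simp add: inner_L2_diff_right g rhoL)
    also have "\<dots> = ((?k (?s t) - ?k s) / complex_of_real t
      + (?k (- ?s t) - ?k (- s)) / complex_of_real t) / 2"
      unfolding inner_L2_rho_right[OF g]
      by (cases "t = 0") (simp_all add: field_simps)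
    finally show ?thesis unfolding shift .
  qed
  have "((\<lambda>t. inner_L2 a g (?Q t)) \<longlongrightarrow>
     ((inner_L2 a g (dPhi a k v s) * inner_L2 a (Phi a k s) f
        + inner_L2 a g (Phi a k s) * inner_L2 a (dPhi a k v s) f)
      + (inner_L2 a g (dPhi a k (- v) (- s)) * inner_L2 a (Phi a k (- s)) f
        + inner_L2 a g (Phi a k (- s)) * inner_L2 a (dPhi a k (- v) (- s)) f)) / 2) (at 0)"
    unfolding Q by (intro tendsto_intros tendsto_inner_ketbra_quotient assms(1) f g) simp
  then show ?thesis
    using tendsto_unique[OF _ lim1] by fastforce
qed

text \<open>The modulus of \<open>Phi\<close> is constant, so the integrand is a multiple of the
  coordinate \<open>x_i\<close>, which is odd under its reflection.\<close>

lemma inner_L2_Phi_dPhi_axis: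
  "inner_L2 a (Phi a k s) (dPhi a k (axis i 1) s) = 0"
proof -
  have "(\<lambda>r. cnj (Phi a k s r) * dPhi a k (axis i 1) s r)
      = (\<lambda>r. \<i> * k * complex_of_real ((cmod (Phi a k s r))\<^sup>2) * complex_of_real (r$i))"
    by (simp add: fun_eq_iff dPhi_def position_def inner_axis' complex_norm_square mult_ac del: of_real_power)
  then have "inner_L2 a (Phi a k s) (dPhi a k (axis i 1) s)
      = (LINT r|disk_measure a. \<i> * k * complex_of_real ((1 / (sqrt pi * \<bar>a\<bar>))\<^sup>2) * complex_of_real (r$i))"
    by (simp add: inner_L2_def cmod_Phi)
  also have "\<dots> = 0"
    by (rule integral_disk_odd[where i=i])
       (auto intro!: continuous_measurable_disk continuous_intros simp: reflect_nth)
  finally show ?thesis .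
qed

text \<open>Multiplication by \<open>i k (v . r)\<close> is anti-Hermitian. Together with the
  opposite directions of the two sources, this makes the matrix of overlaps with the SLD errors
  Hermitian off the diagonal.\<close>

lemma inner_L2_dPhi_uminus:
  "inner_L2 a (Phi a k s) (dPhi a k (- v) s') = inner_L2 a (dPhi a k v s) (Phi a k s')"
  unfolding inner_L2_def dPhi_def position_def
  by (intro Bochner_Integration.integral_cong refl) simp

text \<open>With \<open>w\<^sub>\<plusminus> = L \<Phi>\<^sub>\<plusminus> - 2 \<partial>\<Phi>\<^sub>\<plusminus>\<close> the equation for \<open>L\<close> says that
  \<open>\<bar>w\<^sub>+\<rangle>\<langle>\<Phi>\<^sub>+\<bar> + \<bar>w\<^sub>-\<rangle>\<langle>\<Phi>\<^sub>-\<bar>\<close> is anti-Hermitian. The matrix \<open>\<langle>\<Phi>\<^sub>\<sigma>\<bar>w\<^sub>\<tau>\<rangle>\<close> is Hermitian and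
  anticommutes with the positive definite Gram matrix of \<open>\<Phi>\<^sub>\<plusminus>\<close>, so it vanishes, and then so do \<open>w\<^sub>\<plusminus>\<close>.\<close>

lemma sld_on_Phi:
  assumes "a > 0" "k > 0" and s: "s$1 \<noteq> 0 \<or> s$2 \<noteq> 0" and T: "is_sld a k i s T"
  defines "v \<equiv> axis i 1"
  shows "norm_L2 a (\<lambda>r. T (Phi a k s) r - 2 * dPhi a k v s r) = 0"
    and "norm_L2 a (\<lambda>r. T (Phi a k (- s)) r - 2 * dPhi a k (- v) (- s) r) = 0"
proof -
  let ?p = "Phi a k s" and ?m = "Phi a k (- s)"
  let ?dp = "dPhi a k v s" and ?dm = "dPhi a k (- v) (- s)"
  let ?wp = "\<lambda>r. T ?p r - 2 * ?dp r" and ?wm = "\<lambda>r. T ?m r - 2 * ?dm r"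
  let ?I = "inner_L2 a"
  define \<delta> where "\<delta> = ?I ?p ?m"
  have bT: "bounded_op a T" and sa: "self_adjoint a T"
    using T by (simp_all add: is_sld_def)
  note TL = bounded_op_L2[OF bT]
  have sT: "?I f (T g) = ?I (T f) g" if "f \<in> L2 a" "g \<in> L2 a" for f g
    using sa that by (simp add: self_adjoint_def)
  have wL: "?wp \<in> L2 a" "?wm \<in> L2 a"
    by (intro L2_diff L2_scale TL L2_Phi L2_dPhi)+
  let ?D = "\<lambda>f r. 1/2 * (T (rho a k s f) r + rho a k s (T f) r)"
  have D: "norm_bounded a ?D"
    by (rule norm_bounded_scale[OF norm_bounded_add[OF
          norm_bounded_compose[OF norm_bounded_op[OF bT] norm_bounded_rho]
          norm_bounded_compose[OF norm_bounded_rho norm_bounded_op[OF bT]]]])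
  have partial: "has_partial_rho a k i s ?D"
    using T by (simp add: is_sld_def)
  have wr: "?I g ?wp = ?I g (T ?p) - 2 * ?I g ?dp" "?I g ?wm = ?I g (T ?m) - 2 * ?I g ?dm"
    if "g \<in> L2 a" for g
    by (simp_all add: inner_L2_diff_right inner_L2_scale_right that TL L2_Phi L2_dPhi L2_scale)
  have wl: "?I ?wp f = ?I (T ?p) f - 2 * ?I ?dp f" "?I ?wm f = ?I (T ?m) f - 2 * ?I ?dm f"
    if "f \<in> L2 a" for f
    by (simp_all add: inner_L2_diff_left inner_L2_scale_left that TL L2_Phi L2_dPhi L2_scale)
  \<comment> \<open>A matrix element of the anti-Hermitian identity for \<open>?wp\<close> and
    \<open>?wm\<close>. The unit ball appears because the derivative of \<open>rho\<close> is taken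
    in operator norm.\<close>
  have key: "?I g ?wp * ?I ?p f + ?I g ?p * ?I ?wp f + ?I g ?wm * ?I ?m f + ?I g ?m * ?I ?wm f = 0"
    if f: "f \<in> L2 a" "norm_L2 a f \<le> 1" and g: "g \<in> L2 a" for f g
  proof -
    have rL: "rho a k s f \<in> L2 a" "rho a k s (T f) \<in> L2 a"
      by (intro norm_bounded_L2[OF norm_bounded_rho] TL f)+
    have "2 * ?I g (?D f) = ?I g (T (rho a k s f)) + ?I g (rho a k s (T f))"
      unfolding inner_L2_scale_right using inner_L2_add_right[OF g TL[OF rL(1)] rL(2)] by simp
    also have "?I g (T (rho a k s f)) = ?I (T g) (rho a k s f)"
      by (rule sT[OF g rL(1)])
    also have "\<dots> = (?I g (T ?p) * ?I ?p f + ?I g (T ?m) * ?I ?m f) / 2"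
      unfolding inner_L2_rho_right[OF TL[OF g]] using sT[OF g L2_Phi] by simp
    also have "?I g (rho a k s (T f)) = (?I g ?p * ?I (T ?p) f + ?I g ?m * ?I (T ?m) f) / 2"
      unfolding inner_L2_rho_right[OF g] using sT[OF L2_Phi f(1)] by simp
    finally have eq: "(?I g (T ?p) * ?I ?p f + ?I g (T ?m) * ?I ?m f) / 2
        + (?I g ?p * ?I (T ?p) f + ?I g ?m * ?I (T ?m) f) / 2
      = ?I g ?dp * ?I ?p f + ?I g ?p * ?I ?dp f + ?I g ?dm * ?I ?m f + ?I g ?m * ?I ?dm f"
      using has_partial_rho_weak[OF assms(1) D partial f g] unfolding v_def by simp
    have half: "x / 2 + y / 2 = z \<Longrightarrow> x + y = 2 * z" for x y z :: complex
      by (simp add: field_simps)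
    show ?thesis
      using half[OF eq] unfolding wr[OF g] wl[OF f(1)] by (simp add: algebra_simps)
  qed
  have unit: "norm_L2 a ?p \<le> 1" "norm_L2 a ?m \<le> 1"
    using assms(1) by (simp_all add: norm_L2_Phi)
  have self: "?I ?p ?p = 1" "?I ?m ?m = 1"
    using assms(1) by (simp_all add: inner_L2_self norm_L2_Phi)
  have \<delta>: "?I ?p ?m = \<delta>" "?I ?m ?p = cnj \<delta>"
    unfolding \<delta>_def by (simp, rule inner_L2_commute)
  define M1 M2 \<mu> where "M1 = ?I ?p ?wp" and "M2 = ?I ?m ?wm" and "\<mu> = ?I ?p ?wm"
  have d0: "?I ?p ?dp = 0" "?I ?m ?dm = 0"
    using inner_L2_Phi_dPhi_axis[of a k s i] inner_L2_Phi_dPhi_axis[of a k "- s" i]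
      inner_L2_scale_right[of a ?m "-1"]
    by (simp_all add: v_def dPhi_uminus)
  have d0': "?I ?dp ?p = 0" "?I ?dm ?m = 0"
    using d0 inner_L2_commute[of a ?dp ?p] inner_L2_commute[of a ?dm ?m] by simp_all
  have M1: "?I ?wp ?p = M1"
    unfolding M1_def wr[OF L2_Phi] wl[OF L2_Phi] using sT[OF L2_Phi L2_Phi] d0 d0' by simp
  have M2: "?I ?wm ?m = M2"
    unfolding M2_def wr[OF L2_Phi] wl[OF L2_Phi] using sT[OF L2_Phi L2_Phi] d0 d0' by simp
  have \<mu>1: "?I ?wp ?m = \<mu>"
    unfolding \<mu>_def wr[OF L2_Phi] wl[OF L2_Phi]
    using sT[OF L2_Phi L2_Phi] inner_L2_dPhi_uminus[of a k s v "- s"] by simp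
  have \<mu>2: "?I ?m ?wp = cnj \<mu>" "?I ?wm ?p = cnj \<mu>"
    using \<mu>1 inner_L2_commute[of a ?m ?wp] inner_L2_commute[of a ?wm ?p] by (simp_all add: \<mu>_def)
  have defs: "?I ?p ?wp = M1" "?I ?m ?wm = M2" "?I ?p ?wm = \<mu>"
    by (simp_all add: M1_def M2_def \<mu>_def)
  \<comment> \<open>Testing \<open>key\<close> at the pairs (p,p), (m,m) and (p,m) gives three
    equations for the overlaps.\<close>
  have e1: "2 * M1 + \<mu> * cnj \<delta> + \<delta> * cnj \<mu> = 0"
    using key[OF L2_Phi unit(1) L2_Phi[of a k s]] self \<delta> M1 \<mu>2 defs by simp
  have e2: "2 * M2 + cnj \<mu> * \<delta> + cnj \<delta> * \<mu> = 0"
    using key[OF L2_Phi unit(2) L2_Phi[of a k "- s"]] self \<delta> M2 \<mu>1 \<mu>2 defs by (simp add: ac_simps)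
  have e3: "M1 * \<delta> + 2 * \<mu> + \<delta> * M2 = 0"
    using key[OF L2_Phi unit(2) L2_Phi[of a k s]] self \<delta> M2 \<mu>1 defs by (simp add: ac_simps)
  \<comment> \<open>\<open>e1\<close> and \<open>e2\<close> share their mixed terms, so the diagonal
    entries agree. \<open>e3\<close> then gives \<open>\<mu> = - M1 \<delta>\<close>, and since
    \<open>M1\<close> is real, substitution into \<open>e1\<close> leaves
    \<open>M1 (1 - |\<delta>|^2) = 0\<close>.\<close>
  have "2 * M1 = 2 * M2" using e1 e2 by algebra
  then have "M1 = M2" by simp
  then have "M1 * \<delta> + 2 * \<mu> + \<delta> * M1 = 0" using e3 by simp
  then have "2 * \<mu> = 2 * (- M1 * \<delta>)" by algebra
  then have \<mu>: "\<mu> = - M1 * \<delta>" by simp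
  have cM1: "cnj M1 = M1" using M1 M1_def inner_L2_commute[of a ?wp ?p] by simp
  have nz: "1 - \<delta> * cnj \<delta> \<noteq> 0"
    using Phi_overlap[OF assms(1,2) s] unfolding \<delta>_def by simp
  have "M1 * (1 - \<delta> * cnj \<delta>) = 0"
  proof -
    have "cnj \<mu> = - M1 * cnj \<delta>" using \<mu> cM1 by simp
    then have "2 * (M1 * (1 - \<delta> * cnj \<delta>)) = 0" using e1 \<mu> by algebra
    then show ?thesis by simp
  qed
  then have zero: "M1 = 0" "\<mu> = 0" "M2 = 0"
    using nz \<mu> \<open>M1 = M2\<close> by simp_all
  have "?I g ?wp = 0 \<and> ?I g ?wm = 0" if g: "g \<in> L2 a" for g
  proof -
    \<comment> \<open>A homogeneous linear system for the two pairings, with determinant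
      \<open>1 - |\<delta>|^2\<close>.\<close>
    have a1: "?I g ?wp + ?I g ?wm * cnj \<delta> = 0"
      using key[OF L2_Phi unit(1) g] self \<delta> M1 \<mu>2 zero by simp
    have a2: "?I g ?wp * \<delta> + ?I g ?wm = 0"
      using key[OF L2_Phi unit(2) g] self \<delta> M2 \<mu>1 zero by simp
    have "?I g ?wp * (1 - \<delta> * cnj \<delta>) = 0" "?I g ?wm * (1 - \<delta> * cnj \<delta>) = 0"
      using a1 a2 by algebra+
    then show ?thesis using nz by simp
  qed
  then show "norm_L2 a ?wp = 0" "norm_L2 a ?wm = 0"
    using wL by (simp_all add: norm_L2_null_if_orthogonal)
qed

section \<open>Probabilities and the quantum bound as inner products\<close>

lemma prob_eq:
  assumes P: "projector a P"
  shows "prob a k P s = (Re (inner_L2 a (Phi a k s) (P (Phi a k s)))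
    + Re (inner_L2 a (Phi a k (- s)) (P (Phi a k (- s))))) / 2"
proof -
  have bP: "bounded_op a P" and sP: "\<And>f g. f \<in> L2 a \<Longrightarrow> g \<in> L2 a \<Longrightarrow> inner_L2 a f (P g) = inner_L2 a (P f) g"
    using P by (simp_all add: projector_def self_adjoint_def)
  note PL = bounded_op_L2[OF bP]
  have "op_trace a (rho a k s \<circ> P)
      = inner_L2 a (P (Phi a k s)) (\<lambda>r. 1/2 * Phi a k s r)
        + inner_L2 a (P (Phi a k (- s))) (\<lambda>r. 1/2 * Phi a k (- s) r)"
    by (rule op_trace_rank_two[OF L2_scale[OF L2_Phi] L2_scale[OF L2_Phi] PL[OF L2_Phi] PL[OF L2_Phi]])
       (simp add: rho_def ketbra_def sP L2_Phi)
  then have "op_trace a (rho a k s \<circ> P) = (inner_L2 a (Phi a k s) (P (Phi a k s))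
      + inner_L2 a (Phi a k (- s)) (P (Phi a k (- s)))) / 2"
    unfolding inner_L2_scale_right by (simp add: sP L2_Phi add_divide_distrib)
  then show ?thesis
    unfolding prob_def by (simp only: Re_divide_numeral plus_complex.sel)
qed

text \<open>Self-adjointness turns each trace term into a pairing of SLD images of
  \<open>Phi\<close>, and each image may be replaced by twice a derivative. The constant 2 is the
  product of these two factors 2 with the weight 1/2 in \<open>rho\<close>.\<close>

lemma quantum_bound_eq:
  assumes "a > 0" "k > 0" and P: "projector a P" and s: "s$1 \<noteq> 0 \<or> s$2 \<noteq> 0"
    and T: "\<And>i. is_sld a k i s (L i s)"
  shows "quantum_bound a k L P s $ i $ j =
      2 * Re (inner_L2 a (dPhi a k (axis i 1) s) (P (dPhi a k (axis j 1) s)))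
    + 2 * Re (inner_L2 a (dPhi a k (- axis i 1) (- s)) (P (dPhi a k (- axis j 1) (- s))))"
proof -
  have bP: "bounded_op a P" and sP: "\<And>f g. f \<in> L2 a \<Longrightarrow> g \<in> L2 a \<Longrightarrow> inner_L2 a f (P g) = inner_L2 a (P f) g"
    using P by (simp_all add: projector_def self_adjoint_def)
  have bT: "bounded_op a (L i s)"
    and sT: "\<And>f g. f \<in> L2 a \<Longrightarrow> g \<in> L2 a \<Longrightarrow> inner_L2 a f (L i s g) = inner_L2 a (L i s f) g" for i
    using T[of i] by (simp_all add: is_sld_def self_adjoint_def)
  note PL = bounded_op_L2[OF bP] and TL = bounded_op_L2[OF bT]
  let ?I = "inner_L2 a"
  \<comment> \<open>\<open>op_trace_rank_two\<close> wants f bare in the right slot, so the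
    operators are carried to the left slot in reverse order.\<close>
  have move: "?I u (L i s (P (L j s f))) = ?I (L j s (P (L i s u))) f"
    if "u \<in> L2 a" "f \<in> L2 a" for u f
    using that by (simp add: sT sP TL PL)
  have eval: "?I (L j s (P (L i s u))) u = 4 * ?I (P d) e"
    if u: "u \<in> L2 a" and d: "d \<in> L2 a" "norm_L2 a (\<lambda>r. L i s u r - 2 * d r) = 0"
      and e: "e \<in> L2 a" "norm_L2 a (\<lambda>r. L j s u r - 2 * e r) = 0" for u d e
  proof -
    have "?I (L j s (P (L i s u))) u = ?I (P (L i s u)) (L j s u)"
      using u by (simp add: sT PL TL)
    also have "\<dots> = ?I (P (L i s u)) (\<lambda>r. 2 * e r)"
      by (rule inner_L2_cong_right[OF PL[OF TL[OF u]] TL[OF u] L2_scale[OF e(1)] e(2)])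
    also have "\<dots> = 2 * ?I (L i s u) (P e)"
      using u e by (simp add: inner_L2_scale_right sP TL)
    also have "?I (L i s u) (P e) = ?I (\<lambda>r. 2 * d r) (P e)"
      by (rule inner_L2_cong_left[OF PL[OF e(1)] TL[OF u] L2_scale[OF d(1)] d(2)])
    also have "\<dots> = 2 * ?I (P d) e"
      using d e by (simp add: inner_L2_scale_left sP)
    finally show ?thesis by simp
  qed
  have "op_trace a (rho a k s \<circ> L i s \<circ> P \<circ> L j s)
      = ?I (L j s (P (L i s (Phi a k s)))) (\<lambda>r. 1/2 * Phi a k s r)
        + ?I (L j s (P (L i s (Phi a k (- s))))) (\<lambda>r. 1/2 * Phi a k (- s) r)"
    by (rule op_trace_rank_two[OF L2_scale[OF L2_Phi] L2_scale[OF L2_Phi]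
          TL[OF PL[OF TL[OF L2_Phi]]] TL[OF PL[OF TL[OF L2_Phi]]]])
       (simp add: rho_def ketbra_def move L2_Phi)
  also have "\<dots> = 2 * ?I (P (dPhi a k (axis i 1) s)) (dPhi a k (axis j 1) s)
      + 2 * ?I (P (dPhi a k (- axis i 1) (- s))) (dPhi a k (- axis j 1) (- s))"
    unfolding inner_L2_scale_right
      eval[OF L2_Phi L2_dPhi sld_on_Phi(1)[OF assms(1,2) s T] L2_dPhi sld_on_Phi(1)[OF assms(1,2) s T]]
      eval[OF L2_Phi L2_dPhi sld_on_Phi(2)[OF assms(1,2) s T] L2_dPhi sld_on_Phi(2)[OF assms(1,2) s T]]
    by simp
  finally show ?thesis
    unfolding quantum_bound_def by (simp add: sP L2_dPhi)
qed

section \<open>Odd Zernike functions\<close>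

text \<open>The n-th finite difference annihilates polynomials of degree below n, here a product of
  linear factors. When \<open>c x - l\<close> is split off, the constant part falls to the induction
  hypothesis. For the part with l, the identity \<open>l (n choose l) = n (n-1 choose l-1)\<close>
  lowers n by one and shifts every root, hence the generalisation over n and c.\<close>

lemma alternating_binomial_sum_prod_eq_0:
  fixes c :: "'i \<Rightarrow> 'a::comm_ring_1"
  assumes "finite I" "card I < n"
  shows "(\<Sum>l\<le>n. (-1) ^ l * of_nat (n choose l) * (\<Prod>i\<in>I. c i - of_nat l)) = 0"
  using assms
proof (induction I arbitrary: n c rule: finite_induct)
  case empty
  then show ?case using choose_alternating_sum[of n, where ?'a='a] by simp
next
  case (insert x I)
  then obtain m where m: "n = Suc m" "card I < m" by (cases n) auto
  let ?p = "\<lambda>l. \<Prod>i\<in>I. c i - of_nat l"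
  have "(\<Sum>l\<le>n. (-1) ^ l * of_nat (n choose l) * (\<Prod>i\<in>insert x I. c i - of_nat l))
      = (\<Sum>l\<le>n. c x * ((-1) ^ l * of_nat (n choose l) * ?p l)
          - (-1) ^ l * of_nat (l * (n choose l)) * ?p l)"
    using insert.hyps by (intro sum.cong) (auto simp: algebra_simps)
  also have "\<dots> = c x * (\<Sum>l\<le>n. (-1) ^ l * of_nat (n choose l) * ?p l)
      - (\<Sum>l\<le>n. (-1) ^ l * of_nat (l * (n choose l)) * ?p l)"
    by (simp add: sum_subtractf sum_distrib_left)
  also have "(\<Sum>l\<le>n. (-1) ^ l * of_nat (n choose l) * ?p l) = 0"
    using m by (intro insert.IH) simp
  also have "(\<Sum>l\<le>n. (-1) ^ l * of_nat (l * (n choose l)) * ?p l)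
      = (\<Sum>l\<le>m. (-1) ^ Suc l * of_nat (Suc l * (Suc m choose Suc l)) * ?p (Suc l))"
    unfolding m(1) sum.atMost_Suc_shift by simp
  also have "\<dots> = - of_nat (Suc m) *
      (\<Sum>l\<le>m. (-1) ^ l * of_nat (m choose l) * (\<Prod>i\<in>I. (c i - 1) - of_nat l))"
    unfolding sum_distrib_left
  proof (rule sum.cong[OF refl])
    fix l
    have "(of_nat (Suc l * (Suc m choose Suc l)) :: 'a) = of_nat (Suc m) * of_nat (m choose l)"
      by (simp only: Suc_times_binomial of_nat_mult)
    moreover have "?p (Suc l) = (\<Prod>i\<in>I. (c i - 1) - of_nat l)"
      by (intro prod.cong) (auto simp: algebra_simps)
    ultimately show "(-1) ^ Suc l * of_nat (Suc l * (Suc m choose Suc l)) * ?p (Suc l)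
      = - of_nat (Suc m) * ((-1) ^ l * of_nat (m choose l) * (\<Prod>i\<in>I. (c i - 1) - of_nat l))"
      by (simp only: power_Suc mult_minus_left mult_minus_right mult_1_left mult_ac)
  qed
  also have "(\<Sum>l\<le>m. (-1) ^ l * of_nat (m choose l) * (\<Prod>i\<in>I. (c i - 1) - of_nat l)) = 0"
    using m by (intro insert.IH)
  finally show ?case by simp
qed

text \<open>The coefficient of \<open>x^(2n+1-2l)\<close> in \<open>zernike_radial\<close> with
  indices 2n + 1 and 1, for which the two halved indices are n + 1 and n.\<close>

definition zernike_coeff :: "nat \<Rightarrow> nat \<Rightarrow> real" where
  "zernike_coeff n l = (-1) ^ l * fact (2 * n + 1 - l) / (fact l * fact (n + 1 - l) * fact (n - l))"

lemma fact_add_eq_prod: "(fact (m + n) :: real) = fact m * (\<Prod>i<n. real m + 1 + real i)"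
  by (induction n) (simp_all add: algebra_simps)

text \<open>The quotient of \<open>fact (2n+1-l)\<close> by \<open>fact (n+1-l)\<close> is the
  product of \<open>n+2+i-l\<close> over i < n, and its factor i = j cancels the denominator. There
  remain n - 1 linear factors in l, one too few to survive the alternating binomial sum. The
  denominators are those of the radial moments.\<close>

lemma zernike_coeff_sum_eq_0:
  assumes "j < n"
  shows "(\<Sum>l\<le>n. zernike_coeff n l / (real (j + n - l) + 2)) = 0"
proof -
  let ?c = "\<lambda>i. real n + 2 + real i"
  have "zernike_coeff n l / (real (j + n - l) + 2)
      = 1 / fact n * ((-1) ^ l * real (n choose l) * (\<Prod>i\<in>{..<n} - {j}. ?c i - real l))"
    if l: "l \<le> n" for l
  proof -
    have "(fact (2 * n + 1 - l) :: real) = fact ((n + 1 - l) + n)"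
      using l by (intro arg_cong[where f=fact]) simp
    also have "\<dots> = fact (n + 1 - l) * (\<Prod>i<n. real (n + 1 - l) + 1 + real i)"
      by (rule fact_add_eq_prod)
    also have "(\<Prod>i<n. real (n + 1 - l) + 1 + real i) = (\<Prod>i<n. ?c i - real l)"
      using l by (intro prod.cong) (auto simp: of_nat_diff)
    also have "\<dots> = (?c j - real l) * (\<Prod>i\<in>{..<n} - {j}. ?c i - real l)"
      using assms by (intro prod.remove) auto
    finally have f: "(fact (2 * n + 1 - l) :: real)
        = fact (n + 1 - l) * ((?c j - real l) * (\<Prod>i\<in>{..<n} - {j}. ?c i - real l))" .
    have y: "real (j + n - l) + 2 = ?c j - real l" "?c j - real l \<noteq> 0"
      using l by (auto simp: of_nat_diff)
    have cancel: "x * (F * (y * p)) / (u * F * w) / y = 1 / N * (x * (N / (u * w)) * p)"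
      if "F \<noteq> 0" "y \<noteq> 0" "N \<noteq> 0" "u \<noteq> 0" "w \<noteq> 0" for x F y p u w N :: real
      using that by (simp add: field_simps)
    show ?thesis
      unfolding zernike_coeff_def f y(1) binomial_fact[OF l]
      by (rule cancel) (use y(2) in simp_all)
  qed
  then have "(\<Sum>l\<le>n. zernike_coeff n l / (real (j + n - l) + 2))
      = 1 / fact n * (\<Sum>l\<le>n. (-1) ^ l * real (n choose l) * (\<Prod>i\<in>{..<n} - {j}. ?c i - real l))"
    unfolding sum_distrib_left by (intro sum.cong) auto
  also have "(\<Sum>l\<le>n. (-1) ^ l * real (n choose l) * (\<Prod>i\<in>{..<n} - {j}. ?c i - real l)) = 0"
    using assms by (intro alternating_binomial_sum_prod_eq_0) (auto simp: card_Diff_singleton)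
  finally show ?thesis by simp
qed

section \<open>Cartesian form and orthogonality of the odd Zernike functions\<close>

definition odd_monomial :: "2 \<Rightarrow> nat \<Rightarrow> wavefun" where
  "odd_monomial i j = (\<lambda>r. complex_of_real (r$i * norm r ^ (2 * j)))"

text \<open>The unnormalised functions of order 2n + 1 in Cartesian form: index 1 belongs to
  azimuthal number 1, index 2 to -1. One factor \<open>|r|\<close> of the radial polynomial turns
  the cosine or sine into a coordinate.\<close>

definition zernike_poly :: "real \<Rightarrow> 2 \<Rightarrow> nat \<Rightarrow> wavefun" where
  "zernike_poly a i n =
     (\<lambda>r. \<Sum>l\<le>n. complex_of_real (zernike_coeff n l / a ^ (2 * (n - l) + 1)) * odd_monomial i (n - l) r)"

lemma L2_odd_monomial: "odd_monomial i j \<in> L2 a"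
  unfolding odd_monomial_def by (intro L2_continuous continuous_intros)

lemma L2_zernike_poly: "zernike_poly a i n \<in> L2 a"
  unfolding zernike_poly_def by (intro L2_sum L2_scale L2_odd_monomial)

lemma norm_times_cos_sin_polar_angle:
  "norm r * cos (polar_angle r) = r$1" "norm r * sin (polar_angle r) = r$2"
proof -
  have n: "norm r = cmod (Complex (r$1) (r$2))"
    by (simp add: norm_vec_def L2_set_def sum_2 cmod_def)
  have "rcis (norm r) (polar_angle r) = Complex (r$1) (r$2)"
    unfolding n polar_angle_def by (rule rcis_cmod_Arg)
  then show "norm r * cos (polar_angle r) = r$1" "norm r * sin (polar_angle r) = r$2"
    by (auto simp: complex_eq_iff)
qed

text \<open>\<open>c\<close> stands for the cosine or the sine, so that both azimuthal numbers share
  one expansion.\<close>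

lemma zernike_radial_odd:
  assumes "a > 0"
  shows "complex_of_real (zernike_radial (2 * n + 1) 1 (norm r / a) * c)
    = (\<Sum>l\<le>n. complex_of_real (zernike_coeff n l / a ^ (2 * (n - l) + 1))
        * complex_of_real (norm r * c * norm r ^ (2 * (n - l))))"
proof -
  have "zernike_radial (2 * n + 1) 1 (norm r / a) * c
      = (\<Sum>l\<le>n. zernike_coeff n l * (norm r / a) ^ (2 * n + 1 - 2 * l) * c)"
    unfolding zernike_radial_def sum_distrib_right
    by (intro sum.cong) (auto simp: zernike_coeff_def)
  also have "\<dots> = (\<Sum>l\<le>n. zernike_coeff n l / a ^ (2 * (n - l) + 1) * (norm r * c * norm r ^ (2 * (n - l))))"
  proof (rule sum.cong[OF refl])
    fix l assume "l \<in> {..n}"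
    then have "2 * n + 1 - 2 * l = 2 * (n - l) + 1" by auto
    then show "zernike_coeff n l * (norm r / a) ^ (2 * n + 1 - 2 * l) * c
      = zernike_coeff n l / a ^ (2 * (n - l) + 1) * (norm r * c * norm r ^ (2 * (n - l)))"
      by (simp only: power_divide) simp
  qed
  finally show ?thesis
    by (simp only: of_real_sum of_real_mult)
qed

lemma zernike_unnormalized_odd:
  assumes "a > 0"
  shows "zernike_unnormalized a (2 * n + 1) 1 = zernike_poly a 1 n"
    and "zernike_unnormalized a (2 * n + 1) (-1) = zernike_poly a 2 n"
proof -
  have "zernike_unnormalized a (2 * n + 1) 1 r = zernike_poly a 1 n r" for r
  proof -
    have "zernike_unnormalized a (2 * n + 1) 1 r
        = complex_of_real (zernike_radial (2 * n + 1) 1 (norm r / a) * cos (polar_angle r))"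
      by (simp add: zernike_unnormalized_def)
    then show ?thesis
      by (simp only: zernike_radial_odd[OF assms] norm_times_cos_sin_polar_angle
          zernike_poly_def odd_monomial_def)
  qed
  then show "zernike_unnormalized a (2 * n + 1) 1 = zernike_poly a 1 n" ..
  have "zernike_unnormalized a (2 * n + 1) (-1) r = zernike_poly a 2 n r" for r
  proof -
    have "zernike_unnormalized a (2 * n + 1) (-1) r
        = complex_of_real (zernike_radial (2 * n + 1) 1 (norm r / a) * sin (polar_angle r))"
      by (simp add: zernike_unnormalized_def)
    then show ?thesis
      by (simp only: zernike_radial_odd[OF assms] norm_times_cos_sin_polar_angle
          zernike_poly_def odd_monomial_def)
  qed
  then show "zernike_unnormalized a (2 * n + 1) (-1) = zernike_poly a 2 n" ..
qed

text \<open>Each pairing of monomials is a moment \<open>2 K a^(2p) / (p + 2)\<close> with p = j + n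
  - l and K the moment of order 0. The powers of a combine with those in the coefficients to a
  factor free of l, which leaves the sum of \<open>zernike_coeff_sum_eq_0\<close>.\<close>

lemma inner_L2_odd_monomial_zernike_poly:
  assumes "a > 0" "j < n"
  shows "inner_L2 a (odd_monomial i j) (zernike_poly a i n) = 0"
proof -
  have mono: "inner_L2 a (odd_monomial i j) (odd_monomial i m)
      = complex_of_real (2 * disk_moment a i 0) * complex_of_real (a ^ (2 * (j + m)) / (real (j + m) + 2))" for m
  proof -
    have "inner_L2 a (odd_monomial i j) (odd_monomial i m)
        = (LINT r|disk_measure a. complex_of_real ((r$i)\<^sup>2 * norm r ^ (2 * (j + m))))"
      unfolding inner_L2_def odd_monomial_def
      by (intro Bochner_Integration.integral_cong refl)
         (simp add: power_add power2_eq_square distrib_left mult_ac)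
    also have "\<dots> = complex_of_real (disk_moment a i (j + m))"
      unfolding disk_moment_def by (rule integral_complex_of_real)
    also have "disk_moment a i (j + m) = 2 * disk_moment a i 0 * (a ^ (2 * (j + m)) / (real (j + m) + 2))"
      using disk_moment_eq[OF assms(1), of i "j + m"]
      by (simp add: field_simps)
    finally show ?thesis by (simp only: of_real_mult)
  qed
  have "inner_L2 a (odd_monomial i j) (zernike_poly a i n)
      = (\<Sum>l\<le>n. complex_of_real (zernike_coeff n l / a ^ (2 * (n - l) + 1))
          * inner_L2 a (odd_monomial i j) (odd_monomial i (n - l)))"
    unfolding zernike_poly_def
    by (simp only: inner_L2_sum_right[OF L2_odd_monomial L2_scale[OF L2_odd_monomial]]
        inner_L2_scale_right)
  also have "\<dots> = (\<Sum>l\<le>n. complex_of_real (2 * disk_moment a i 0 * a ^ (2 * j) / a)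
      * complex_of_real (zernike_coeff n l / (real (j + n - l) + 2)))"
  proof (rule sum.cong[OF refl])
    fix l assume "l \<in> {..n}"
    then have l: "j + (n - l) = j + n - l" by simp
    have "zernike_coeff n l / a ^ (2 * (n - l) + 1)
          * (2 * disk_moment a i 0 * (a ^ (2 * (j + (n - l))) / (real (j + (n - l)) + 2)))
        = 2 * disk_moment a i 0 * a ^ (2 * j) / a * (zernike_coeff n l / (real (j + (n - l)) + 2))"
      using assms(1) by (simp add: power_add distrib_left)
    then show "complex_of_real (zernike_coeff n l / a ^ (2 * (n - l) + 1))
          * inner_L2 a (odd_monomial i j) (odd_monomial i (n - l))
        = complex_of_real (2 * disk_moment a i 0 * a ^ (2 * j) / a)
          * complex_of_real (zernike_coeff n l / (real (j + n - l) + 2))"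
      unfolding mono l by (simp only: of_real_mult[symmetric])
  qed
  also have "\<dots> = complex_of_real (2 * disk_moment a i 0 * a ^ (2 * j) / a)
      * complex_of_real (\<Sum>l\<le>n. zernike_coeff n l / (real (j + n - l) + 2))"
    by (simp only: sum_distrib_left of_real_sum)
  finally show ?thesis
    unfolding zernike_coeff_sum_eq_0[OF assms(2)] by simp
qed

text \<open>The polynomial of lower index is a combination of monomials whose index lies below that
  of the other, and each of these is orthogonal to it.\<close>

lemma zernike_poly_orthogonal:
  assumes "a > 0" "m \<noteq> n"
  shows "inner_L2 a (zernike_poly a i m) (zernike_poly a i n) = 0"
proof -
  have less: "inner_L2 a (zernike_poly a i m) (zernike_poly a i n) = 0" if "m < n" for m n
  proof -
    have "inner_L2 a (zernike_poly a i m) (zernike_poly a i n)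
      = (\<Sum>l\<le>m. cnj (complex_of_real (zernike_coeff m l / a ^ (2 * (m - l) + 1)))
          * inner_L2 a (odd_monomial i (m - l)) (zernike_poly a i n))"
      unfolding zernike_poly_def[of a i m]
      by (simp only: inner_L2_sum_left[OF L2_zernike_poly L2_scale[OF L2_odd_monomial]]
          inner_L2_scale_left)
    also have "\<dots> = 0"
      using that by (intro sum.neutral ballI)
        (simp add: inner_L2_odd_monomial_zernike_poly[OF assms(1)])
    finally show ?thesis .
  qed
  show ?thesis
    using less[of m n] less[of n m] assms(2) inner_L2_commute[of a "zernike_poly a i m" "zernike_poly a i n"]
    by (cases "m < n") auto
qed

definition normalized_zernike :: "real \<Rightarrow> 2 \<Rightarrow> nat \<Rightarrow> wavefun" where
  "normalized_zernike a i n = (\<lambda>r. zernike_poly a i n r / complex_of_real (norm_L2 a (zernike_poly a i n)))"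

lemma orthonormal_or_null_zernike:
  assumes "a > 0"
  shows "orthonormal_or_null a (normalized_zernike a i)"
  unfolding orthonormal_or_null_def
proof (intro conjI allI impI)
  show "normalized_zernike a i n \<in> L2 a" for n
    unfolding normalized_zernike_def by (intro L2_divide L2_zernike_poly)
  show "norm_L2 a (normalized_zernike a i n) = 1 \<or> norm_L2 a (normalized_zernike a i n) = 0" for n
    by (cases "norm_L2 a (zernike_poly a i n) = 0")
       (simp_all add: normalized_zernike_def norm_L2_divide)
  fix m n :: nat assume "m \<noteq> n"
  then show "inner_L2 a (normalized_zernike a i m) (normalized_zernike a i n) = 0"
    using inner_L2_scale_right[of a "normalized_zernike a i m"
        "1 / complex_of_real (norm_L2 a (zernike_poly a i n))" "zernike_poly a i n"]
      inner_L2_scale_left[of a "1 / complex_of_real (norm_L2 a (zernike_poly a i m))" "zernike_poly a i m"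
        "zernike_poly a i n"] zernike_poly_orthogonal[OF assms]
    by (simp add: normalized_zernike_def)
qed

lemma odd_monomial_reflect: "odd_monomial i j (reflect m r) = (if m = i then - odd_monomial i j r else odd_monomial i j r)"
  by (simp add: odd_monomial_def reflect_nth)

lemma normalized_zernike_reflect:
  "normalized_zernike a i n (reflect m r)
    = (if m = i then - normalized_zernike a i n r else normalized_zernike a i n r)"
  by (simp add: normalized_zernike_def zernike_poly_def odd_monomial_reflect sum_negf)

text \<open>The integrand is odd under the reflection of coordinate i. Annihilation of radial
  functions and of the other coordinate, and the orthogonality of the two families, are all
  instances.\<close>

lemma normalized_zernike_inner_even:
  assumes f: "f \<in> L2 a" and even: "\<And>r. f (reflect i r) = f r"
  shows "inner_L2 a (normalized_zernike a i n) f = 0"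
proof -
  have Z: "normalized_zernike a i n \<in> L2 a"
    unfolding normalized_zernike_def by (intro L2_divide L2_zernike_poly)
  show ?thesis
    unfolding inner_L2_def
    using borel_measurable_integrable[OF integrable_inner_L2[OF Z f]]
    by (rule integral_disk_odd[where i=i]) (simp add: even normalized_zernike_reflect)
qed

lemma bounded_op_fixes_sum:
  assumes P: "bounded_op a P" and L: "\<And>i. i \<in> I \<Longrightarrow> f i \<in> L2 a"
    and fixed: "\<And>i. i \<in> I \<Longrightarrow> norm_L2 a (\<lambda>r. P (f i) r - f i r) = 0"
  shows "norm_L2 a (\<lambda>r. P (\<lambda>r. \<Sum>i\<in>I. c i * f i r) r - (\<Sum>i\<in>I. c i * f i r)) = 0"
proof -
  have zero: "norm_L2 a (\<lambda>r. P (\<lambda>r. 0) r - 0) = 0"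
    using bounded_op_scale[OF P L2_zero, of 0] by simp
  show ?thesis
    using L fixed
  proof (induction I rule: infinite_finite_induct)
    case (insert x F)
    have fx: "f x \<in> L2 a" and fixed_x: "norm_L2 a (\<lambda>r. P (f x) r - f x r) = 0"
      using insert.prems by simp_all
    have SL: "(\<lambda>r. \<Sum>i\<in>F. c i * f i r) \<in> L2 a"
      using insert.prems(1) by (intro L2_sum L2_scale) simp
    have IH: "norm_L2 a (\<lambda>r. P (\<lambda>r. \<Sum>i\<in>F. c i * f i r) r - (\<Sum>i\<in>F. c i * f i r)) = 0"
      using insert.prems by (intro insert.IH) simp_all
    show ?case
      using bounded_op_fixes_add[OF P L2_scale[OF fx] SL bounded_op_fixes_scale[OF P fx fixed_x] IH, of "c x"]
        insert.hyps by simp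
  qed (use zero in simp_all)
qed

section \<open>What the Zernike sums fix and annihilate\<close>

context
  fixes a :: real and i :: 2 and P :: wave_op
  assumes a: "a > 0" and P: "strong_sum a (normalized_zernike a i) P"
begin

lemmas zernike_sum_bounded_op = strong_sum_bounded_op[OF orthonormal_or_null_zernike[OF a] P]

text \<open>A null polynomial is fixed because its image is null as well; any other is a multiple of
  a member of the family.\<close>

lemma zernike_sum_fixes_poly: "norm_L2 a (\<lambda>r. P (zernike_poly a i n) r - zernike_poly a i n r) = 0"
proof (cases "norm_L2 a (zernike_poly a i n) = 0")
  case True
  then have "norm_L2 a (P (zernike_poly a i n)) \<le> 0"
    using strong_sum_norm_le[OF orthonormal_or_null_zernike[OF a] P L2_zernike_poly, of i n] by simp
  then have "norm_L2 a (\<lambda>r. P (zernike_poly a i n) r - zernike_poly a i n r) \<le> 0"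
    using norm_L2_triangle_minus[OF bounded_op_L2[OF zernike_sum_bounded_op L2_zernike_poly] L2_zernike_poly,
        of i n i n] True by simp
  then show ?thesis by (simp add: antisym)
next
  case False
  have "zernike_poly a i n = (\<lambda>r. complex_of_real (norm_L2 a (zernike_poly a i n)) * normalized_zernike a i n r)"
    using False by (simp add: normalized_zernike_def)
  then show ?thesis
    using bounded_op_fixes_scale[OF zernike_sum_bounded_op
        orthonormal_or_null_L2[OF orthonormal_or_null_zernike[OF a]]
        strong_sum_fixes_basis[OF orthonormal_or_null_zernike[OF a] P]]
    by metis
qed

text \<open>Triangular inversion: the term l = 0 of \<open>zernike_poly\<close> carries the highest
  monomial with a nonzero coefficient, and the lower monomials are fixed by induction.\<close>

lemma zernike_sum_fixes_monomial:
  "norm_L2 a (\<lambda>r. P (odd_monomial i n) r - odd_monomial i n r) = 0"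
proof (induction n rule: less_induct)
  case (less n)
  let ?c = "\<lambda>l. complex_of_real (zernike_coeff n l / a ^ (2 * (n - l) + 1))"
  let ?S = "\<lambda>r. \<Sum>l\<in>{1..n}. (- ?c l) * odd_monomial i (n - l) r"
  have split: "{..n} = insert 0 {1..n}" by auto
  have "(\<lambda>r. zernike_poly a i n r + ?S r) = (\<lambda>r. ?c 0 * odd_monomial i n r)"
    unfolding zernike_poly_def split by (simp add: sum_negf)
  moreover have "?c 0 \<noteq> 0"
    using a by (simp only: of_real_eq_0_iff) (simp add: zernike_coeff_def del: fact_Suc)
  ultimately have eq: "odd_monomial i n = (\<lambda>r. (1 / ?c 0) * (zernike_poly a i n r + ?S r))"
    by (simp add: fun_eq_iff)
  have SL: "?S \<in> L2 a" by (intro L2_sum L2_scale L2_odd_monomial)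
  have S: "norm_L2 a (\<lambda>r. P ?S r - ?S r) = 0"
    by (rule bounded_op_fixes_sum[OF zernike_sum_bounded_op L2_odd_monomial less.IH]) auto
  have "norm_L2 a (\<lambda>r. P (\<lambda>r. (1 / ?c 0) * (zernike_poly a i n r + ?S r)) r
      - (1 / ?c 0) * (zernike_poly a i n r + ?S r)) = 0"
    by (intro bounded_op_fixes_scale bounded_op_fixes_add zernike_sum_bounded_op L2_add L2_zernike_poly
        SL S zernike_sum_fixes_poly)
  moreover have "(1 / ?c 0) * (zernike_poly a i n r + ?S r) = odd_monomial i n r" for r
    by (subst eq) (rule refl)
  ultimately show ?case by (simp only:)
qed

text \<open>On the axis \<open>Phi\<close> is a constant times \<open>exp (z |r|^2)\<close>.
  Multiplying the exponential series by \<open>x_i\<close> gives combinations of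
  \<open>odd_monomial\<close> that converge uniformly on the disk, and limits of fixed functions are
  fixed.\<close>

lemma zernike_sum_fixes_position:
  "norm_L2 a (\<lambda>r. P (position (axis i 1) (Phi a k (vector [0, 0, \<sigma>]))) r
      - position (axis i 1) (Phi a k (vector [0, 0, \<sigma>])) r) = 0"
proof (rule bounded_op_fixes_limit[OF zernike_sum_bounded_op])
  let ?z = "- (\<i> * complex_of_real (k * \<sigma> / 2))"
  let ?C = "complex_of_real (1 / (sqrt pi * a))"
  let ?g = "\<lambda>N r. \<Sum>n\<in>{..N}. (?C * ?z ^ n / fact n) * odd_monomial i n r"
  show "?g N \<in> L2 a" for N by (intro L2_sum L2_scale L2_odd_monomial)
  show "position (axis i 1) (Phi a k (vector [0, 0, \<sigma>])) \<in> L2 a" by (rule L2_position_Phi)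
  show "norm_L2 a (\<lambda>r. P (?g N) r - ?g N r) = 0" for N
    by (rule bounded_op_fixes_sum[OF zernike_sum_bounded_op L2_odd_monomial zernike_sum_fixes_monomial])
  \<comment> \<open>A bound for the modulus of the exponent on the disk. The remainder bound, with N
    + 1 in the power but N in the factorial, is written as \<open>?R\<close> times a term of the
    exponential series, which tends to 0.\<close>
  let ?R = "\<bar>k * \<sigma> / 2\<bar> * a\<^sup>2"
  let ?b = "\<lambda>N. a * (1 / (sqrt pi * a)) * (?R * (?R ^ N / fact N))"
  show "(\<lambda>N. norm_L2 a (\<lambda>r. ?g N r - position (axis i 1) (Phi a k (vector [0, 0, \<sigma>])) r)) \<longlonglongrightarrow> 0"
  proof (rule norm_L2_tendsto_0_uniform)
    show "(\<lambda>r. ?g N r - position (axis i 1) (Phi a k (vector [0, 0, \<sigma>])) r) \<in> L2 a" for N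
      by (intro L2_diff L2_sum L2_scale L2_odd_monomial L2_position_Phi)
    show "?b N \<ge> 0" for N using a by simp
    have "(\<lambda>N. ?R ^ N / fact N) \<longlonglongrightarrow> 0"
      using summable_LIMSEQ_zero[OF summable_exp[of ?R]] by (simp only: divide_inverse mult.commute)
    then have "?b \<longlonglongrightarrow> a * (1 / (sqrt pi * a)) * (?R * 0)"
      by (intro tendsto_intros)
    then show "?b \<longlonglongrightarrow> 0" by simp
    fix N and r :: "real^2" assume r: "r \<in> cball 0 a"
    let ?w = "?z * complex_of_real ((norm r)\<^sup>2)"
    have Phi: "Phi a k (vector [0, 0, \<sigma>]) r = ?C * exp ?w"
      by (simp add: Phi_def field_simps)
    have g: "?g N r = complex_of_real (r$i) * ?C * (\<Sum>n\<le>N. ?w ^ n / fact n)"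
    proof -
      have w: "?w ^ n = ?z ^ n * complex_of_real (norm r ^ (2 * n))" for n
        by (simp only: power_mult_distrib of_real_power power_mult)
      show ?thesis
        unfolding sum_distrib_left w odd_monomial_def of_real_mult
        by (simp only: times_divide_eq_right times_divide_eq_left mult_ac)
    qed
    have nw: "cmod ?w \<le> ?R"
    proof -
      have "cmod ?w = \<bar>k * \<sigma> / 2\<bar> * (norm r)\<^sup>2" by (simp add: norm_mult norm_power norm_divide abs_mult)
      also have "\<dots> \<le> ?R"
        using r by (intro mult_left_mono power_mono) auto
      finally show ?thesis .
    qed
    have "?g N r - position (axis i 1) (Phi a k (vector [0, 0, \<sigma>])) r
        = - (complex_of_real (r$i) * ?C * (exp ?w - (\<Sum>n\<le>N. ?w ^ n / fact n)))"
      unfolding g position_def Phi by (simp add: inner_axis' algebra_simps)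
    then have "cmod (?g N r - position (axis i 1) (Phi a k (vector [0, 0, \<sigma>])) r)
        = \<bar>r$i\<bar> * (1 / (sqrt pi * a)) * cmod (exp ?w - (\<Sum>n\<le>N. ?w ^ n / fact n))"
      using a by (simp only: norm_minus_cancel norm_mult norm_of_real) simp
    also have "\<dots> \<le> a * (1 / (sqrt pi * a)) * (?R ^ Suc N / fact N)"
    proof (intro mult_mono)
      show "\<bar>r$i\<bar> \<le> a" using r component_le_norm_cart[of r i] by simp
      have "cmod (exp ?w - (\<Sum>n\<le>N. ?w ^ n / fact n)) \<le> exp \<bar>Re ?w\<bar> * cmod ?w ^ Suc N / fact N"
        by (rule Taylor_exp)
      also have "\<dots> = cmod ?w ^ Suc N / fact N" by simp
      also have "\<dots> \<le> ?R ^ Suc N / fact N"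
        using nw by (intro divide_right_mono power_mono) auto
      finally show "cmod (exp ?w - (\<Sum>n\<le>N. ?w ^ n / fact n)) \<le> ?R ^ Suc N / fact N" .
    qed (use a in auto)
    also have "\<dots> = ?b N" by simp
    finally show "cmod (?g N r - position (axis i 1) (Phi a k (vector [0, 0, \<sigma>])) r) \<le> ?b N" .
  qed
qed

lemma zernike_sum_kills_Phi: "norm_L2 a (P (Phi a k (vector [0, 0, \<sigma>]))) = 0"
  by (rule strong_sum_null[OF orthonormal_or_null_zernike[OF a] P L2_Phi normalized_zernike_inner_even[OF L2_Phi]])
     (simp add: Phi_def)

lemma zernike_sum_kills_position:
  assumes "j \<noteq> i"
  shows "norm_L2 a (P (position (axis j 1) (Phi a k (vector [0, 0, \<sigma>])))) = 0"
  by (rule strong_sum_null[OF orthonormal_or_null_zernike[OF a] P L2_position_Phi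
        normalized_zernike_inner_even[OF L2_position_Phi]])
     (use assms in \<open>simp add: position_def Phi_def inner_axis' reflect_nth\<close>)

end

lemma strong_sum_odd_zernike_sum:
  assumes a: "a > 0"
  shows "odd_zernike_sum a 1 P \<Longrightarrow> strong_sum a (normalized_zernike a 1) P"
    and "odd_zernike_sum a (-1) P \<Longrightarrow> strong_sum a (normalized_zernike a 2) P"
proof -
  have Z: "Zernike a (2 * n + 1) 1 = normalized_zernike a 1 n"
    "Zernike a (2 * n + 1) (-1) = normalized_zernike a 2 n" for n
    unfolding Zernike_def normalized_zernike_def zernike_unnormalized_odd[OF a] by (rule refl)+
  show "odd_zernike_sum a 1 P \<Longrightarrow> strong_sum a (normalized_zernike a 1) P"
    "odd_zernike_sum a (-1) P \<Longrightarrow> strong_sum a (normalized_zernike a 2) P"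
    unfolding odd_zernike_sum_def strong_sum_def fourier_part_def Z ketbra_def
    by (simp_all add: mult.commute)
qed

lemma normalized_zernike_cross_orthogonal:
  assumes "a > 0" "i \<noteq> j"
  shows "inner_L2 a (normalized_zernike a i m) (normalized_zernike a j n) = 0"
  using orthonormal_or_null_L2[OF orthonormal_or_null_zernike[OF assms(1)]] assms(2)
  by (intro normalized_zernike_inner_even) (auto simp: normalized_zernike_reflect)

section \<open>Limits of the Fisher information\<close>

lemma bounded_op_kills_scale:
  assumes P: "bounded_op a P" and f: "f \<in> L2 a" and "norm_L2 a (P f) = 0"
  shows "norm_L2 a (P (\<lambda>r. c * f r)) = 0"
proof -
  have "norm_L2 a (\<lambda>r. c * P f r) = 0" using assms(3) by (simp add: norm_L2_scale)
  then have "norm_L2 a (P (\<lambda>r. c * f r)) \<le> 0"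
    using norm_L2_triangle_sub[OF bounded_op_L2[OF P L2_scale[OF f]] L2_scale[OF bounded_op_L2[OF P f]],
        of c c] bounded_op_scale[OF P f, of c] by simp
  then show ?thesis by (simp add: antisym)
qed

lemma dPhi_axis_eq_scale_position:
  assumes "v = axis i 1 \<or> v = - axis i 1"
  obtains c where "dPhi a k v s = (\<lambda>r. c * position (axis i 1) (Phi a k s) r)"
proof (cases "v = axis i 1")
  case True
  then show ?thesis by (intro that[of "\<i> * k"]) (simp add: dPhi_def)
next
  case False
  then have "v = - axis i 1" using assms by simp
  then show ?thesis by (intro that[of "- (\<i> * k)"]) (simp add: dPhi_def position_def)
qed

lemma zernike_sum_fixes_dPhi:
  assumes "a > 0" "strong_sum a (normalized_zernike a i) P" and v: "v = axis i 1 \<or> v = - axis i 1"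
  shows "norm_L2 a (\<lambda>r. P (dPhi a k v (vector [0, 0, \<sigma>])) r - dPhi a k v (vector [0, 0, \<sigma>]) r) = 0"
  by (rule dPhi_axis_eq_scale_position[OF v, of a k "vector [0, 0, \<sigma>]"])
     (simp only: bounded_op_fixes_scale[OF zernike_sum_bounded_op[OF assms(1,2)] L2_position_Phi
          zernike_sum_fixes_position[OF assms(1,2)]])

lemma zernike_sum_kills_dPhi:
  assumes "a > 0" "strong_sum a (normalized_zernike a i) P"
    and "j \<noteq> i" and v: "v = axis j 1 \<or> v = - axis j 1"
  shows "norm_L2 a (P (dPhi a k v (vector [0, 0, \<sigma>]))) = 0"
  by (rule dPhi_axis_eq_scale_position[OF v, of a k "vector [0, 0, \<sigma>]"])
     (simp only: bounded_op_kills_scale[OF zernike_sum_bounded_op[OF assms(1,2)] L2_position_Phi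
          zernike_sum_kills_position[OF assms(1,2,3)]])

text \<open>The quantity in which the limits are expressed: off the axis the quantum bound is twice
  it, and at a null point it is the Hessian of the probability and twice its second-order
  coefficient. It is defined and continuous at s = 0 as well.\<close>

definition fisher_form :: "real \<Rightarrow> real \<Rightarrow> wave_op \<Rightarrow> real^3 \<Rightarrow> real^2 \<Rightarrow> real^2 \<Rightarrow> real" where
  "fisher_form a k P s v w = Re (inner_L2 a (dPhi a k v s) (P (dPhi a k w s)))
     + Re (inner_L2 a (dPhi a k (- v) (- s)) (P (dPhi a k (- w) (- s))))"

definition prob_derivative :: "real \<Rightarrow> real \<Rightarrow> wave_op \<Rightarrow> real^2 \<Rightarrow> real^3 \<Rightarrow> real" where
  "prob_derivative a k P v s = Re (inner_L2 a (dPhi a k v s) (P (Phi a k s)))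
     + Re (inner_L2 a (dPhi a k (- v) (- s)) (P (Phi a k (- s))))"

lemma uminus_add_transverse: "- (s + t *\<^sub>R transverse v) = - s + t *\<^sub>R transverse (- v)"
  by (simp add: transverse_uminus)

context
  fixes a k :: real and P :: wave_op
  assumes a: "a > 0" and P: "projector a P"
begin

lemma projector_bounded_op: "bounded_op a P"
  and projector_self_adjoint: "f \<in> L2 a \<Longrightarrow> g \<in> L2 a \<Longrightarrow> inner_L2 a f (P g) = inner_L2 a (P f) g"
  using P by (simp_all add: projector_def self_adjoint_def)

lemmas projector_L2 = bounded_op_L2[OF projector_bounded_op]

lemma tendsto_P_Phi:
  "((\<lambda>t. norm_L2 a (\<lambda>r. P (Phi a k (s + t *\<^sub>R transverse v)) r - P (Phi a k s) r)) \<longlongrightarrow> 0) (at 0)"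
  by (rule tendsto_bounded_op[OF projector_bounded_op L2_Phi L2_Phi tendsto_Phi[OF a]])

lemma tendsto_P_dPhi:
  "((\<lambda>t. norm_L2 a (\<lambda>r. P (dPhi a k w (s + t *\<^sub>R transverse v)) r - P (dPhi a k w s) r)) \<longlongrightarrow> 0) (at 0)"
  by (rule tendsto_bounded_op[OF projector_bounded_op L2_dPhi L2_dPhi tendsto_dPhi[OF a]])

lemma tendsto_P_Phi_quotient:
  "((\<lambda>t. norm_L2 a (\<lambda>r. P (Phi_quotient a k v s t) r - P (dPhi a k v s) r)) \<longlongrightarrow> 0) (at 0)"
  by (rule tendsto_bounded_op[OF projector_bounded_op L2_Phi_quotient L2_dPhi tendsto_Phi_quotient[OF a]])

text \<open>The product rule; self-adjointness of P makes both contributions equal in real part,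
  whence the factor 2.\<close>

lemma tendsto_quadratic_quotient:
  "((\<lambda>t. (Re (inner_L2 a (Phi a k (s + t *\<^sub>R transverse v)) (P (Phi a k (s + t *\<^sub>R transverse v))))
      - Re (inner_L2 a (Phi a k s) (P (Phi a k s)))) / t)
    \<longlongrightarrow> 2 * Re (inner_L2 a (dPhi a k v s) (P (Phi a k s)))) (at 0)"
proof (rule Lim_transform_eventually)
  let ?u = "\<lambda>t. Phi a k (s + t *\<^sub>R transverse v)" and ?p = "Phi a k s"
  let ?q = "Phi_quotient a k v s"
  note PL = projector_L2
  have lim1: "((\<lambda>t. inner_L2 a (?q t) (P (?u t))) \<longlongrightarrow> inner_L2 a (dPhi a k v s) (P ?p)) (at 0)"
    by (rule tendsto_inner_L2[OF L2_Phi_quotient PL[OF L2_Phi] L2_dPhi PL[OF L2_Phi]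
          tendsto_Phi_quotient[OF a] tendsto_P_Phi])
  have lim2: "((\<lambda>t. inner_L2 a (P ?p) (?q t)) \<longlongrightarrow> inner_L2 a (P ?p) (dPhi a k v s)) (at 0)"
    by (rule tendsto_inner_L2[OF PL[OF L2_Phi] L2_Phi_quotient PL[OF L2_Phi] L2_dPhi _
          tendsto_Phi_quotient[OF a]]) simp
  have "((\<lambda>t. Re (inner_L2 a (?q t) (P (?u t))) + Re (inner_L2 a (P ?p) (?q t)))
    \<longlongrightarrow> Re (inner_L2 a (dPhi a k v s) (P ?p)) + Re (inner_L2 a (P ?p) (dPhi a k v s))) (at 0)"
    by (intro tendsto_intros lim1 lim2)
  also have "Re (inner_L2 a (P ?p) (dPhi a k v s)) = Re (inner_L2 a (dPhi a k v s) (P ?p))"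
    by (subst inner_L2_commute) simp
  finally show "((\<lambda>t. Re (inner_L2 a (?q t) (P (?u t))) + Re (inner_L2 a (P ?p) (?q t)))
    \<longlongrightarrow> 2 * Re (inner_L2 a (dPhi a k v s) (P ?p))) (at 0)"
    by (simp only: mult_2)
  have "inner_L2 a (?q t) (P (?u t)) + inner_L2 a (P ?p) (?q t)
      = (inner_L2 a (?u t) (P (?u t)) - inner_L2 a ?p (P ?p)) / complex_of_real t" for t
  proof -
    have "inner_L2 a (?q t) (P (?u t))
        = (inner_L2 a (?u t) (P (?u t)) - inner_L2 a ?p (P (?u t))) / complex_of_real t"
      using inner_L2_scale_left[of a "1 / complex_of_real t" "\<lambda>r. ?u t r - ?p r" "P (?u t)"]
      by (simp add: Phi_quotient_def inner_L2_diff_left PL[OF L2_Phi] L2_Phi)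
    moreover have "inner_L2 a (P ?p) (?q t)
        = (inner_L2 a (P ?p) (?u t) - inner_L2 a (P ?p) ?p) / complex_of_real t"
      using inner_L2_scale_right[of a "P ?p" "1 / complex_of_real t" "\<lambda>r. ?u t r - ?p r"]
      by (simp add: Phi_quotient_def inner_L2_diff_right PL[OF L2_Phi] L2_Phi)
    moreover have "inner_L2 a (P ?p) (?u t) = inner_L2 a ?p (P (?u t))"
      "inner_L2 a (P ?p) ?p = inner_L2 a ?p (P ?p)"
      by (rule projector_self_adjoint[symmetric]; rule L2_Phi)+
    ultimately show ?thesis by (simp add: diff_divide_distrib)
  qed
  then have "Re (inner_L2 a (?q t) (P (?u t))) + Re (inner_L2 a (P ?p) (?q t))
      = (Re (inner_L2 a (?u t) (P (?u t))) - Re (inner_L2 a ?p (P ?p))) / t" for t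
    by (metis Re_divide_of_real minus_complex.sel(1) plus_complex.sel(1))
  then show "\<forall>\<^sub>F t in at 0. Re (inner_L2 a (?q t) (P (?u t))) + Re (inner_L2 a (P ?p) (?q t))
      = (Re (inner_L2 a (?u t) (P (?u t))) - Re (inner_L2 a ?p (P ?p))) / t"
    by (simp add: always_eventually)
qed

text \<open>As it holds at every s, the inner \<open>partial\<close> in \<open>hessian\<close> can
  be rewritten and then differentiated once more.\<close>

lemma partial_prob: "partial i (prob a k P) s = prob_derivative a k P (axis i 1) s"
proof -
  let ?v = "axis i 1 :: real^2"
  let ?g = "\<lambda>s. Re (inner_L2 a (Phi a k s) (P (Phi a k s)))"
  have "((\<lambda>t. ((?g (s + t *\<^sub>R transverse ?v) - ?g s) / t
      + (?g (- s + t *\<^sub>R transverse (- ?v)) - ?g (- s)) / t) / 2)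
    \<longlongrightarrow> (2 * Re (inner_L2 a (dPhi a k ?v s) (P (Phi a k s)))
      + 2 * Re (inner_L2 a (dPhi a k (- ?v) (- s)) (P (Phi a k (- s))))) / 2) (at 0)"
    by (intro tendsto_divide tendsto_add tendsto_quadratic_quotient tendsto_const) simp
  also have "(\<lambda>t. ((?g (s + t *\<^sub>R transverse ?v) - ?g s) / t
      + (?g (- s + t *\<^sub>R transverse (- ?v)) - ?g (- s)) / t) / 2)
    = (\<lambda>t. (prob a k P (s + t *\<^sub>R transverse ?v) - prob a k P s) / t)"
    unfolding prob_eq[OF P] uminus_add_transverse
    by (simp add: fun_eq_iff diff_divide_distrib add_divide_distrib)
  finally have "((\<lambda>t. prob a k P (s + t *\<^sub>R transverse ?v)) has_real_derivative
      prob_derivative a k P ?v s) (at 0)"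
    by (simp add: DERIV_def prob_derivative_def add_divide_distrib)
  then show ?thesis
    unfolding partial_def by (rule DERIV_imp_deriv)
qed

lemma tendsto_prob_derivative:
  "((\<lambda>t. prob_derivative a k P w (s + t *\<^sub>R transverse v)) \<longlongrightarrow> prob_derivative a k P w s) (at 0)"
  unfolding prob_derivative_def uminus_add_transverse
  by (intro tendsto_add tendsto_Re tendsto_inner_L2[OF L2_dPhi projector_L2[OF L2_Phi] L2_dPhi
        projector_L2[OF L2_Phi] tendsto_dPhi[OF a] tendsto_P_Phi])

lemma tendsto_prob: "((\<lambda>t. prob a k P (s + t *\<^sub>R transverse v)) \<longlongrightarrow> prob a k P s) (at 0)"
  unfolding prob_eq[OF P] uminus_add_transverse
  by (intro tendsto_divide tendsto_const tendsto_add tendsto_Re tendsto_inner_L2[OF L2_Phi projector_L2[OF L2_Phi] L2_Phi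
        projector_L2[OF L2_Phi] tendsto_Phi[OF a] tendsto_P_Phi]) simp

lemma tendsto_fisher_form:
  "((\<lambda>t. fisher_form a k P (s + t *\<^sub>R transverse v) w w') \<longlongrightarrow> fisher_form a k P s w w') (at 0)"
  unfolding fisher_form_def uminus_add_transverse
  by (intro tendsto_add tendsto_Re tendsto_inner_L2[OF L2_dPhi projector_L2[OF L2_dPhi] L2_dPhi
        projector_L2[OF L2_dPhi] tendsto_dPhi[OF a] tendsto_P_dPhi])

lemma fisher_form_add_right:
  "fisher_form a k P s w (v + v') = fisher_form a k P s w v + fisher_form a k P s w v'"
proof -
  have d: "dPhi a k (v + v') s = (\<lambda>r. dPhi a k v s r + dPhi a k v' s r)" for v v' s
    by (simp add: dPhi_def position_def inner_add_left algebra_simps)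
  show ?thesis
    using d[of "- v" "- v'"]
    by (simp add: fisher_form_def d inner_L2_bounded_op_add[OF projector_bounded_op L2_dPhi L2_dPhi L2_dPhi])
qed

lemma fisher_form_scale_right:
  "fisher_form a k P s w (c *\<^sub>R v) = c * fisher_form a k P s w v"
proof -
  have d: "dPhi a k (c *\<^sub>R v) s = (\<lambda>r. complex_of_real c * dPhi a k v s r)" for v s
    by (simp add: dPhi_def position_def algebra_simps)
  show ?thesis
    using d[of "- v"]
    by (simp add: fisher_form_def d inner_L2_bounded_op_scale[OF projector_bounded_op L2_dPhi L2_dPhi]
        distrib_left)
qed

lemma fisher_form_commute: "fisher_form a k P s v w = fisher_form a k P s w v"
proof -
  have "Re (inner_L2 a (dPhi a k v s) (P (dPhi a k w s))) = Re (inner_L2 a (dPhi a k w s) (P (dPhi a k v s)))" for v w s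
    by (subst projector_self_adjoint[OF L2_dPhi L2_dPhi], subst inner_L2_commute) simp
  then show ?thesis by (simp add: fisher_form_def)
qed

text \<open>Nonzero v and t move the point off the line, where \<open>quantum_bound_eq\<close>
  applies; the form it yields is continuous across the line.\<close>

lemma tendsto_quantum_bound:
  assumes "k > 0" and T: "\<And>i s. s \<noteq> 0 \<Longrightarrow> is_sld a k i s (L i s)" and "v \<noteq> 0"
  shows "((\<lambda>t. quantum_bound a k L P (vector [0, 0, \<sigma>] + t *\<^sub>R transverse v))
    \<longlongrightarrow> (\<chi> i j. 2 * fisher_form a k P (vector [0, 0, \<sigma>]) (axis i 1) (axis j 1))) (at 0)"
proof (intro vec_tendstoI)
  fix i j
  let ?s = "\<lambda>t. vector [0, 0, \<sigma>] + t *\<^sub>R transverse v :: real^3"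
  have "((\<lambda>t. 2 * fisher_form a k P (?s t) (axis i 1) (axis j 1))
      \<longlongrightarrow> 2 * fisher_form a k P (vector [0, 0, \<sigma>]) (axis i 1) (axis j 1)) (at 0)"
    by (intro tendsto_mult tendsto_const tendsto_fisher_form)
  moreover have "\<forall>\<^sub>F t in at 0. 2 * fisher_form a k P (?s t) (axis i 1) (axis j 1)
      = quantum_bound a k L P (?s t) $ i $ j"
    unfolding eventually_at_filter
  proof (rule always_eventually, intro allI impI)
    fix t :: real assume "t \<noteq> 0"
    then have s: "?s t $ 1 \<noteq> 0 \<or> ?s t $ 2 \<noteq> 0"
      using \<open>v \<noteq> 0\<close> by (auto simp: vec_eq_iff forall_2 vector_3)
    then have nz: "?s t \<noteq> 0" by (metis zero_index)
    show "2 * fisher_form a k P (?s t) (axis i 1) (axis j 1) = quantum_bound a k L P (?s t) $ i $ j"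
      using quantum_bound_eq[where L=L and s="?s t", OF a assms(1) P s T[OF nz]] by (simp add: fisher_form_def)
  qed
  ultimately have "((\<lambda>t. quantum_bound a k L P (?s t) $ i $ j)
     \<longlongrightarrow> 2 * fisher_form a k P (vector [0, 0, \<sigma>]) (axis i 1) (axis j 1)) (at 0)"
    by (rule Lim_transform_eventually)
  then show "((\<lambda>t. quantum_bound a k L P (?s t) $ i $ j)
     \<longlongrightarrow> (\<chi> i j. 2 * fisher_form a k P (vector [0, 0, \<sigma>]) (axis i 1) (axis j 1)) $ i $ j) (at 0)"
    by simp
qed

section \<open>Second-order behaviour at null points, and the two saturation criteria\<close>

context
  fixes s :: "real^3"
  assumes null: "norm_L2 a (P (Phi a k s)) = 0" "norm_L2 a (P (Phi a k (- s))) = 0"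
begin

lemma null_inner: "f \<in> L2 a \<Longrightarrow> inner_L2 a f (P (Phi a k s)) = 0"
  "f \<in> L2 a \<Longrightarrow> inner_L2 a f (P (Phi a k (- s))) = 0"
  using null by (auto intro: inner_L2_null_right projector_L2[OF L2_Phi])

lemma null_prob: "prob a k P s = 0"
  by (simp add: prob_eq[OF P] null_inner L2_Phi)

lemma null_prob_derivative: "prob_derivative a k P v s = 0"
  by (simp add: prob_derivative_def null_inner L2_dPhi)

end

text \<open>The image of \<open>Phi a k s\<close> is null, so it can be subtracted at no cost;
  dividing by t then produces a difference quotient.\<close>

lemma tendsto_null_linear:
  assumes null: "norm_L2 a (P (Phi a k s)) = 0"
  shows "((\<lambda>t. Re (inner_L2 a (dPhi a k w (s + t *\<^sub>R transverse v)) (P (Phi a k (s + t *\<^sub>R transverse v)))) / t)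
    \<longlongrightarrow> Re (inner_L2 a (dPhi a k w s) (P (dPhi a k v s)))) (at 0)"
proof -
  let ?u = "\<lambda>t. Phi a k (s + t *\<^sub>R transverse v)" and ?p = "Phi a k s"
  let ?d = "\<lambda>t. dPhi a k w (s + t *\<^sub>R transverse v)"
  let ?q = "Phi_quotient a k v s"
  note PL = projector_L2
  have "((\<lambda>t. Re (inner_L2 a (P (?d t)) (?q t))) \<longlongrightarrow> Re (inner_L2 a (P (dPhi a k w s)) (dPhi a k v s))) (at 0)"
    by (intro tendsto_Re tendsto_inner_L2[OF PL[OF L2_dPhi] L2_Phi_quotient PL[OF L2_dPhi] L2_dPhi
          tendsto_P_dPhi tendsto_Phi_quotient[OF a]])
  moreover have "Re (inner_L2 a (P (?d t)) (?q t)) = Re (inner_L2 a (?d t) (P (?u t))) / t" for t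
  proof -
    have "inner_L2 a (P (?d t)) ?p = 0"
      using inner_L2_null_right[OF L2_dPhi PL[OF L2_Phi] null] projector_self_adjoint[OF L2_dPhi L2_Phi] by simp
    then have "inner_L2 a (P (?d t)) (?q t) = inner_L2 a (P (?d t)) (?u t) / complex_of_real t"
      using inner_L2_scale_right[of a "P (?d t)" "1 / complex_of_real t" "\<lambda>r. ?u t r - ?p r"]
      by (simp add: Phi_quotient_def inner_L2_diff_right PL[OF L2_dPhi] L2_Phi)
    then show ?thesis
      using projector_self_adjoint[OF L2_dPhi L2_Phi] by (simp add: Re_divide_of_real)
  qed
  ultimately show ?thesis
    using projector_self_adjoint[OF L2_dPhi L2_dPhi] by simp
qed

text \<open>The subtraction is possible in both slots and gives two difference quotients, one for
  each power of t.\<close>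

lemma tendsto_null_quadratic:
  assumes null: "norm_L2 a (P (Phi a k s)) = 0"
  shows "((\<lambda>t. Re (inner_L2 a (Phi a k (s + t *\<^sub>R transverse v)) (P (Phi a k (s + t *\<^sub>R transverse v)))) / t\<^sup>2)
    \<longlongrightarrow> Re (inner_L2 a (dPhi a k v s) (P (dPhi a k v s)))) (at 0)"
proof (rule Lim_transform_eventually)
  let ?u = "\<lambda>t. Phi a k (s + t *\<^sub>R transverse v)" and ?p = "Phi a k s"
  let ?q = "Phi_quotient a k v s"
  note PL = projector_L2
  show "((\<lambda>t. Re (inner_L2 a (?q t) (P (?q t)))) \<longlongrightarrow> Re (inner_L2 a (dPhi a k v s) (P (dPhi a k v s)))) (at 0)"
    by (intro tendsto_Re tendsto_inner_L2[OF L2_Phi_quotient PL[OF L2_Phi_quotient] L2_dPhi PL[OF L2_dPhi]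
          tendsto_Phi_quotient[OF a] tendsto_P_Phi_quotient])
  show "\<forall>\<^sub>F t in at 0. Re (inner_L2 a (?q t) (P (?q t))) = Re (inner_L2 a (?u t) (P (?u t))) / t\<^sup>2"
    unfolding eventually_at_filter
  proof (rule always_eventually, intro allI impI)
    fix t :: real assume t: "t \<noteq> 0"
    let ?c = "1 / complex_of_real t"
    let ?w = "\<lambda>r. ?u t r - ?p r"
    have wL: "?w \<in> L2 a" by (intro L2_diff L2_Phi)
    have z: "inner_L2 a f (P ?p) = 0" if "f \<in> L2 a" for f
      by (rule inner_L2_null_right[OF that PL[OF L2_Phi] null])
    have q: "?q t = (\<lambda>r. ?c * ?w r)" by (simp add: Phi_quotient_def)
    have "inner_L2 a (?q t) (P (?q t)) = cnj ?c * (?c * inner_L2 a ?w (P ?w))"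
      unfolding q inner_L2_scale_left inner_L2_bounded_op_scale[OF projector_bounded_op wL wL] by simp
    also have "inner_L2 a ?w (P ?w) = inner_L2 a ?w (P (?u t))"
      by (simp add: inner_L2_bounded_op_diff[OF projector_bounded_op L2_Phi L2_Phi wL] z wL)
    also have "\<dots> = inner_L2 a (?u t) (P (?u t)) - inner_L2 a ?p (P (?u t))"
      by (rule inner_L2_diff_left[OF PL[OF L2_Phi] L2_Phi L2_Phi])
    also have "inner_L2 a ?p (P (?u t)) = cnj (inner_L2 a (?u t) (P ?p))"
      by (subst projector_self_adjoint[OF L2_Phi L2_Phi]) (rule inner_L2_commute)
    also have "\<dots> = 0" by (simp add: z L2_Phi)
    also have "cnj ?c * (?c * (inner_L2 a (?u t) (P (?u t)) - 0))
        = inner_L2 a (?u t) (P (?u t)) / complex_of_real (t\<^sup>2)"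
      by (simp add: power2_eq_square)
    finally show "Re (inner_L2 a (?q t) (P (?q t))) = Re (inner_L2 a (?u t) (P (?u t))) / t\<^sup>2"
      by (simp only: Re_divide_of_real)
  qed
qed

context
  fixes s :: "real^3"
  assumes null: "norm_L2 a (P (Phi a k s)) = 0" "norm_L2 a (P (Phi a k (- s))) = 0"
begin

lemma tendsto_null_prob_derivative:
  "((\<lambda>t. prob_derivative a k P w (s + t *\<^sub>R transverse v) / t) \<longlongrightarrow> fisher_form a k P s w v) (at 0)"
  unfolding prob_derivative_def fisher_form_def uminus_add_transverse add_divide_distrib
  by (intro tendsto_add tendsto_null_linear null)

lemma tendsto_null_prob:
  "((\<lambda>t. prob a k P (s + t *\<^sub>R transverse v) / t\<^sup>2) \<longlongrightarrow> fisher_form a k P s v v / 2) (at 0)"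
proof -
  let ?g = "\<lambda>s. Re (inner_L2 a (Phi a k s) (P (Phi a k s)))"
  have "((\<lambda>t. (?g (s + t *\<^sub>R transverse v) / t\<^sup>2 + ?g (- s + t *\<^sub>R transverse (- v)) / t\<^sup>2) / 2)
    \<longlongrightarrow> fisher_form a k P s v v / 2) (at 0)"
    unfolding fisher_form_def by (intro tendsto_divide tendsto_add tendsto_null_quadratic null tendsto_const) simp
  moreover have "(?g (s + t *\<^sub>R transverse v) / t\<^sup>2 + ?g (- s + t *\<^sub>R transverse (- v)) / t\<^sup>2) / 2
      = prob a k P (s + t *\<^sub>R transverse v) / t\<^sup>2" for t
    unfolding prob_eq[OF P] uminus_add_transverse by (simp add: add_divide_distrib)
  ultimately show ?thesis by simp
qed

text \<open>The first derivative vanishes at s, so its difference quotient is its value divided by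
  t, whose limit is known.\<close>

lemma hessian_null: "hessian (prob a k P) s = (\<chi> p q. fisher_form a k P s (axis q 1) (axis p 1))"
proof -
  have "partial p (partial q (prob a k P)) s = fisher_form a k P s (axis q 1) (axis p 1)" for p q
  proof -
    have "((\<lambda>t. prob_derivative a k P (axis q 1) (s + t *\<^sub>R transverse (axis p 1))) has_real_derivative
        fisher_form a k P s (axis q 1) (axis p 1)) (at 0)"
      unfolding DERIV_def
      using tendsto_null_prob_derivative[of "axis q 1" "axis p 1"] null_prob_derivative[OF null] by simp
    then show ?thesis
      unfolding partial_def[of p] partial_prob by (rule DERIV_imp_deriv)
  qed
  then show ?thesis by (simp add: hessian_def)
qed

text \<open>Numerator and denominator vanish to second order; dividing both by \<open>t^2\<close>
  resolves the quotient.\<close>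

lemma tendsto_classical_fisher_null:
  assumes "fisher_form a k P s v v \<noteq> 0"
  shows "((\<lambda>t. classical_fisher a k P (s + t *\<^sub>R transverse v)) \<longlongrightarrow>
    (\<chi> i j. fisher_form a k P s (axis i 1) v * fisher_form a k P s (axis j 1) v
      / (fisher_form a k P s v v / 2))) (at 0)"
proof (intro vec_tendstoI)
  fix i j
  let ?s = "\<lambda>t. s + t *\<^sub>R transverse v" and ?D = "\<lambda>i. prob_derivative a k P (axis i 1)"
  have "((\<lambda>t. (?D i (?s t) / t) * (?D j (?s t) / t) / (prob a k P (?s t) / t\<^sup>2)) \<longlongrightarrow>
     fisher_form a k P s (axis i 1) v * fisher_form a k P s (axis j 1) v
      / (fisher_form a k P s v v / 2)) (at 0)"
    using assms by (intro tendsto_divide tendsto_mult tendsto_null_prob_derivative tendsto_null_prob) simp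
  moreover have "\<forall>\<^sub>F t in at 0. (?D i (?s t) / t) * (?D j (?s t) / t) / (prob a k P (?s t) / t\<^sup>2)
      = classical_fisher a k P (?s t) $ i $ j"
    unfolding eventually_at_filter classical_fisher_def partial_prob
    by (rule always_eventually) (simp add: power2_eq_square)
  ultimately show "((\<lambda>t. classical_fisher a k P (?s t) $ i $ j) \<longlongrightarrow>
     (\<chi> i j. fisher_form a k P s (axis i 1) v * fisher_form a k P s (axis j 1) v
      / (fisher_form a k P s v v / 2)) $ i $ j) (at 0)"
    by (simp add: Lim_transform_eventually)
qed

end

text \<open>At a point of positive probability with zero gradient the classical information tends to
  0 by continuity, so the quantum limit has to vanish too; this is what the assumption on
  \<open>fisher_form\<close> provides.\<close>

lemma saturated_at_regular:
  assumes "k > 0" and T: "\<And>i s. s \<noteq> 0 \<Longrightarrow> is_sld a k i s (L i s)"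
    and pos: "prob a k P (vector [0, 0, \<sigma>]) > 0"
    and D0: "\<And>i. prob_derivative a k P (axis i 1) (vector [0, 0, \<sigma>]) = 0"
    and F0: "\<And>i j. fisher_form a k P (vector [0, 0, \<sigma>]) (axis i 1) (axis j 1) = 0"
  shows "saturated_at a k L P (vector [0, 0, \<sigma>])"
proof -
  let ?s = "vector [0, 0, \<sigma>] :: real^3"
  have "equal_limits a k L P ?s v" if v: "v \<noteq> 0" for v
    unfolding equal_limits_def
  proof (intro exI conjI)
    have "((\<lambda>t. quantum_bound a k L P (?s + t *\<^sub>R transverse v))
      \<longlongrightarrow> (\<chi> i j. 2 * fisher_form a k P ?s (axis i 1) (axis j 1))) (at 0)"
      by (rule tendsto_quantum_bound[OF assms(1) T v])
    then show "((\<lambda>t. quantum_bound a k L P (?s + t *\<^sub>R transverse v)) \<longlongrightarrow> 0) (at 0)"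
      by (simp add: F0 zero_vec_def)
    show "((\<lambda>t. classical_fisher a k P (?s + t *\<^sub>R transverse v)) \<longlongrightarrow> 0) (at 0)"
    proof (intro vec_tendstoI)
      fix i j
      let ?D = "\<lambda>i. prob_derivative a k P (axis i 1)"
      have "((\<lambda>t. ?D i (?s + t *\<^sub>R transverse v) * ?D j (?s + t *\<^sub>R transverse v)
          / prob a k P (?s + t *\<^sub>R transverse v)) \<longlongrightarrow> ?D i ?s * ?D j ?s / prob a k P ?s) (at 0)"
        using pos by (intro tendsto_divide tendsto_mult tendsto_prob_derivative tendsto_prob) simp
      then show "((\<lambda>t. classical_fisher a k P (?s + t *\<^sub>R transverse v) $ i $ j) \<longlongrightarrow> 0 $ i $ j) (at 0)"
        by (simp add: classical_fisher_def partial_prob D0)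
    qed
  qed
  then show ?thesis using pos by (simp add: saturated_at_def)
qed

text \<open>The form has a single entry c, at (m,m). If c = 0, the Hessian and the quantum limit
  vanish together. Otherwise a direction with positive Hessian has nonzero m-th component, and both
  limits have the single entry 2c.\<close>

lemma saturated_at_null:
  assumes "k > 0" and T: "\<And>i s. s \<noteq> 0 \<Longrightarrow> is_sld a k i s (L i s)"
    and null: "norm_L2 a (P (Phi a k (vector [0, 0, \<sigma>]))) = 0"
      "norm_L2 a (P (Phi a k (- vector [0, 0, \<sigma>]))) = 0"
    and F: "\<And>i j. i \<noteq> m \<or> j \<noteq> m \<Longrightarrow> fisher_form a k P (vector [0, 0, \<sigma>]) (axis i 1) (axis j 1) = 0"
  shows "saturated_at a k L P (vector [0, 0, \<sigma>])"
proof -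
  let ?s = "vector [0, 0, \<sigma>] :: real^3"
  let ?F = "fisher_form a k P ?s"
  define c where "c = ?F (axis m 1) (axis m 1)"
  have Fij: "?F (axis i 1) (axis j 1) = (if i = m \<and> j = m then c else 0)" for i j
    using F by (auto simp: c_def)
  have Fv: "?F (axis i 1) v = (if i = m then c * v$m else 0)" for i v
  proof -
    have v: "v = v$1 *\<^sub>R axis 1 1 + v$2 *\<^sub>R axis 2 1"
      by (simp add: vec_eq_iff forall_2 axis_def)
    have "?F (axis i 1) v = v$1 * ?F (axis i 1) (axis 1 1) + v$2 * ?F (axis i 1) (axis 2 1)"
      by (subst v) (simp add: fisher_form_add_right fisher_form_scale_right)
    then show ?thesis
      using exhaust_2[of m] by (auto simp: Fij mult.commute)
  qed
  have Fvv: "?F v v = c * (v$m)\<^sup>2" for v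
  proof -
    have v: "v = v$1 *\<^sub>R axis 1 1 + v$2 *\<^sub>R axis 2 1"
      by (simp add: vec_eq_iff forall_2 axis_def)
    have "?F v v = v$1 * ?F v (axis 1 1) + v$2 * ?F v (axis 2 1)"
      by (subst (2) v) (simp add: fisher_form_add_right fisher_form_scale_right)
    then show ?thesis
      using exhaust_2[of m]
      by (auto simp: fisher_form_commute[of ?s v "axis 1 1"] fisher_form_commute[of ?s v "axis 2 1"]
          Fv power2_eq_square)
  qed
  have H: "hessian (prob a k P) ?s = (\<chi> p q. if p = m \<and> q = m then c else 0)"
    unfolding hessian_null[OF null] by (simp add: vec_eq_iff Fij)
  have Q: "((\<lambda>t. quantum_bound a k L P (?s + t *\<^sub>R transverse v))
      \<longlongrightarrow> (\<chi> i j. if i = m \<and> j = m then 2 * c else 0)) (at 0)" if "v \<noteq> 0" for v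
  proof -
    have "(\<chi> i j. 2 * ?F (axis i 1) (axis j 1)) = (\<chi> i j. if i = m \<and> j = m then 2 * c else 0)"
      by (simp add: vec_eq_iff Fij)
    then show ?thesis using tendsto_quantum_bound[OF assms(1) T that] by metis
  qed
  have "equal_limits a k L P ?s v"
    if "(\<Sum>p\<in>UNIV. \<Sum>q\<in>UNIV. hessian (prob a k P) ?s $ p $ q * v $ p * v $ q) > 0" for v
  proof -
    have "(\<Sum>p\<in>UNIV. \<Sum>q\<in>UNIV. hessian (prob a k P) ?s $ p $ q * v $ p * v $ q) = c * v$m * v$m"
      using exhaust_2[of m] by (auto simp: H sum_2)
    then have cv: "c * v$m * v$m > 0" using that by simp
    then have nz: "c \<noteq> 0" "v$m \<noteq> 0" by auto
    then have v0: "v \<noteq> 0" by auto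
    \<comment> \<open>At (m,m) this reads \<open>(c v_m)^2 / (c v_m^2 / 2) = 2 c\<close>.\<close>
    have eq: "(\<chi> i j. ?F (axis i 1) v * ?F (axis j 1) v / (?F v v / 2))
        = (\<chi> i j. if i = m \<and> j = m then 2 * c else 0)"
      using nz by (simp add: vec_eq_iff Fv Fvv power2_eq_square)
    have "?F v v \<noteq> 0" using nz by (simp add: Fvv)
    then have "((\<lambda>t. classical_fisher a k P (?s + t *\<^sub>R transverse v))
        \<longlongrightarrow> (\<chi> i j. if i = m \<and> j = m then 2 * c else 0)) (at 0)"
      using tendsto_classical_fisher_null[OF null, of v] unfolding eq by simp
    then show ?thesis
      unfolding equal_limits_def using Q[OF v0] by blast
  qed
  moreover have "((\<lambda>t. quantum_bound a k L P (?s + t *\<^sub>R transverse v)) \<longlongrightarrow> 0) (at 0)"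
    if "hessian (prob a k P) ?s = 0" "v \<noteq> 0" for v
  proof -
    have "hessian (prob a k P) ?s $ m $ m = 0" using that(1) by simp
    then have "c = 0" by (simp add: H)
    then have "(\<chi> i j. if i = m \<and> j = m then 2 * c else 0) = (0 :: real^2^2)"
      by (simp add: vec_eq_iff)
    then show ?thesis using Q[OF that(2)] by simp
  qed
  ultimately show ?thesis
    using null_prob[OF null] by (simp add: saturated_at_def)
qed

end

text \<open>On the axis the second source only changes the sign of the third coordinate, so facts
  stated for arbitrary \<open>\<sigma>\<close> cover both sources.\<close>

lemma uminus_vector_axis: "- vector [0, 0, \<sigma>] = (vector [0, 0, - \<sigma>] :: real^3)"
  by (simp add: vec_eq_iff forall_3 vector_3)

theorem mainTheorem13:
  fixes a k s3 :: real
    and L :: "2 \<Rightarrow> real^3 \<Rightarrow> wave_op"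
    and P1 P2 P3 :: wave_op
  assumes "a > 0" and "k > 0"
    and "\<And>i s. s \<noteq> 0 \<Longrightarrow> is_sld a k i s (L i s)"
    and "odd_zernike_sum a 1 P2"
    and "odd_zernike_sum a (-1) P3"
    and "P1 = (\<lambda>f r. f r - P2 f r - P3 f r)"
  shows "\<forall>P\<in>{P1, P2, P3}. projector a P \<and> saturated_at a k L P (vector [0, 0, s3])"
proof -
  let ?s = "vector [0, 0, s3] :: real^3"
  note s2 = strong_sum_odd_zernike_sum(1)[OF assms(1,4)]
    and s3 = strong_sum_odd_zernike_sum(2)[OF assms(1,5)]
  note on = orthonormal_or_null_zernike[OF assms(1)]
  \<comment> \<open>\<open>P2\<close> and \<open>P3\<close> differ only in the coordinate i to which
    their family belongs.\<close>
  have null: "projector a P \<and> saturated_at a k L P ?s"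
    if P: "strong_sum a (normalized_zernike a i) P" for P i
  proof
    show proj: "projector a P" by (rule projector_strong_sum[OF on P])
    note sa = projector_self_adjoint[OF assms(1) proj] and PL = projector_L2[OF assms(1) proj]
    have kills: "inner_L2 a f (P (dPhi a k v (vector [0, 0, \<sigma>]))) = 0"
      if "j \<noteq> i" "v = axis j 1 \<or> v = - axis j 1" "f \<in> L2 a" for j v f \<sigma>
      by (rule inner_L2_null_right[OF that(3) PL[OF L2_dPhi] zernike_sum_kills_dPhi[OF assms(1) P that(1,2)]])
    \<comment> \<open>The right slot suffices, since symmetry of the form supplies the left
      one.\<close>
    have right: "fisher_form a k P ?s w (axis j 1) = 0" if "j \<noteq> i" for w j
      unfolding fisher_form_def uminus_vector_axis
      using kills[OF that _ L2_dPhi] by simp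
    show "saturated_at a k L P ?s"
    proof (rule saturated_at_null[OF assms(1) proj assms(2,3), where m=i])
      show "norm_L2 a (P (Phi a k ?s)) = 0" "norm_L2 a (P (Phi a k (- ?s))) = 0"
        unfolding uminus_vector_axis by (rule zernike_sum_kills_Phi[OF assms(1) P])+
      show "fisher_form a k P ?s (axis j 1) (axis l 1) = 0" if "j \<noteq> i \<or> l \<noteq> i" for j l
        using that right fisher_form_commute[OF assms(1) proj] by metis
    qed
  qed
  have "projector a P1 \<and> saturated_at a k L P1 ?s"
  proof
    show proj: "projector a P1"
      unfolding assms(6)
      by (rule projector_complement_strong_sums[OF on s2 on s3])
         (rule normalized_zernike_cross_orthogonal[OF assms(1)], simp)
    note sa = projector_self_adjoint[OF assms(1) proj] and PL = projector_L2[OF assms(1) proj]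
    note b2 = bounded_op_L2[OF strong_sum_bounded_op[OF on s2]]
      and b3 = bounded_op_L2[OF strong_sum_bounded_op[OF on s3]]
    have split: "inner_L2 a f (P1 g) = inner_L2 a f g - inner_L2 a f (P2 g) - inner_L2 a f (P3 g)"
      if "f \<in> L2 a" "g \<in> L2 a" for f g
      unfolding assms(6) using that by (simp add: inner_L2_diff_right L2_diff b2 b3)
    \<comment> \<open>One of the two sums fixes the derivative and the other annihilates it, so the
      complement cancels it.\<close>
    have kills: "inner_L2 a f (P1 (dPhi a k v (vector [0, 0, \<sigma>]))) = 0"
      if v: "v = axis j 1 \<or> v = - axis j 1" and f: "f \<in> L2 a" for j v f \<sigma>
    proof -
      let ?d = "dPhi a k v (vector [0, 0, \<sigma>])"
      consider "j = 1" | "j = 2" using exhaust_2[of j] by blast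
      then show ?thesis
      proof cases
        case 1
        have "inner_L2 a f (P2 ?d) = inner_L2 a f ?d"
          using v 1 by (intro inner_L2_cong_right[OF f b2[OF L2_dPhi] L2_dPhi]
              zernike_sum_fixes_dPhi[OF assms(1) s2]) simp
        moreover have "inner_L2 a f (P3 ?d) = 0"
          using v 1 by (intro inner_L2_null_right[OF f b3[OF L2_dPhi]]
              zernike_sum_kills_dPhi[OF assms(1) s3, of 1]) simp_all
        ultimately show ?thesis by (simp add: split f L2_dPhi)
      next
        case 2
        have "inner_L2 a f (P3 ?d) = inner_L2 a f ?d"
          using v 2 by (intro inner_L2_cong_right[OF f b3[OF L2_dPhi] L2_dPhi]
              zernike_sum_fixes_dPhi[OF assms(1) s3]) simp
        moreover have "inner_L2 a f (P2 ?d) = 0"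
          using v 2 by (intro inner_L2_null_right[OF f b2[OF L2_dPhi]]
              zernike_sum_kills_dPhi[OF assms(1) s2, of 2]) simp_all
        ultimately show ?thesis by (simp add: split f L2_dPhi)
      qed
    qed
    \<comment> \<open>Both sums annihilate \<open>Phi\<close>, so on the axis \<open>P1\<close> has
      probability 1 and is regular.\<close>
    have unit: "inner_L2 a (Phi a k (vector [0, 0, \<sigma>])) (P1 (Phi a k (vector [0, 0, \<sigma>]))) = 1" for \<sigma>
    proof -
      let ?p = "Phi a k (vector [0, 0, \<sigma>])"
      have "inner_L2 a ?p (P2 ?p) = 0"
        by (rule inner_L2_null_right[OF L2_Phi b2[OF L2_Phi] zernike_sum_kills_Phi[OF assms(1) s2]])
      moreover have "inner_L2 a ?p (P3 ?p) = 0"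
        by (rule inner_L2_null_right[OF L2_Phi b3[OF L2_Phi] zernike_sum_kills_Phi[OF assms(1) s3]])
      ultimately show ?thesis
        using assms(1) by (simp add: split L2_Phi inner_L2_self norm_L2_Phi)
    qed
    have kills': "inner_L2 a (dPhi a k v (vector [0, 0, \<sigma>])) (P1 f) = 0"
      if "v = axis j 1 \<or> v = - axis j 1" "f \<in> L2 a" for j v f \<sigma>
      using kills[OF that] sa[OF L2_dPhi that(2)]
        inner_L2_commute[of a "P1 (dPhi a k v (vector [0, 0, \<sigma>]))" f] by simp
    show "saturated_at a k L P1 ?s"
    proof (rule saturated_at_regular[OF assms(1) proj assms(2,3)])
      show "prob a k P1 ?s > 0"
        unfolding prob_eq[OF proj] uminus_vector_axis unit by simp
      show "prob_derivative a k P1 (axis i 1) ?s = 0" for i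
        unfolding prob_derivative_def uminus_vector_axis
        using kills'[of "axis i 1" i] kills'[of "- axis i 1" i] by (simp add: L2_Phi)
      show "fisher_form a k P1 ?s (axis i 1) (axis j 1) = 0" for i j
        unfolding fisher_form_def uminus_vector_axis
        using kills[of "axis j 1" j] kills[of "- axis j 1" j] by (simp add: L2_dPhi)
    qed
  qed
  then show ?thesis using null[OF s2] null[OF s3] by simp
qed

end
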